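(* For every finite irreducible reversible Markov chain $(\Omega,P,\pi)$ and every $x\in\Omega$, $$\rho_x\le\tau_{2,x}\le\bar\rho_x+5\,t_{\mathrm{rel}}\le\rho_x+8\kappa+(5+6\log2)\,t_{\mathrm{rel}} .$$ The same holds when $x$ is omitted from all of the terms, i.e. $\rho\le\tau_2\le\bar\rho+5\,t_{\mathrm{rel}}\le\rho+8\kappa+(5+6\log2)\,t_{\mathrm{rel}}$. Consequently, $$\rho\le\tau_2\le(9+15/\log2)\,\rho .$$
   Context: Setting: $P$ is an irreducible transition matrix on a finite set $\Omega$ (with $|\Omega|\ge2$ implicit), reversible with respect to its stationary distribution $\pi$. The chain is run in continuous time: $(X_t)_{t\ge0}$ has heat kernel $H_t=e^{-t(I-P)}$; $\mathrm P_x$ is its law started at $x$, $\mathrm P_x^t=H_t(x,\cdot)$, $T_A=\inf\{t\ge0:X_t\in A\}$, $T_b=T_{\{b\}}$. A nonempty $A\subset\Omega$ is connected if $\mathrm P_a[T_b<T_{A^c}]>0$ for all $a,b\in A$; $\mathrm{Con}_{1/2}$ is the collection of connected $A$ with $\pi(A)\le1/2$. $\tau_{2,x}=\min\{t\ge0:\|\mathrm P_x^t-\pi\|_{2,\pi}\le1/2\}$, where $\|\sigma\|_{2,\pi}=\big(\sum_y\pi(y)(\sigma(y)/\pi(y))^2\big)^{1/2}$, and $\tau_2=\max_x\tau_{2,x}$. $$\rho_x=\min\{t\ge0:\mathrm P_x[T_{A^c}>t]\le\pi(A)+\tfrac12\sqrt{\pi(A)\pi(A^c)}\ \ \forall A\in\mathrm{Con}_{1/2}\},\qquad\rho=\max_x\rho_x,$$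 $$\bar\rho_x=\min\{t\ge0:\mathrm P_x[T_{A^c}>t]\le\pi(A)^3\ \ \forall A\in\mathrm{Con}_{1/2}\},\qquad\bar\rho=\max_x\bar\rho_x.$$ $t_{\mathrm{rel}}=1/\lambda$ with $\lambda$ the smallest non-zero eigenvalue of $I-P$. For nonempty $A\subsetneq\Omega$, $\lambda(A)$ is the smallest eigenvalue of $I-P_A$, with $P_A$ the restriction of $P$ to $A$; $\kappa=\max_{A\in\mathrm{Con}_{1/2}}|\log\pi(A)|/\lambda(A)$. *)

theory Defs
  imports "HOL-Probability.Probability"
begin

text \<open>
  The finite state space is the universe of a type of class \<^class>\<open>finite\<close>; matrices are indexed as
  \<open>P $ x $ y\<close> with \<open>x\<close> the row (the starting state).
\<close>

definition mat_power :: "real^'a^'a \<Rightarrow> nat \<Rightarrow> real^'a^'a" where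
  "mat_power A k = (((**) A) ^^ k) (mat 1)"

definition transition_matrix :: "real^'a^'a \<Rightarrow> bool" where
  "transition_matrix P \<longleftrightarrow> (\<forall>x y. 0 \<le> P $ x $ y) \<and> (\<forall>x. (\<Sum>y\<in>UNIV. P $ x $ y) = 1)"

definition irreducible_matrix :: "real^'a^'a \<Rightarrow> bool" where
  "irreducible_matrix P \<longleftrightarrow> (\<forall>x y. \<exists>k. 0 < mat_power P k $ x $ y)"

definition stationary_distribution :: "real^'a^'a \<Rightarrow> real^'a \<Rightarrow> bool" where
  "stationary_distribution P \<pi> \<longleftrightarrow>
     (\<forall>x. 0 \<le> \<pi> $ x) \<and> (\<Sum>x\<in>UNIV. \<pi> $ x) = 1 \<and> \<pi> v* P = \<pi>"

definition reversible_wrt :: "real^'a^'a \<Rightarrow> real^'a \<Rightarrow> bool" where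
  "reversible_wrt P \<pi> \<longleftrightarrow> (\<forall>x y. \<pi> $ x * P $ x $ y = \<pi> $ y * P $ y $ x)"

definition mass :: "real^'a \<Rightarrow> 'a set \<Rightarrow> real" where
  "mass \<pi> A = (\<Sum>x\<in>A. \<pi> $ x)"

text \<open>
  \<open>exp (- t (I - P))\<close> as a power series; \<^typ>\<open>real^'a^'a\<close> is not an instance of the type class
  on which \<^const>\<open>exp\<close> is defined.
\<close>

definition heat_kernel :: "real^'a^'a \<Rightarrow> real \<Rightarrow> real^'a^'a" where
  "heat_kernel P t = (\<Sum>k. ((- t) ^ k / fact k) *\<^sub>R mat_power (mat 1 - P) k)"

text \<open>
  \<open>X\<close> is the coordinate process and \<open>Pr x\<close> its law started at \<open>x\<close>: the paths are right-continuous
  for the discrete topology, and under \<open>Pr x\<close> the finite-dimensional distributions are those of the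
  Markov chain with heat kernel \<open>H\<^sub>t = exp (- t (I - P))\<close>. The choice \<open>n = 0\<close>, \<open>t 0 = 0\<close> gives
  \<open>X\<^sub>0 = x\<close> almost surely, since \<open>H\<^sub>0 = I\<close>. Only times \<open>t \<ge> 0\<close> matter.
\<close>

definition continuous_time_chain ::
    "real^'a^'a \<Rightarrow> ('a \<Rightarrow> 'w measure) \<Rightarrow> (real \<Rightarrow> 'w \<Rightarrow> 'a) \<Rightarrow> bool" where
  "continuous_time_chain P Pr X \<longleftrightarrow> (\<forall>x.
     prob_space (Pr x) \<and>
     (\<forall>t\<ge>0. X t \<in> measurable (Pr x) (count_space UNIV)) \<and>
     (\<forall>\<omega>\<in>space (Pr x). \<forall>t\<ge>0. \<forall>\<^sub>F s in at_right t. X s \<omega> = X t \<omega>) \<and>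
     (\<forall>(n::nat) (t::nat \<Rightarrow> real) (y::nat \<Rightarrow> 'a).
        0 \<le> t 0 \<longrightarrow> (\<forall>i<n. t i \<le> t (Suc i)) \<longrightarrow>
        \<P>(\<omega> in Pr x. \<forall>i\<le>n. X (t i) \<omega> = y i) =
          heat_kernel P (t 0) $ x $ y 0 *
          (\<Prod>i<n. heat_kernel P (t (Suc i) - t i) $ y i $ y (Suc i))))"

text \<open>The hitting time is extended-real valued: it is \<open>\<infinity>\<close> if \<open>A\<close> is never visited.\<close>

definition hitting_time :: "(real \<Rightarrow> 'w \<Rightarrow> 'a) \<Rightarrow> 'a set \<Rightarrow> 'w \<Rightarrow> ereal" where
  "hitting_time X A \<omega> = Inf {ereal t | t. 0 \<le> t \<and> X t \<omega> \<in> A}"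

definition connected_set :: "('a \<Rightarrow> 'w measure) \<Rightarrow> (real \<Rightarrow> 'w \<Rightarrow> 'a) \<Rightarrow> 'a set \<Rightarrow> bool" where
  "connected_set Pr X A \<longleftrightarrow> A \<noteq> {} \<and>
     (\<forall>a\<in>A. \<forall>b\<in>A. 0 < \<P>(\<omega> in Pr a. hitting_time X {b} \<omega> < hitting_time X (- A) \<omega>))"

definition Con_half ::
    "real^'a \<Rightarrow> ('a \<Rightarrow> 'w measure) \<Rightarrow> (real \<Rightarrow> 'w \<Rightarrow> 'a) \<Rightarrow> 'a set set" where
  "Con_half \<pi> Pr X = {A. connected_set Pr X A \<and> mass \<pi> A \<le> 1/2}"

text \<open>The norm of a signed measure \<open>\<sigma>\<close>.\<close>

definition norm_2 :: "real^'a \<Rightarrow> real^'a \<Rightarrow> real" where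
  "norm_2 \<pi> \<sigma> = sqrt (\<Sum>y\<in>UNIV. \<pi> $ y * (\<sigma> $ y / \<pi> $ y)\<^sup>2)"

definition tau2_at :: "real^'a^'a \<Rightarrow> real^'a \<Rightarrow> 'a \<Rightarrow> real" where
  "tau2_at P \<pi> x = (LEAST t. 0 \<le> t \<and> norm_2 \<pi> (heat_kernel P t $ x - \<pi>) \<le> 1/2)"

definition tau2 :: "real^'a^'a \<Rightarrow> real^'a \<Rightarrow> real" where
  "tau2 P \<pi> = (MAX x. tau2_at P \<pi> x)"

definition rho_at ::
    "real^'a \<Rightarrow> ('a \<Rightarrow> 'w measure) \<Rightarrow> (real \<Rightarrow> 'w \<Rightarrow> 'a) \<Rightarrow> 'a \<Rightarrow> real" where
  "rho_at \<pi> Pr X x = (LEAST t. 0 \<le> t \<and> (\<forall>A\<in>Con_half \<pi> Pr X.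
     \<P>(\<omega> in Pr x. hitting_time X (- A) \<omega> > ereal t)
       \<le> mass \<pi> A + 1/2 * sqrt (mass \<pi> A * mass \<pi> (- A))))"

definition rho :: "real^'a \<Rightarrow> ('a \<Rightarrow> 'w measure) \<Rightarrow> (real \<Rightarrow> 'w \<Rightarrow> 'a) \<Rightarrow> real" where
  "rho \<pi> Pr X = (MAX x. rho_at \<pi> Pr X x)"

definition rho_bar_at ::
    "real^'a \<Rightarrow> ('a \<Rightarrow> 'w measure) \<Rightarrow> (real \<Rightarrow> 'w \<Rightarrow> 'a) \<Rightarrow> 'a \<Rightarrow> real" where
  "rho_bar_at \<pi> Pr X x = (LEAST t. 0 \<le> t \<and> (\<forall>A\<in>Con_half \<pi> Pr X.
     \<P>(\<omega> in Pr x. hitting_time X (- A) \<omega> > ereal t) \<le> mass \<pi> A ^ 3))"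

definition rho_bar :: "real^'a \<Rightarrow> ('a \<Rightarrow> 'w measure) \<Rightarrow> (real \<Rightarrow> 'w \<Rightarrow> 'a) \<Rightarrow> real" where
  "rho_bar \<pi> Pr X = (MAX x. rho_bar_at \<pi> Pr X x)"

text \<open>
  \<open>l\<close> is a (real) eigenvalue of the submatrix of \<open>M\<close> with rows and columns in \<open>A\<close>; the values of
  the eigenvector \<open>f\<close> outside \<open>A\<close> are irrelevant. The eigenvalues of \<open>I - P\<close> and of its
  principal submatrices are all real by reversibility.
\<close>

definition eigenvalue_on :: "'a set \<Rightarrow> real^'a^'a \<Rightarrow> real \<Rightarrow> bool" where
  "eigenvalue_on A M l \<longleftrightarrow>
     (\<exists>f::real^'a. (\<exists>x\<in>A. f $ x \<noteq> 0) \<and> (\<forall>x\<in>A. (\<Sum>y\<in>A. M $ x $ y * f $ y) = l * f $ x))"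

definition t_rel :: "real^'a^'a \<Rightarrow> real" where
  "t_rel P = 1 / (LEAST l. l \<noteq> 0 \<and> eigenvalue_on UNIV (mat 1 - P) l)"

definition lambda_on :: "real^'a^'a \<Rightarrow> 'a set \<Rightarrow> real" where
  "lambda_on P A = (LEAST l. eigenvalue_on A (mat 1 - P) l)"

definition kappa ::
    "real^'a^'a \<Rightarrow> real^'a \<Rightarrow> ('a \<Rightarrow> 'w measure) \<Rightarrow> (real \<Rightarrow> 'w \<Rightarrow> 'a) \<Rightarrow> real" where
  "kappa P \<pi> Pr X = (MAX A\<in>Con_half \<pi> Pr X. \<bar>ln (mass \<pi> A)\<bar> / lambda_on P A)"

end

theory Submission
  imports Defs
begin

text \<open>
  Every quantity in the theorem becomes analytic once exit times are read off killed semigroups.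
  For a substochastic matrix \<open>R\<close> let \<open>flow R t = exp (- t (I - R))\<close>. If \<open>R\<close> is the restriction of
  \<open>P\<close> to \<open>A\<close>, then \<open>P\<^sub>x[T > t]\<close>, for \<open>T\<close> the exit time from \<open>A\<close>, is \<open>flow R t 1\<^sub>A x\<close>, called
  \<open>survival A t x\<close> below. Right-continuity lets dyadic observation times detect the exit, and the
  chains observed along finer and finer grids converge to the killed semigroup
  (\<open>tail_prob\<close>, \<open>killed_limit\<close>). Only connected \<open>A\<close> enter the definitions of \<open>\<rho>\<close> and of the
  cubic variant \<open>\<rho>'\<close> (\<open>rho_bar\<close>), but surviving in \<open>A\<close> from \<open>x\<close> is the same as surviving in the
  connected component of \<open>x\<close>, so the bounds hold for all \<open>A\<close> of mass at most \<open>1/2\<close>.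

  The bound \<open>\<rho>\<^sub>x \<le> \<tau>\<^sub>x\<close> is Cauchy-Schwarz, since surviving in \<open>A\<close> until \<open>t\<close> forces \<open>X\<^sub>t \<in> A\<close>.

  For \<open>\<tau>\<^sub>x \<le> \<rho>'\<^sub>x + 5 t\<^sub>r\<^sub>e\<^sub>l\<close> put \<open>t = \<rho>'\<^sub>x\<close>, \<open>s = 5 t\<^sub>r\<^sub>e\<^sub>l\<close>, and let \<open>f\<close> be the centred density of
  \<open>P\<^sub>x\<close> at time \<open>t + s\<close>, so that \<open>\<parallel>f\<parallel>\<^sup>2 = H\<^sub>t F x\<close> with \<open>F = H\<^sub>s f\<close> and
  \<open>\<parallel>F\<parallel> \<le> exp (- 5) \<parallel>f\<parallel>\<close>. A maximal inequality of Starr type in exponent \<open>4/3\<close>, applied to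
  \<open>\<bar>F\<bar>\<close> raised to the power \<open>3/2\<close>, makes the level sets \<open>A\<^sub>0 \<supseteq> A\<^sub>1 \<supseteq> \<dots>\<close> of its maximal function
  small. Starting from \<open>x\<close>, the chain either has left \<open>A\<^sub>i\<close> before \<open>t\<close>, and then the mean of that
  power at time \<open>t\<close> is at most the level, or has not, which has probability at most the cube of the
  mass of \<open>A\<^sub>i\<close>. Hoelder with exponents \<open>3/2\<close> and \<open>3\<close> removes the cube, and the resulting
  geometric series gives \<open>H\<^sub>t \<bar>F\<bar> x \<le> 26 \<parallel>F\<parallel>\<close>, whence \<open>\<parallel>f\<parallel> \<le> 26 exp (- 5) \<le> 1/2\<close>
  (\<open>maximal_inequality\<close>, \<open>layered_bound\<close>, \<open>l2_dist_le_half\<close>).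

  For \<open>\<rho>'\<^sub>x \<le> \<rho>\<^sub>x + 8 \<kappa>\<close> let \<open>B\<close> be the set of states from which survival in \<open>A\<close> for a time
  \<open>8 \<kappa>\<close> is not small. Spectral decay of the killed semigroup and Chebyshev bound its mass by a high
  power of the mass of \<open>A\<close>. By time \<open>\<rho>\<^sub>x\<close> the chain has probably left \<open>B\<close>, and after that it
  survives in \<open>A\<close> for another \<open>8 \<kappa>\<close> only with small probability (\<open>exits_rho_bar_level\<close>).

  Finally, eight successive attempts of length \<open>\<rho>\<close> give \<open>\<rho>' \<le> 8 \<rho>\<close>. A component of the positivity
  set of an eigenfunction for the spectral gap is left no faster than at the rate of the gap, which
  gives \<open>t\<^sub>r\<^sub>e\<^sub>l \<le> 4 \<rho>\<close>. Hence \<open>\<tau> \<le> 28 \<rho>\<close>, and \<open>28 \<le> 9 + 15 / ln 2\<close>.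
\<close>

section \<open>Matrix exponentials acting on functions\<close>

definition app :: "('a::finite \<Rightarrow> 'a \<Rightarrow> real) \<Rightarrow> ('a \<Rightarrow> real) \<Rightarrow> 'a \<Rightarrow> real" where
  "app R f x = (\<Sum>y\<in>UNIV. R x y * f y)"

definition ind :: "'a set \<Rightarrow> 'a \<Rightarrow> real" where
  "ind A x = (if x \<in> A then 1 else 0)"

definition expop :: "('a::finite \<Rightarrow> 'a \<Rightarrow> real) \<Rightarrow> real \<Rightarrow> ('a \<Rightarrow> real) \<Rightarrow> 'a \<Rightarrow> real" where
  "expop R t f x = (\<Sum>k. t ^ k / fact k * (app R ^^ k) f x)"

lemma app_add: "app R (\<lambda>y. f y + g y) x = app R f x + app R g x"
  by (simp add: app_def distrib_left sum.distrib)

lemma app_diff: "app R (\<lambda>y. f y - g y) x = app R f x - app R g x"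
  by (simp add: app_def right_diff_distrib sum_subtractf)

lemma app_cmult: "app R (\<lambda>y. c * f y) x = c * app R f x"
  by (simp add: app_def sum_distrib_left algebra_simps)

lemma app_sum: "app R (\<lambda>y. \<Sum>i\<in>I. f i y) x = (\<Sum>i\<in>I. app R (f i) x)"
  unfolding app_def by (simp add: sum_distrib_left sum.swap[of _ I UNIV])

lemma app_pow_Suc: "(app R ^^ Suc k) f x = (\<Sum>y\<in>UNIV. R x y * (app R ^^ k) f y)"
  by (simp add: app_def[of R "(app R ^^ k) f" x])

lemma app_pow_add: "(app R ^^ k) (\<lambda>y. f y + g y) = (\<lambda>x. (app R ^^ k) f x + (app R ^^ k) g x)"
  by (induction k) (simp_all add: ext[OF app_add])

lemma app_pow_diff: "(app R ^^ k) (\<lambda>y. f y - g y) = (\<lambda>x. (app R ^^ k) f x - (app R ^^ k) g x)"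
  by (induction k) (simp_all add: ext[OF app_diff])

lemma app_pow_cmult: "(app R ^^ k) (\<lambda>y. c * f y) = (\<lambda>x. c * (app R ^^ k) f x)"
  by (induction k) (simp_all add: ext[OF app_cmult])

lemma app_pow_sum: "(app R ^^ k) (\<lambda>y. \<Sum>i\<in>I. f i y) = (\<lambda>x. \<Sum>i\<in>I. (app R ^^ k) (f i) x)"
  by (induction k) (simp_all add: ext[OF app_sum])

lemma app_pow_growth:
  "\<bar>(app R ^^ k) f x\<bar> \<le> (\<Sum>x\<in>UNIV. \<Sum>y\<in>UNIV. \<bar>R x y\<bar>) ^ k * (\<Sum>y\<in>UNIV. \<bar>f y\<bar>)"
proof (induction k arbitrary: x)
  case 0
  show ?case using member_le_sum[of x UNIV "\<lambda>y. \<bar>f y\<bar>"] by simp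
next
  case (Suc k)
  define C where "C = (\<Sum>x\<in>UNIV. \<Sum>y\<in>UNIV. \<bar>R x y\<bar>)"
  define F where "F = (\<Sum>y\<in>UNIV. \<bar>f y\<bar>)"
  have F0: "0 \<le> F" and C0: "0 \<le> C" by (simp_all add: F_def C_def sum_nonneg)
  have "\<bar>(app R ^^ Suc k) f x\<bar> \<le> (\<Sum>y\<in>UNIV. \<bar>R x y * (app R ^^ k) f y\<bar>)"
    by (simp add: app_def sum_abs)
  also have "\<dots> \<le> (\<Sum>y\<in>UNIV. \<bar>R x y\<bar> * (C ^ k * F))"
    using Suc by (intro sum_mono) (auto simp: abs_mult C_def F_def intro!: mult_left_mono)
  also have "\<dots> = (\<Sum>y\<in>UNIV. \<bar>R x y\<bar>) * (C ^ k * F)"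
    by (simp add: sum_distrib_right)
  also have "\<dots> \<le> C * (C ^ k * F)"
    unfolding C_def[symmetric]
    by (intro mult_right_mono)
       (use F0 C0 member_le_sum[of x UNIV "\<lambda>x. \<Sum>y\<in>UNIV. \<bar>R x y\<bar>"] in \<open>auto simp: C_def sum_nonneg\<close>)
  finally show ?case by (simp add: C_def F_def mult.assoc)
qed

lemma summable_expop: "summable (\<lambda>k. t ^ k / fact k * (app R ^^ k) f x)"
proof -
  define C where "C = (\<Sum>x\<in>UNIV. \<Sum>y\<in>UNIV. \<bar>R x y\<bar>)"
  define F where "F = (\<Sum>y\<in>UNIV. \<bar>f y\<bar>)"
  have s: "summable (\<lambda>k. (\<bar>t\<bar> * C) ^ k /\<^sub>R fact k * F)"
    by (intro summable_mult2 summable_exp_generic)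
  have "norm (t ^ k / fact k * (app R ^^ k) f x) \<le> (\<bar>t\<bar> * C) ^ k /\<^sub>R fact k * F" for k
  proof -
    have "norm (t ^ k / fact k * (app R ^^ k) f x) = \<bar>t\<bar> ^ k / fact k * \<bar>(app R ^^ k) f x\<bar>"
      by (simp add: abs_mult power_abs)
    also have "\<dots> \<le> \<bar>t\<bar> ^ k / fact k * (C ^ k * F)"
      using app_pow_growth[where R = R and k = k and f = f and x = x] by (intro mult_left_mono) (auto simp: C_def F_def)
    finally show ?thesis by (simp add: power_mult_distrib field_simps)
  qed
  then show ?thesis by (intro summable_comparison_test[OF _ s]) auto
qed

lemma expop_zero [simp]: "expop R 0 f x = f x"
proof -
  have "(\<lambda>k. 0 ^ k / fact k * (app R ^^ k) f x) sums (\<Sum>k\<in>{0}. 0 ^ k / fact k * (app R ^^ k) f x)"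
    by (rule sums_finite) auto
  then show ?thesis by (simp add: expop_def sums_iff)
qed

lemma expop_sums: "(\<lambda>k. t ^ k / fact k * (app R ^^ k) f x) sums expop R t f x"
  unfolding expop_def by (rule summable_sums[OF summable_expop])

lemma expop_add: "expop R t (\<lambda>y. f y + g y) x = expop R t f x + expop R t g x"
  using sums_add[OF expop_sums[of t R f x] expop_sums[of t R g x]]
    expop_sums[of t R "\<lambda>y. f y + g y" x]
  unfolding app_pow_add distrib_left by (rule sums_unique2[symmetric])

lemma expop_diff: "expop R t (\<lambda>y. f y - g y) x = expop R t f x - expop R t g x"
  using sums_diff[OF expop_sums[of t R f x] expop_sums[of t R g x]]
    expop_sums[of t R "\<lambda>y. f y - g y" x]
  unfolding app_pow_diff right_diff_distrib by (rule sums_unique2[symmetric])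

lemma expop_cmult: "expop R t (\<lambda>y. c * f y) x = c * expop R t f x"
  using sums_mult[OF expop_sums[of t R f x], of c] expop_sums[of t R "\<lambda>y. c * f y" x]
  unfolding app_pow_cmult mult.left_commute[of c] by (rule sums_unique2[symmetric])

lemma expop_sum:
  "expop R t (\<lambda>y. \<Sum>i\<in>I. f i y) x = (\<Sum>i\<in>I. expop R t (f i) x)"
  using sums_sum[where I = I, OF expop_sums[of t R "f _" x]]
    expop_sums[of t R "\<lambda>y. \<Sum>i\<in>I. f i y" x]
  unfolding app_pow_sum sum_distrib_left by (rule sums_unique2[symmetric])

lemma sum_ind_decomp: "f = (\<lambda>x. \<Sum>y\<in>UNIV. f y * ind {y} x)" for f :: "'a::finite \<Rightarrow> real"
proof
  fix x
  have "(\<Sum>y\<in>UNIV. f y * ind {y} x) = (\<Sum>y\<in>UNIV. if y = x then f y else 0)"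
    by (intro sum.cong) (auto simp: ind_def)
  then show "f x = (\<Sum>y\<in>UNIV. f y * ind {y} x)" by simp
qed

lemma expop_kernel: "app (\<lambda>x y. expop R t (ind {y}) x) f = expop R t f"
proof
  fix x
  have "expop R t f x = expop R t (\<lambda>x. \<Sum>y\<in>UNIV. f y * ind {y} x) x"
    by (subst sum_ind_decomp[of f]) simp
  also have "\<dots> = (\<Sum>y\<in>UNIV. f y * expop R t (ind {y}) x)"
    by (simp add: expop_sum expop_cmult)
  finally show "app (\<lambda>x y. expop R t (ind {y}) x) f x = expop R t f x"
    by (simp add: app_def mult.commute)
qed

lemma app_expop_commute: "expop R t (app R f) x = app R (expop R t f) x"
proof -
  have "(\<lambda>k. \<Sum>y\<in>UNIV. R x y * (t ^ k / fact k * (app R ^^ k) f y)) sums app R (expop R t f) x"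
    unfolding app_def[of R "expop R t f"] by (intro sums_sum sums_mult expop_sums)
  moreover have "(\<Sum>y\<in>UNIV. R x y * (t ^ k / fact k * (app R ^^ k) f y))
      = t ^ k / fact k * (app R ^^ k) (app R f) x" for k
  proof -
    have "(app R ^^ k) (app R f) x = app R ((app R ^^ k) f) x"
      by (metis funpow_swap1)
    then show ?thesis by (simp add: app_def[of R _ x] sum_distrib_left algebra_simps)
  qed
  ultimately show ?thesis using expop_sums[of t R "app R f" x] by (simp add: sums_unique2)
qed

lemma expop_deriv:
  "((\<lambda>t. expop R t f x) has_real_derivative app R (expop R t f) x) (at t)"
proof -
  define c where "c = (\<lambda>k. (app R ^^ k) f x / fact k)"
  have c: "expop R t f x = (\<Sum>k. c k * t ^ k)" for t
    by (simp add: expop_def c_def mult.commute)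
  have "((\<lambda>t. \<Sum>k. c k * t ^ k) has_real_derivative (\<Sum>k. diffs c k * t ^ k)) (at t)"
    using summable_expop[of _ R f x]
    by (intro termdiffs_strong_converges_everywhere) (simp add: c_def mult.commute)
  moreover have "diffs c k * t ^ k = t ^ k / fact k * (app R ^^ k) (app R f) x" for k
    by (simp add: diffs_def c_def funpow_swap1 fact_Suc field_simps del: of_nat_Suc)
  moreover have "(\<lambda>t. expop R t f x) = (\<lambda>t. \<Sum>k. c k * t ^ k)"
    using c by (rule ext)
  ultimately show ?thesis by (simp add: app_expop_commute[symmetric] expop_def)
qed

lemma gronwall:
  fixes \<phi> :: "real \<Rightarrow> real"
  assumes d: "\<And>t. 0 \<le> t \<Longrightarrow> (\<phi> has_real_derivative \<phi>' t) (at t)"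
    and le: "\<And>t. 0 \<le> t \<Longrightarrow> \<phi>' t \<le> c * \<phi> t" and t: "0 \<le> t"
  shows "\<phi> t \<le> exp (c * t) * \<phi> 0"
proof -
  have "exp (- c * t) * \<phi> t \<le> exp (- c * 0) * \<phi> 0"
  proof (rule DERIV_nonpos_imp_nonincreasing[OF t])
    fix s assume s: "0 \<le> s" "s \<le> t"
    have "((\<lambda>t. exp (- c * t) * \<phi> t) has_real_derivative exp (- c * s) * (\<phi>' s - c * \<phi> s)) (at s)"
      by (auto intro!: derivative_eq_intros d s simp: algebra_simps)
    moreover have "exp (- c * s) * (\<phi>' s - c * \<phi> s) \<le> 0"
      using le[of s] s by (simp add: mult_nonneg_nonpos)
    ultimately show "\<exists>y. ((\<lambda>t. exp (- c * t) * \<phi> t) has_real_derivative y) (at s) \<and> y \<le> 0"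
      by blast
  qed
  then have "exp (- c * t) * \<phi> t \<le> \<phi> 0" by simp
  then have "exp (c * t) * (exp (- c * t) * \<phi> t) \<le> exp (c * t) * \<phi> 0" by (intro mult_left_mono) auto
  moreover have "exp (c * t) * (exp (- c * t) * \<phi> t) = \<phi> t"
    by (simp add: exp_minus)
  ultimately show ?thesis by linarith
qed

text \<open>
  The energy of the difference of two solutions satisfies Gronwall's inequality and vanishes at time \<open>0\<close>.
  Only forward times matter, so the equation is assumed on \<open>[0, \<infinity>)\<close>; the
  semigroup law and the two descriptions of the heat kernel are instances of this uniqueness.
\<close>

lemma linear_ode_unique:
  fixes u v :: "real \<Rightarrow> 'a::finite \<Rightarrow> real"
  assumes u: "\<And>t x. 0 \<le> t \<Longrightarrow> ((\<lambda>t. u t x) has_real_derivative app M (u t) x) (at t)"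
    and v: "\<And>t x. 0 \<le> t \<Longrightarrow> ((\<lambda>t. v t x) has_real_derivative app M (v t) x) (at t)"
    and init: "u 0 = v 0" and t: "0 \<le> t"
  shows "u t = v t"
proof -
  define w where "w = (\<lambda>t x. u t x - v t x)"
  define C where "C = (\<Sum>x\<in>UNIV. \<Sum>y\<in>UNIV. \<bar>M x y\<bar>)"
  define \<phi> where "\<phi> = (\<lambda>t. \<Sum>x\<in>UNIV. (w t x)\<^sup>2)"
  define \<phi>' where "\<phi>' = (\<lambda>t. \<Sum>x\<in>UNIV. 2 * w t x * app M (w t) x)"
  have w: "((\<lambda>t. w t x) has_real_derivative app M (w t) x) (at t)" if "0 \<le> t" for t x
    unfolding w_def app_diff by (intro derivative_intros u v that)
  have d: "(\<phi> has_real_derivative \<phi>' t) (at t)" if "0 \<le> t" for t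
    unfolding \<phi>_def \<phi>'_def using that
    by (auto intro!: derivative_eq_intros w sum.cong simp: power2_eq_square)
  have le: "\<phi>' t \<le> (2 * C) * \<phi> t" for t
  proof -
    have "2 * w t x * (M x y * w t y) \<le> \<bar>M x y\<bar> * (2 * \<phi> t)" for x y
    proof -
      have "2 * \<bar>w t x\<bar> * \<bar>w t y\<bar> \<le> (w t x)\<^sup>2 + (w t y)\<^sup>2"
        using sum_squares_bound[of "\<bar>w t x\<bar>" "\<bar>w t y\<bar>"] by simp
      also have "\<dots> \<le> 2 * \<phi> t"
        using member_le_sum[of x UNIV "\<lambda>x. (w t x)\<^sup>2"] member_le_sum[of y UNIV "\<lambda>x. (w t x)\<^sup>2"]
        by (simp add: \<phi>_def)
      finally have "\<bar>M x y\<bar> * (2 * \<bar>w t x\<bar> * \<bar>w t y\<bar>) \<le> \<bar>M x y\<bar> * (2 * \<phi> t)"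
        by (intro mult_left_mono) auto
      moreover have "2 * w t x * (M x y * w t y) \<le> \<bar>M x y\<bar> * (2 * \<bar>w t x\<bar> * \<bar>w t y\<bar>)"
        using abs_ge_self[of "2 * w t x * (M x y * w t y)"] by (simp add: abs_mult algebra_simps)
      ultimately show ?thesis by linarith
    qed
    then have "\<phi>' t \<le> (\<Sum>x\<in>UNIV. \<Sum>y\<in>UNIV. \<bar>M x y\<bar> * (2 * \<phi> t))"
      unfolding \<phi>'_def app_def sum_distrib_left by (intro sum_mono) auto
    also have "\<dots> = (2 * C) * \<phi> t"
      by (simp add: C_def sum_distrib_right sum_distrib_left algebra_simps)
    finally show ?thesis .
  qed
  have "\<phi> t \<le> exp (2 * C * t) * \<phi> 0" by (rule gronwall[OF d le t])
  then have "\<phi> t \<le> 0" by (simp add: \<phi>_def w_def init)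
  moreover have "\<phi> t \<ge> (w t x)\<^sup>2" for x
    unfolding \<phi>_def by (rule member_le_sum) auto
  ultimately have "(w t x)\<^sup>2 \<le> 0" for x
    by (meson order_trans)
  then show ?thesis by (simp add: w_def fun_eq_iff)
qed

text \<open>
  This is \<open>exp (- t (I - R))\<close>, written as a Poisson mixture of the powers of \<open>R\<close>: positivity and
  monotonicity in \<open>R\<close> can then be read off term by term.
\<close>

definition flow :: "('a::finite \<Rightarrow> 'a \<Rightarrow> real) \<Rightarrow> real \<Rightarrow> ('a \<Rightarrow> real) \<Rightarrow> 'a \<Rightarrow> real" where
  "flow R t f x = exp (- t) * expop R t f x"

definition gen :: "('a \<Rightarrow> 'a \<Rightarrow> real) \<Rightarrow> 'a \<Rightarrow> 'a \<Rightarrow> real" where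
  "gen R x y = R x y - ind {x} y"

lemma app_gen: "app (gen R) f x = app R f x - f x"
proof -
  have "(\<Sum>y\<in>UNIV. ind {x} y * f y) = (\<Sum>y\<in>UNIV. if y = x then f y else 0)"
    by (intro sum.cong) (auto simp: ind_def)
  then show ?thesis by (simp add: app_def gen_def left_diff_distrib sum_subtractf)
qed

lemma flow_zero [simp]: "flow R 0 f = f"
  by (simp add: flow_def fun_eq_iff)

lemma flow_add: "flow R t (\<lambda>y. f y + g y) x = flow R t f x + flow R t g x"
  by (simp add: flow_def expop_add distrib_left)

lemma flow_diff: "flow R t (\<lambda>y. f y - g y) x = flow R t f x - flow R t g x"
  by (simp add: flow_def expop_diff right_diff_distrib)

lemma flow_cmult: "flow R t (\<lambda>y. c * f y) x = c * flow R t f x"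
  by (simp add: flow_def expop_cmult)

lemma app_flow_kernel: "app (\<lambda>x y. flow R t (ind {y}) x) f = flow R t f"
proof
  fix x show "app (\<lambda>x y. flow R t (ind {y}) x) f x = flow R t f x"
    unfolding flow_def expop_kernel[symmetric, of R t f]
    by (simp add: app_def sum_distrib_left mult.assoc)
qed

lemma flow_deriv:
  "((\<lambda>t. flow R t f x) has_real_derivative app (gen R) (flow R t f) x) (at t)"
proof -
  have a: "app R (flow R t f) x = exp (- t) * app R (expop R t f) x"
    unfolding flow_def by (rule app_cmult)
  show ?thesis
    unfolding app_gen a unfolding flow_def
    by (auto intro!: derivative_eq_intros expop_deriv simp: algebra_simps)
qed

lemma flow_eq_expop_gen: "0 \<le> t \<Longrightarrow> flow R t f = expop (gen R) t f"
  by (rule linear_ode_unique[where M = "gen R"]) (auto intro: flow_deriv expop_deriv)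

lemma flow_semigroup:
  assumes "0 \<le> s" "0 \<le> t" shows "flow R (s + t) f = flow R s (flow R t f)"
proof (rule linear_ode_unique[where M = "gen R" and u = "\<lambda>s. flow R (s + t) f" and v = "\<lambda>s. flow R s (flow R t f)"])
  fix s x
  show "((\<lambda>s. flow R (s + t) f x) has_real_derivative app (gen R) (flow R (s + t) f) x) (at s)"
    using flow_deriv[of R f x "s + t"] by (subst (asm) DERIV_shift)
qed (use assms in \<open>auto intro: flow_deriv\<close>)

lemma continuous_flow: "continuous_on S (\<lambda>t. flow R t f x)"
  by (rule DERIV_continuous_on) (rule has_field_derivative_at_within[OF flow_deriv])

lemma mat_power_entry:
  "mat_power M k $ x $ y = (app (\<lambda>x y. M $ x $ y) ^^ k) (ind {y}) x"
proof (induction k arbitrary: x)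
  case 0 show ?case by (simp add: mat_power_def mat_def ind_def)
next
  case (Suc k)
  have "mat_power M (Suc k) = M ** mat_power M k" by (simp add: mat_power_def)
  then show ?case using Suc by (simp add: matrix_matrix_mult_def app_def)
qed

text \<open>
  The power series of \<open>P - I\<close> and the Poisson mixture of the powers of \<open>P\<close> solve the same linear
  differential equation.
\<close>

lemma heat_kernel_eq_flow:
  assumes "0 \<le> t"
  shows "heat_kernel P t $ x $ y = flow (\<lambda>x y. P $ x $ y) t (ind {y}) x"
proof -
  let ?P = "\<lambda>x y. P $ x $ y"
  define M where "M = (\<lambda>x y. (mat 1 - P) $ x $ y)"
  have pw: "(- t) ^ k * (app M ^^ k) f z = t ^ k * (app (gen ?P) ^^ k) f z" for k f z
  proof (induction k arbitrary: z)
    case (Suc k)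
    have neg: "app M g z = - app (gen ?P) g z" for g
      unfolding app_def gen_def M_def sum_negf[symmetric]
      by (intro sum.cong) (auto simp: mat_def ind_def algebra_simps)
    have "(- t) ^ Suc k * (app M ^^ Suc k) f z
        = t * app (gen ?P) (\<lambda>y. (- t) ^ k * (app M ^^ k) f y) z"
      unfolding app_cmult by (simp add: neg)
    also have "\<dots> = t ^ Suc k * (app (gen ?P) ^^ Suc k) f z"
      by (simp only: Suc app_cmult) simp
    finally show ?case .
  qed simp
  let ?t = "\<lambda>k. ((- t) ^ k / fact k) *\<^sub>R mat_power (mat 1 - P) k"
  have ent: "?t k $ x $ y = t ^ k / fact k * (app (gen ?P) ^^ k) (ind {y}) x" for k x y
    using pw[of k "ind {y}" x] by (simp add: mat_power_entry M_def)
  have "?t sums (\<chi> x y. expop (gen ?P) t (ind {y}) x)"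
    unfolding sums_def
  proof (intro vec_tendstoI)
    fix x y
    have "(\<lambda>k. ?t k $ x $ y) sums expop (gen ?P) t (ind {y}) x"
      unfolding ent expop_def by (intro summable_sums summable_expop)
    then show "(\<lambda>n. (\<Sum>k<n. ?t k) $ x $ y) \<longlonglongrightarrow> (\<chi> x y. expop (gen ?P) t (ind {y}) x) $ x $ y"
      by (simp add: sums_def)
  qed
  then show ?thesis
    using assms by (simp add: heat_kernel_def sums_iff flow_eq_expop_gen)
qed

section \<open>Killed semigroups\<close>

definition substoch :: "('a::finite \<Rightarrow> 'a \<Rightarrow> real) \<Rightarrow> bool" where
  "substoch R \<longleftrightarrow> (\<forall>x y. 0 \<le> R x y) \<and> (\<forall>x. (\<Sum>y\<in>UNIV. R x y) \<le> 1)"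

definition restr :: "'a set \<Rightarrow> ('a \<Rightarrow> 'a \<Rightarrow> real) \<Rightarrow> 'a \<Rightarrow> 'a \<Rightarrow> real" where
  "restr A R x y = (if x \<in> A \<and> y \<in> A then R x y else 0)"

abbreviation flow_kernel :: "('a::finite \<Rightarrow> 'a \<Rightarrow> real) \<Rightarrow> real \<Rightarrow> 'a \<Rightarrow> 'a \<Rightarrow> real" where
  "flow_kernel R t \<equiv> (\<lambda>x y. flow R t (ind {y}) x)"

lemma restr_UNIV [simp]: "restr UNIV R = R"
  by (simp add: restr_def fun_eq_iff)

lemma restr_restr: "B \<subseteq> A \<Longrightarrow> restr B (restr A R) = restr B R"
  by (auto simp: restr_def fun_eq_iff)

lemma app_mono:
  assumes "\<And>x y. 0 \<le> R x y" and "\<And>x y. R x y \<le> S x y"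
    and "\<And>y. 0 \<le> f y" and "\<And>y. f y \<le> g y"
  shows "app R f x \<le> app S g x"
  unfolding app_def
  by (intro sum_mono mult_mono assms order_trans[OF assms(1) assms(2)])

lemma app_nonneg: "(\<And>x y. 0 \<le> R x y) \<Longrightarrow> (\<And>y. 0 \<le> f y) \<Longrightarrow> 0 \<le> app R f x"
  by (simp add: app_def sum_nonneg)

lemma app_le_const:
  assumes "substoch R" "0 \<le> c" "\<And>y. f y \<le> c" shows "app R f x \<le> c"
proof -
  have "app R f x \<le> (\<Sum>y\<in>UNIV. R x y * c)"
    unfolding app_def using assms by (intro sum_mono mult_left_mono) (auto simp: substoch_def)
  also have "\<dots> = (\<Sum>y\<in>UNIV. R x y) * c" by (simp add: sum_distrib_right)
  also have "\<dots> \<le> 1 * c" using assms by (intro mult_right_mono) (auto simp: substoch_def)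
  finally show ?thesis by simp
qed

lemma app_abs_le:
  assumes "substoch R" "\<And>y. \<bar>f y\<bar> \<le> c" shows "\<bar>app R f x\<bar> \<le> c"
proof -
  have "0 \<le> c" using assms(2)[of x] by linarith
  have "app R f x \<le> c" by (rule app_le_const) (use assms \<open>0 \<le> c\<close> in \<open>auto simp: abs_le_iff\<close>)
  moreover have "app R (\<lambda>y. (- 1) * f y) x \<le> c"
    by (rule app_le_const) (use assms \<open>0 \<le> c\<close> abs_le_iff in \<open>auto simp: abs_le_iff\<close>)
  ultimately show ?thesis unfolding app_cmult by linarith
qed

lemma app_pow_nonneg:
  assumes "\<And>x y. 0 \<le> R x y" "\<And>y. 0 \<le> f y" shows "0 \<le> (app R ^^ k) f x"
  by (induction k arbitrary: x) (simp_all add: assms app_nonneg)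

lemma app_pow_mono:
  assumes "\<And>x y. 0 \<le> R x y" and "\<And>x y. R x y \<le> S x y"
    and "\<And>y. 0 \<le> f y" and "\<And>y. f y \<le> g y"
  shows "(app R ^^ k) f x \<le> (app S ^^ k) g x"
  by (induction k arbitrary: x) (simp_all add: assms app_mono app_pow_nonneg)

lemma app_pow_abs_le:
  assumes "substoch R" "\<And>y. \<bar>f y\<bar> \<le> c" shows "\<bar>(app R ^^ k) f x\<bar> \<le> c"
  by (induction k arbitrary: x) (simp_all add: assms app_abs_le)

lemma app_pow_supported:
  assumes "\<And>y. y \<notin> A \<Longrightarrow> f y = 0" "x \<notin> A" shows "(app (restr A R) ^^ k) f x = 0"
  using assms by (cases k) (simp_all add: app_def restr_def)

lemma app_pow_restr_cut:
  assumes "x \<in> A"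
  shows "(app (restr A R) ^^ k) f x = (app (restr A R) ^^ k) (\<lambda>y. ind A y * f y) x"
  using assms
proof (induction k arbitrary: x)
  case (Suc k)
  then show ?case unfolding funpow.simps comp_apply app_def
    by (intro sum.cong refl) (auto simp: restr_def)
qed (simp add: ind_def)

lemma exp_sums_mult:
  fixes t c :: real shows "(\<lambda>k. t ^ k / fact k * c) sums (exp t * c)"
  using sums_mult2[OF exp_converges[of t], of c] by (simp add: field_simps)

lemma flow_nonneg:
  assumes "0 \<le> t" "\<And>x y. 0 \<le> R x y" "\<And>y. 0 \<le> f y" shows "0 \<le> flow R t f x"
  unfolding flow_def expop_def
  by (intro mult_nonneg_nonneg suminf_nonneg summable_expop app_pow_nonneg) (use assms in auto)

lemma flow_mono:
  assumes "0 \<le> t" "\<And>x y. 0 \<le> R x y" and "\<And>x y. R x y \<le> S x y"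
    and "\<And>y. 0 \<le> f y" and "\<And>y. f y \<le> g y"
  shows "flow R t f x \<le> flow S t g x"
  unfolding flow_def expop_def
  by (intro mult_left_mono suminf_le summable_expop app_pow_mono) (use assms in auto)

lemma flow_abs_le:
  assumes "0 \<le> t" "substoch R" "\<And>y. \<bar>f y\<bar> \<le> c" shows "\<bar>flow R t f x\<bar> \<le> c"
proof -
  have b: "\<bar>(app R ^^ k) f x\<bar> \<le> c" for k using assms(2,3) by (rule app_pow_abs_le)
  have "expop R t f x \<le> exp t * c"
    by (rule sums_le[OF _ expop_sums exp_sums_mult], rule mult_left_mono)
       (use assms(1) b in \<open>auto simp: abs_le_iff\<close>)
  moreover have "- expop R t f x \<le> exp t * c"
    by (rule sums_le[OF _ sums_minus[OF expop_sums] exp_sums_mult], unfold mult_minus_right[symmetric], rule mult_left_mono)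
       (use assms(1) b in \<open>auto simp: abs_le_iff\<close>)
  ultimately have "\<bar>expop R t f x\<bar> \<le> exp t * c" by linarith
  then have "exp (- t) * \<bar>expop R t f x\<bar> \<le> exp (- t) * (exp t * c)" by (intro mult_left_mono) auto
  also have "exp (- t) * (exp t * c) = c" by (simp add: exp_minus)
  finally show ?thesis by (simp add: flow_def abs_mult)
qed

lemma flow_supported:
  assumes "\<And>y. y \<notin> A \<Longrightarrow> f y = 0" "x \<notin> A" shows "flow (restr A R) t f x = 0"
  by (simp add: flow_def expop_def app_pow_supported[where A = A and f = f, OF assms])

lemma flow_const:
  assumes "0 \<le> t" "\<And>x. (\<Sum>y\<in>UNIV. R x y) = 1" shows "flow R t (\<lambda>_. c) x = c"
proof -
  have "(app R ^^ k) (\<lambda>_. c) = (\<lambda>_. c)" for k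
    by (induction k) (auto simp: app_def assms sum_distrib_right[symmetric])
  then have "expop R t (\<lambda>_. c) x = exp t * c"
    using expop_sums[of t R "\<lambda>_. c" x] exp_sums_mult[of t c] by (simp add: sums_unique2)
  then show ?thesis by (simp add: flow_def exp_minus)
qed

lemma substoch_restr: "substoch R \<Longrightarrow> substoch (restr A R)"
  unfolding substoch_def restr_def
  by (intro conjI allI; (erule conjE)?; (rule order_trans[OF sum_mono])?) (auto split: if_splits)

lemma substoch_flow_kernel:
  assumes "0 \<le> t" "substoch R" shows "substoch (flow_kernel R t)"
proof -
  have "(\<Sum>y\<in>UNIV. flow R t (ind {y}) x) \<le> 1" for x
  proof -
    have "(\<Sum>y\<in>UNIV. flow R t (ind {y}) x) = app (flow_kernel R t) (\<lambda>_. 1) x" by (simp add: app_def)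
    also have "\<dots> \<le> 1" using flow_abs_le[OF assms, of "\<lambda>_. 1" 1 x] by (simp add: app_flow_kernel)
    finally show ?thesis .
  qed
  moreover have "0 \<le> flow R t (ind {y}) x" for x y
    by (rule flow_nonneg) (use assms in \<open>auto simp: substoch_def ind_def\<close>)
  ultimately show ?thesis by (simp add: substoch_def)
qed

lemma app_pow_flow_kernel:
  assumes "0 \<le> t" shows "(app (flow_kernel R t) ^^ k) f = flow R (real k * t) f"
proof -
  have k: "app (flow_kernel R t) = flow R t" by (rule ext) (rule app_flow_kernel)
  have "(flow R t ^^ k) f = flow R (real k * t) f"
  proof (induction k)
    case (Suc k)
    have "flow R (real (Suc k) * t) f = flow R (t + real k * t) f" by (simp add: algebra_simps)
    then show ?case using assms Suc flow_semigroup[of t "real k * t" R f] by simp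
  qed simp
  then show ?thesis by (simp only: k)
qed

text \<open>
  Observing the chain only after a step of length \<open>d\<close> misses excursions out of \<open>B\<close>. These need at
  least two jumps: the first two terms of the Poisson mixtures agree on functions supported in \<open>B\<close>,
  and the probability of two or more jumps is \<open>1 - exp (- d) (1 + d) \<le> d\<^sup>2\<close>.
\<close>

lemma killed_step_error:
  assumes R: "substoch R" and d: "0 \<le> d"
    and f: "\<And>y. 0 \<le> f y" "\<And>y. f y \<le> 1" "\<And>y. y \<notin> B \<Longrightarrow> f y = 0"
  shows "\<bar>app (restr B (flow_kernel R d)) f x - flow (restr B R) d f x\<bar> \<le> d\<^sup>2"
proof (cases "x \<in> B")
  case False
  then have "app (restr B (flow_kernel R d)) f x = 0" by (simp add: app_def restr_def)
  then show ?thesis using flow_supported[OF f(3) False] by simp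
next
  case True
  have Rn: "0 \<le> R x y" for x y using R by (simp add: substoch_def)
  have "app (restr B (flow_kernel R d)) f x = app (flow_kernel R d) f x"
    unfolding app_def using True f(3) by (intro sum.cong) (auto simp: restr_def)
  then have 1: "app (restr B (flow_kernel R d)) f x = flow R d f x" by (simp add: app_flow_kernel)
  define D where "D = (\<lambda>k. (app R ^^ k) f x - (app (restr B R) ^^ k) f x)"
  have D0: "0 \<le> D k" for k
    unfolding D_def using app_pow_mono[of "restr B R" R f f k x] f Rn by (simp add: restr_def)
  have D1: "D k \<le> 1" for k
  proof -
    have "\<bar>(app R ^^ k) f x\<bar> \<le> 1" by (rule app_pow_abs_le[OF R]) (use f in auto)
    moreover have "0 \<le> (app (restr B R) ^^ k) f x"
      by (rule app_pow_nonneg) (use f Rn in \<open>auto simp: restr_def\<close>)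
    ultimately show ?thesis by (simp add: D_def)
  qed
  have "D 0 = 0" by (simp add: D_def)
  moreover have "D 1 = 0"
    unfolding D_def app_def using True f(3) by (auto simp: app_def restr_def intro!: sum.cong)
  ultimately have Dk: "D k \<le> 1 - (if k \<in> {0, 1} then 1 else 0)" for k
    using D1[of k] by auto
  have s: "(\<lambda>k. d ^ k / fact k * D k) sums (expop R d f x - expop (restr B R) d f x)"
    unfolding D_def right_diff_distrib by (intro sums_diff expop_sums)
  have "(\<lambda>k. if k \<in> {0,1} then d ^ k / fact k else 0) sums (\<Sum>k\<in>{0,1}. d ^ k / fact k)"
    by (rule sums_If_finite_set) auto
  then have s2: "(\<lambda>k. d ^ k / fact k * 1 - (if k \<in> {0,1} then d ^ k / fact k else 0)) sums (exp d * 1 - (1 + d))"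
    by (intro sums_diff exp_sums_mult) simp
  have "expop R d f x - expop (restr B R) d f x \<le> exp d * 1 - (1 + d)"
  proof (rule sums_le[OF _ s s2])
    fix k
    have "d ^ k / fact k * D k \<le> d ^ k / fact k * (1 - (if k \<in> {0, 1} then 1 else 0))"
      using Dk d by (intro mult_left_mono) auto
    then show "d ^ k / fact k * D k \<le> d ^ k / fact k * 1 - (if k \<in> {0,1} then d ^ k / fact k else 0)"
      by (auto split: if_splits)
  qed
  then have "exp (- d) * (expop R d f x - expop (restr B R) d f x) \<le> exp (- d) * (exp d - (1 + d))"
    by (intro mult_left_mono) auto
  also have "\<dots> = 1 - exp (- d) * (1 + d)" by (simp add: right_diff_distrib exp_minus)
  also have "\<dots> \<le> 1 - (1 - d) * (1 + d)"
    using exp_ge_add_one_self[of "- d"] d by (auto intro!: mult_right_mono)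
  also have "\<dots> = d\<^sup>2" by (simp add: power2_eq_square algebra_simps)
  finally have up: "flow R d f x - flow (restr B R) d f x \<le> d\<^sup>2" by (simp add: flow_def algebra_simps)
  have "0 \<le> expop R d f x - expop (restr B R) d f x"
    by (rule sums_le[OF _ sums_zero s]) (use D0 d in auto)
  then have "0 \<le> exp (- d) * (expop R d f x - expop (restr B R) d f x)" by simp
  then have "0 \<le> flow R d f x - flow (restr B R) d f x" by (simp add: flow_def algebra_simps)
  then show ?thesis using up 1 by simp
qed

text \<open>
  Both the observed and the killed chain contract the supremum norm, so the one-step errors add up.
\<close>

lemma killed_chain_error:
  assumes R: "substoch R" and d: "0 \<le> d"
    and f: "\<And>y. 0 \<le> f y" "\<And>y. f y \<le> 1" "\<And>y. y \<notin> B \<Longrightarrow> f y = 0"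
  shows "\<bar>(app (restr B (flow_kernel R d)) ^^ n) f x - flow (restr B R) (real n * d) f x\<bar> \<le> real n * d\<^sup>2"
proof (induction n arbitrary: x)
  case (Suc n)
  let ?Q = "restr B (flow_kernel R d)" and ?S = "\<lambda>t. flow (restr B R) t"
  have Q: "substoch ?Q" by (intro substoch_restr substoch_flow_kernel R d)
  have e: "?S (real (Suc n) * d) f = ?S d (?S (real n * d) f)"
    using flow_semigroup[of d "real n * d" "restr B R" f] d by (simp add: algebra_simps)
  have "\<bar>app ?Q (\<lambda>y. (app ?Q ^^ n) f y - ?S (real n * d) f y) x\<bar> \<le> real n * d\<^sup>2"
    by (rule app_abs_le[OF Q Suc])
  moreover have "\<bar>app ?Q (?S (real n * d) f) x - ?S d (?S (real n * d) f) x\<bar> \<le> d\<^sup>2"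
  proof (rule killed_step_error[OF R d])
    have Rn: "0 \<le> restr B R x y" for x y using R by (simp add: substoch_def restr_def)
    fix y
    show "0 \<le> ?S (real n * d) f y" by (rule flow_nonneg) (use Rn f d in auto)
    show "?S (real n * d) f y \<le> 1"
      using flow_abs_le[of "real n * d" "restr B R" f 1 y] f d by (simp add: substoch_restr R)
    show "y \<notin> B \<Longrightarrow> ?S (real n * d) f y = 0" by (rule flow_supported) (use f in auto)
  qed
  ultimately show ?case unfolding app_diff e by (simp add: algebra_simps) 
qed simp

lemma killed_limit:
  assumes R: "substoch R" and t: "0 \<le> t"
    and f: "\<And>y. 0 \<le> f y" "\<And>y. f y \<le> 1" "\<And>y. y \<notin> B \<Longrightarrow> f y = 0"
  shows "(\<lambda>n. (app (restr B (flow_kernel R (t / real (Suc n)))) ^^ Suc n) f x) \<longlonglongrightarrow> flow (restr B R) t f x"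
proof -
  have "(\<lambda>n. t\<^sup>2 * inverse (real (Suc n))) \<longlonglongrightarrow> t\<^sup>2 * 0"
    by (intro tendsto_mult tendsto_const LIMSEQ_inverse_real_of_nat)
  then have l: "(\<lambda>n. t\<^sup>2 / real (Suc n)) \<longlonglongrightarrow> 0" by (simp add: divide_inverse)
  have "norm ((app (restr B (flow_kernel R (t / real (Suc n)))) ^^ Suc n) f x - flow (restr B R) t f x) \<le> t\<^sup>2 / real (Suc n)" for n
  proof -
    have "real (Suc n) * (t / real (Suc n)) = t" "real (Suc n) * (t / real (Suc n))\<^sup>2 = t\<^sup>2 / real (Suc n)"
      by (simp_all add: power2_eq_square del: of_nat_Suc)
    then show ?thesis
      using killed_chain_error[where f = f and B = B and d = "t / real (Suc n)" and n = "Suc n" and x = x, OF R _ f] t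
      by (simp only: real_norm_def) simp
  qed
  then have "(\<lambda>n. (app (restr B (flow_kernel R (t / real (Suc n)))) ^^ Suc n) f x - flow (restr B R) t f x) \<longlonglongrightarrow> 0"
    by (intro Lim_null_comparison[OF _ l]) simp
  then show ?thesis by (simp add: LIM_zero_iff)
qed

text \<open>
  Optional stopping at the exit from \<open>B\<close>: the process \<open>(Q ^^ (N - n)) g\<close> evaluated along the chain is
  a martingale, with value \<open>0\<close> after killing, and it is at most \<open>a\<close> when the chain is outside \<open>B\<close>; the remaining contribution
  comes from paths that stay in \<open>B\<close>.
\<close>

lemma stopping_bound:
  assumes Q: "substoch Q" and g: "\<And>y. 0 \<le> g y" and a: "0 \<le> a"
    and off: "\<And>n y. n \<le> N \<Longrightarrow> y \<notin> B \<Longrightarrow> (app Q ^^ n) g y \<le> a"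
  shows "(app Q ^^ N) g x \<le> (app (restr B Q) ^^ N) g x + a"
proof -
  have Qn: "0 \<le> Q x y" for x y using Q by (simp add: substoch_def)
  have "(app Q ^^ n) g x \<le> (app (restr B Q) ^^ n) g x + a" if "n \<le> N" for n x
    using that
  proof (induction n arbitrary: x)
    case (Suc n)
    have nn: "0 \<le> (app (restr B Q) ^^ m) g y" for m y
      by (rule app_pow_nonneg) (use Qn g in \<open>auto simp: restr_def\<close>)
    show ?case
    proof (cases "x \<in> B")
      case False
      then show ?thesis using off[OF Suc.prems False] nn[of "Suc n" x] by linarith
    next
      case True
      have "(\<Sum>y\<in>UNIV. Q x y * (app Q ^^ n) g y) \<le> (\<Sum>y\<in>UNIV. restr B Q x y * (app (restr B Q) ^^ n) g y + Q x y * a)"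
      proof (rule sum_mono)
        fix y
        have "Q x y * (app Q ^^ n) g y \<le> Q x y * ((if y \<in> B then (app (restr B Q) ^^ n) g y else 0) + a)"
          using Suc.IH[of y] off[of n y] Suc.prems Qn[of x y] by (intro mult_left_mono) auto
        then show "Q x y * (app Q ^^ n) g y \<le> restr B Q x y * (app (restr B Q) ^^ n) g y + Q x y * a"
          using True by (simp add: restr_def distrib_left split: if_splits)
      qed
      then have "(app Q ^^ Suc n) g x \<le> (app (restr B Q) ^^ Suc n) g x + app Q (\<lambda>_. a) x"
        by (simp add: app_def sum.distrib)
      also have "app Q (\<lambda>_. a) x \<le> a" by (rule app_le_const[OF Q a]) simp
      finally show ?thesis by simp
    qed
  qed (use a in simp)
  then show ?thesis by simp
qed

text \<open>
  The continuous-time form of the stopping bound, obtained from the grids of mesh \<open>t / (n + 1)\<close>.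
\<close>

lemma strong_markov_bound:
  assumes R: "substoch R" and t: "0 \<le> t" and a: "0 \<le> a"
    and g: "\<And>y. 0 \<le> g y" "\<And>y. g y \<le> 1"
    and off: "\<And>s y. 0 \<le> s \<Longrightarrow> s \<le> t \<Longrightarrow> y \<notin> B \<Longrightarrow> flow R s g y \<le> a"
  shows "flow R t g x \<le> flow (restr B R) t (ind B) x + a"
proof (cases "x \<in> B")
  case False
  then have "flow (restr B R) t (ind B) x = 0" by (intro flow_supported) (auto simp: ind_def)
  then show ?thesis using off[OF t order_refl False] by simp
next
  case True
  have Rn: "0 \<le> R x y" for x y using R by (simp add: substoch_def)
  let ?h = "\<lambda>y. ind B y * g y"
  have le: "flow R t g x \<le> (app (restr B (flow_kernel R (t / real (Suc n)))) ^^ Suc n) ?h x + a" for n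
  proof -
    define d where "d = t / real (Suc n)"
    have d: "0 \<le> d" and nd: "real (Suc n) * d = t" using t by (simp_all add: d_def del: of_nat_Suc)
    have "(app (flow_kernel R d) ^^ Suc n) g x \<le> (app (restr B (flow_kernel R d)) ^^ Suc n) g x + a"
    proof (rule stopping_bound[OF substoch_flow_kernel[OF d R] g(1) a])
      fix k y assume k: "k \<le> Suc n" and y: "y \<notin> B"
      have "real k * d \<le> real (Suc n) * d" using k d by (intro mult_right_mono) auto
      then show "(app (flow_kernel R d) ^^ k) g y \<le> a"
        unfolding app_pow_flow_kernel[OF d] nd using y d by (intro off) auto
    qed
    then show ?thesis
      unfolding app_pow_flow_kernel[OF d] nd app_pow_restr_cut[OF True, where f = g] by (simp add: d_def)
  qed
  have "(\<lambda>n. (app (restr B (flow_kernel R (t / real (Suc n)))) ^^ Suc n) ?h x + a) \<longlonglongrightarrow> flow (restr B R) t ?h x + a"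
    by (intro tendsto_add killed_limit R t tendsto_const) (use g in \<open>auto simp: ind_def\<close>)
  then have "flow R t g x \<le> flow (restr B R) t ?h x + a"
    by (rule Lim_bounded2) (use le in blast)
  also have "flow (restr B R) t ?h x \<le> flow (restr B R) t (ind B) x"
    by (rule flow_mono[OF t]) (use g Rn in \<open>auto simp: ind_def restr_def\<close>)
  finally show ?thesis by simp
qed

lemma app_pow_selfadj:
  assumes "\<And>x y. w x * R x y = w y * R y x"
  shows "(\<Sum>x\<in>UNIV. w x * (f x * (app R ^^ k) g x)) = (\<Sum>x\<in>UNIV. w x * ((app R ^^ k) f x * g x))"
proof (induction k arbitrary: f)
  case (Suc k)
  have 1: "(\<Sum>x\<in>UNIV. w x * (f x * app R h x)) = (\<Sum>x\<in>UNIV. w x * (app R f x * h x))" for f h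
  proof -
    have "(\<Sum>x\<in>UNIV. w x * (f x * app R h x)) = (\<Sum>x\<in>UNIV. \<Sum>y\<in>UNIV. (w x * R x y) * (f x * h y))"
      by (simp add: app_def sum_distrib_left algebra_simps)
    also have "\<dots> = (\<Sum>y\<in>UNIV. \<Sum>x\<in>UNIV. (w y * R y x) * (f x * h y))"
      using assms by (subst sum.swap) simp
    also have "\<dots> = (\<Sum>x\<in>UNIV. w x * (app R f x * h x))"
      by (simp add: app_def sum_distrib_left sum_distrib_right algebra_simps)
    finally show ?thesis .
  qed
  have "(\<Sum>x\<in>UNIV. w x * (f x * (app R ^^ Suc k) g x)) = (\<Sum>x\<in>UNIV. w x * (app R f x * (app R ^^ k) g x))"
    by (simp add: 1)
  also have "\<dots> = (\<Sum>x\<in>UNIV. w x * ((app R ^^ k) (app R f) x * g x))" by (rule Suc)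
  finally show ?case by (simp add: funpow_swap1)
qed simp

lemma flow_selfadj:
  assumes "\<And>x y. w x * R x y = w y * R y x"
  shows "(\<Sum>x\<in>UNIV. w x * (f x * flow R t g x)) = (\<Sum>x\<in>UNIV. w x * (flow R t f x * g x))"
proof -
  have "(\<lambda>k. \<Sum>x\<in>UNIV. w x * f x * (t ^ k / fact k * (app R ^^ k) g x)) sums (\<Sum>x\<in>UNIV. w x * f x * expop R t g x)"
    by (intro sums_sum sums_mult expop_sums)
  moreover have "(\<lambda>k. \<Sum>x\<in>UNIV. w x * g x * (t ^ k / fact k * (app R ^^ k) f x)) sums (\<Sum>x\<in>UNIV. w x * g x * expop R t f x)"
    by (intro sums_sum sums_mult expop_sums)
  moreover have "(\<Sum>x\<in>UNIV. w x * f x * (t ^ k / fact k * (app R ^^ k) g x))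
      = (\<Sum>x\<in>UNIV. w x * g x * (t ^ k / fact k * (app R ^^ k) f x))" for k
  proof -
    have "(\<Sum>x\<in>UNIV. w x * f x * (t ^ k / fact k * (app R ^^ k) g x))
        = t ^ k / fact k * (\<Sum>x\<in>UNIV. w x * (f x * (app R ^^ k) g x))"
      by (simp add: sum_distrib_left algebra_simps)
    also have "\<dots> = t ^ k / fact k * (\<Sum>x\<in>UNIV. w x * ((app R ^^ k) f x * g x))"
      by (simp only: app_pow_selfadj[OF assms])
    finally show ?thesis by (simp add: sum_distrib_left algebra_simps)
  qed
  ultimately have "(\<Sum>x\<in>UNIV. w x * f x * expop R t g x) = (\<Sum>x\<in>UNIV. w x * g x * expop R t f x)"
    by (simp add: sums_unique2)
  then have "exp (- t) * (\<Sum>x\<in>UNIV. w x * f x * expop R t g x) = exp (- t) * (\<Sum>x\<in>UNIV. w x * g x * expop R t f x)"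
    by simp
  then show ?thesis by (simp add: flow_def sum_distrib_left algebra_simps)
qed

section \<open>Exit times of the continuous-time chain\<close>

abbreviation mfun :: "real^'a^'a \<Rightarrow> 'a \<Rightarrow> 'a \<Rightarrow> real" where
  "mfun P \<equiv> (\<lambda>x y. P $ x $ y)"

lemma transition_matrix_substoch:
  assumes "transition_matrix P"
  shows "substoch (mfun P)" "\<And>x y. 0 \<le> mfun P x y" "\<And>x. (\<Sum>y\<in>UNIV. mfun P x y) = 1"
  using assms by (auto simp: transition_matrix_def substoch_def)

lemma hitting_time_gt_iff:
  assumes rc: "\<And>s. 0 \<le> s \<Longrightarrow> \<forall>\<^sub>F r in at_right s. X r \<omega> = X s \<omega>" and t: "0 \<le> t"
  shows "hitting_time X B \<omega> > ereal t \<longleftrightarrow> (\<forall>s. 0 \<le> s \<and> s \<le> t \<longrightarrow> X s \<omega> \<notin> B)"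
proof
  assume h: "hitting_time X B \<omega> > ereal t"
  show "\<forall>s. 0 \<le> s \<and> s \<le> t \<longrightarrow> X s \<omega> \<notin> B"
  proof (intro allI impI notI)
    fix s assume s: "0 \<le> s \<and> s \<le> t" "X s \<omega> \<in> B"
    then have "hitting_time X B \<omega> \<le> ereal s" unfolding hitting_time_def by (intro Inf_lower) auto
    then have "ereal t < ereal s" using h by (rule less_le_trans[rotated])
    then show False using s by simp
  qed
next
  assume n: "\<forall>s. 0 \<le> s \<and> s \<le> t \<longrightarrow> X s \<omega> \<notin> B"
  obtain b where b: "b > t" "\<And>r. t < r \<Longrightarrow> r < b \<Longrightarrow> X r \<omega> = X t \<omega>"
    using rc[OF t] unfolding eventually_at_right_field by blast
  have "ereal b \<le> hitting_time X B \<omega>"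
    unfolding hitting_time_def
  proof (intro Inf_greatest)
    fix z assume "z \<in> {ereal t |t. 0 \<le> t \<and> X t \<omega> \<in> B}"
    then obtain s where s: "z = ereal s" "0 \<le> s" "X s \<omega> \<in> B" by blast
    have "\<not> s < b" using n b(2)[of s] s t by (metis linorder_le_less_linear order_refl)
    then show "ereal b \<le> z" using s by simp
  qed
  then show "hitting_time X B \<omega> > ereal t" using b(1) by (simp add: less_le_trans[of _ "ereal b"])
qed

text \<open>
  By right-continuity a visit to \<open>B\<close> before \<open>t\<close> lasts for a time interval, which contains a dyadic
  multiple of \<open>t\<close>; a visit at \<open>t\<close> itself is seen at the last grid point.
\<close>

lemma hitting_time_gt_dyadic:
  assumes rc: "\<And>s. 0 \<le> s \<Longrightarrow> \<forall>\<^sub>F r in at_right s. X r \<omega> = X s \<omega>" and t: "0 \<le> t"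
  shows "hitting_time X B \<omega> > ereal t \<longleftrightarrow> (\<forall>m. \<forall>j\<le>2 ^ m. X (real j * (t / 2 ^ m)) \<omega> \<notin> B)"
proof (subst hitting_time_gt_iff[where X = X and \<omega> = \<omega> and t = t], rule rc, assumption, rule t, rule iffI)
  assume h: "\<forall>s. 0 \<le> s \<and> s \<le> t \<longrightarrow> X s \<omega> \<notin> B"
  have "0 \<le> real j * (t / 2 ^ m) \<and> real j * (t / 2 ^ m) \<le> t" if "j \<le> 2 ^ m" for m j
  proof -
    have "real j \<le> 2 ^ m" using that by (metis of_nat_le_iff of_nat_numeral of_nat_power)
    then have "real j * t \<le> 2 ^ m * t" using t by (intro mult_right_mono)
    then show ?thesis using t by (simp add: field_simps)
  qed
  then show "\<forall>m. \<forall>j\<le>2 ^ m. X (real j * (t / 2 ^ m)) \<omega> \<notin> B" using h by blast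
next
  assume n: "\<forall>m. \<forall>j\<le>2 ^ m. X (real j * (t / 2 ^ m)) \<omega> \<notin> B"
  show "\<forall>s. 0 \<le> s \<and> s \<le> t \<longrightarrow> X s \<omega> \<notin> B"
  proof (intro allI impI notI)
    fix s assume s: "0 \<le> s \<and> s \<le> t" "X s \<omega> \<in> B"
    show False
    proof (cases "t = 0")
      case True
      then show False using n[rule_format, of 0 0] s by auto
    next
      case False
      then have t0: "0 < t" using t by simp
      obtain b where b: "b > s" "\<And>r. s < r \<Longrightarrow> r < b \<Longrightarrow> X r \<omega> = X s \<omega>"
        using rc[of s] s unfolding eventually_at_right_field by blast
      obtain m where m: "t / (b - s) < 2 ^ m"
        using real_arch_pow[of 2 "t / (b - s)"] by auto
      then have m': "t / 2 ^ m < b - s" using b(1) by (simp add: field_simps)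
      define j where "j = nat \<lceil>s * 2 ^ m / t\<rceil>"
      have c0: "0 \<le> s * 2 ^ m / t" using s t0 by simp
      then have j: "real j = of_int \<lceil>s * 2 ^ m / t\<rceil>" by (simp add: j_def)
      have "s * 2 ^ m / t \<le> 2 ^ m" using s t0 by (simp add: field_simps)
      then have "\<lceil>s * 2 ^ m / t\<rceil> \<le> 2 ^ m" by (simp add: ceiling_le_iff)
      then have jm: "j \<le> 2 ^ m" by (simp add: j_def nat_le_iff)
      have "s * 2 ^ m / t \<le> real j" unfolding j by simp
      then have r1: "s \<le> real j * (t / 2 ^ m)" using t0 by (simp add: field_simps)
      have "real j < s * 2 ^ m / t + 1" unfolding j by linarith
      then have "real j * (t / 2 ^ m) < (s * 2 ^ m / t + 1) * (t / 2 ^ m)"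
        using t0 by (intro mult_strict_right_mono) auto
      also have "\<dots> = s + t / 2 ^ m" using t0 by (simp add: field_simps)
      finally have r2: "real j * (t / 2 ^ m) < b" using m' by simp
      have "X (real j * (t / 2 ^ m)) \<omega> = X s \<omega>"
        using b(2)[of "real j * (t / 2 ^ m)"] r1 r2 by (cases "s = real j * (t / 2 ^ m)") auto
      then show False using n jm s by metis
    qed
  qed
qed

locale ct_chain =
  fixes P :: "real^'a::finite^'a" and Pr :: "'a \<Rightarrow> 'w measure" and X :: "real \<Rightarrow> 'w \<Rightarrow> 'a"
  assumes transition: "transition_matrix P" and chain: "continuous_time_chain P Pr X"
begin

lemma prob_space_Pr: "prob_space (Pr x)"
  using chain by (simp add: continuous_time_chain_def)

lemma X_sets: "0 \<le> t \<Longrightarrow> {\<omega> \<in> space (Pr x). X t \<omega> \<in> S} \<in> sets (Pr x)"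
proof -
  assume "0 \<le> t"
  then have "X t \<in> measurable (Pr x) (count_space UNIV)"
    using chain by (simp add: continuous_time_chain_def)
  then have "X t -` S \<inter> space (Pr x) \<in> sets (Pr x)" by (rule measurable_sets) simp
  also have "X t -` S \<inter> space (Pr x) = {\<omega> \<in> space (Pr x). X t \<omega> \<in> S}" by auto
  finally show ?thesis .
qed

lemma right_cont: "\<omega> \<in> space (Pr x) \<Longrightarrow> 0 \<le> s \<Longrightarrow> \<forall>\<^sub>F r in at_right s. X r \<omega> = X s \<omega>"
  using chain by (simp add: continuous_time_chain_def)

lemma X_measurable: "0 \<le> t \<Longrightarrow> X t \<in> measurable (Pr x) (count_space UNIV)"
  using chain by (simp add: continuous_time_chain_def)

lemma heat_kernel_flow: "0 \<le> t \<Longrightarrow> heat_kernel P t $ x $ y = flow_kernel (mfun P) t x y"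
  by (rule heat_kernel_eq_flow)

lemma hitting_gt_iff:
  assumes "\<omega> \<in> space (Pr x)" "0 \<le> t"
  shows "hitting_time X B \<omega> > ereal t \<longleftrightarrow> (\<forall>s. 0 \<le> s \<and> s \<le> t \<longrightarrow> X s \<omega> \<notin> B)"
  by (rule hitting_time_gt_iff) (use right_cont assms in auto)

lemma hitting_gt_dyadic:
  assumes "\<omega> \<in> space (Pr x)" "0 \<le> t"
  shows "hitting_time X B \<omega> > ereal t \<longleftrightarrow> (\<forall>m. \<forall>j\<le>2 ^ m. X (real j * (t / 2 ^ m)) \<omega> \<notin> B)"
  by (rule hitting_time_gt_dyadic) (use right_cont assms in auto)

lemma hitting_gt_sets:
  assumes "0 \<le> t" shows "{\<omega> \<in> space (Pr x). hitting_time X B \<omega> > ereal t} \<in> sets (Pr x)"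
proof -
  have [measurable]: "X (real j * (t / 2 ^ m)) \<in> measurable (Pr x) (count_space UNIV)" for j m :: nat
    by (rule X_measurable) (use assms in simp)
  have "{\<omega> \<in> space (Pr x). hitting_time X B \<omega> > ereal t}
      = {\<omega> \<in> space (Pr x). \<forall>m. \<forall>j\<le>2 ^ m. X (real j * (t / 2 ^ m)) \<omega> \<notin> B}"
    using hitting_gt_dyadic[OF _ assms] by blast
  also have "\<dots> \<in> sets (Pr x)" by measurable
  finally show ?thesis .
qed

text \<open>
  The finite-dimensional distributions prescribe exact states. Summing over the state at time \<open>k d\<close>
  relaxes one such prescription to membership in \<open>A\<close>, and the induction on \<open>k\<close> relaxes all
  of them without sums over whole paths.
\<close>

lemma grid_path_prob:
  assumes d: "0 \<le> d" and k: "k \<le> n" and y: "\<And>i. y i \<in> A"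
  shows "measure (Pr x) {\<omega> \<in> space (Pr x). (\<forall>i<k. X (real i * d) \<omega> \<in> A) \<and> (\<forall>i\<in>{k..n}. X (real i * d) \<omega> = y i)}
      = (app (restr A (flow_kernel (mfun P) d)) ^^ k) (ind {y k}) x * (\<Prod>i\<in>{k..<n}. flow_kernel (mfun P) d (y i) (y (Suc i)))"
  using k y
proof (induction k arbitrary: y)
  case 0
  have s: "{\<omega> \<in> space (Pr x). \<forall>i\<in>{0..n}. X (real i * d) \<omega> = y i}
      = {\<omega> \<in> space (Pr x). \<forall>i\<le>n. X (real i * d) \<omega> = y i}" by auto
  have "measure (Pr x) {\<omega> \<in> space (Pr x). \<forall>i\<le>n. X (real i * d) \<omega> = y i}
     = heat_kernel P (real 0 * d) $ x $ y 0 * (\<Prod>i<n. heat_kernel P (real (Suc i) * d - real i * d) $ y i $ y (Suc i))"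
  proof -
    have *: "\<And>(n::nat) t y. 0 \<le> t 0 \<Longrightarrow> (\<forall>i<n. t i \<le> t (Suc i)) \<Longrightarrow>
      measure (Pr x) {\<omega> \<in> space (Pr x). \<forall>i\<le>n. X (t i) \<omega> = y i} =
       heat_kernel P (t 0) $ x $ y 0 * (\<Prod>i<n. heat_kernel P (t (Suc i) - t i) $ y i $ y (Suc i))"
      using chain unfolding continuous_time_chain_def by blast
    show ?thesis by (rule *[where t = "\<lambda>i. real i * d"]) (use d in \<open>auto intro!: mult_right_mono\<close>)
  qed
  moreover have "real (Suc i) * d - real i * d = d" for i by (simp add: algebra_simps)
  ultimately show ?case using s d by (simp add: heat_kernel_flow atLeast0LessThan)
next
  case (Suc k)
  let ?Q = "flow_kernel (mfun P) d"
  let ?E = "\<lambda>z. {\<omega> \<in> space (Pr x). (\<forall>i<k. X (real i * d) \<omega> \<in> A) \<and> (\<forall>i\<in>{k..n}. X (real i * d) \<omega> = (y(k := z)) i)}"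
  interpret prob_space "Pr x" by (rule prob_space_Pr)
  have kn: "{k..n} = insert k {Suc k..n}" "{k..<n} = insert k {Suc k..<n}" using Suc.prems by auto
  have "{\<omega> \<in> space (Pr x). (\<forall>i<Suc k. X (real i * d) \<omega> \<in> A) \<and> (\<forall>i\<in>{Suc k..n}. X (real i * d) \<omega> = y i)}
      = (\<Union>z\<in>A. ?E z)"
    unfolding kn by (auto simp: less_Suc_eq)
  moreover have "measure (Pr x) (\<Union>z\<in>A. ?E z) = (\<Sum>z\<in>A. measure (Pr x) (?E z))"
  proof (rule finite_measure_finite_Union)
    have [measurable]: "X (real i * d) \<in> measurable (Pr x) (count_space UNIV)" for i
      by (rule X_measurable) (use d in simp)
    have "?E z \<in> sets (Pr x)" for z by measurable
    then show "?E ` A \<subseteq> sets (Pr x)" by auto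
    show "disjoint_family_on ?E A" unfolding kn by (auto simp: disjoint_family_on_def)
  qed simp
  moreover have "measure (Pr x) (?E z) = (app (restr A ?Q) ^^ k) (ind {z}) x * (?Q z (y (Suc k)) * (\<Prod>i\<in>{Suc k..<n}. ?Q (y i) (y (Suc i))))"
    if "z \<in> A" for z
  proof -
    have "measure (Pr x) (?E z) = (app (restr A ?Q) ^^ k) (ind {(y(k := z)) k}) x * (\<Prod>i\<in>{k..<n}. ?Q ((y(k := z)) i) ((y(k := z)) (Suc i)))"
      by (rule Suc.IH) (use Suc.prems that in auto)
    also have "(\<Prod>i\<in>{k..<n}. ?Q ((y(k := z)) i) ((y(k := z)) (Suc i))) = ?Q z (y (Suc k)) * (\<Prod>i\<in>{Suc k..<n}. ?Q (y i) (y (Suc i)))"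
      unfolding kn by (subst prod.insert) (auto intro!: prod.cong)
    finally show ?thesis by simp
  qed
  moreover have "(app (restr A ?Q) ^^ Suc k) (ind {y (Suc k)}) x = (\<Sum>z\<in>A. (app (restr A ?Q) ^^ k) (ind {z}) x * ?Q z (y (Suc k)))"
  proof -
    have "app (restr A ?Q) (ind {y (Suc k)}) = (\<lambda>w. \<Sum>z\<in>A. ?Q z (y (Suc k)) * ind {z} w)"
    proof
      fix w
      have "app (restr A ?Q) (ind {y (Suc k)}) w = (\<Sum>v\<in>UNIV. if v = y (Suc k) then restr A ?Q w v else 0)"
        unfolding app_def by (intro sum.cong) (auto simp: ind_def)
      also have "\<dots> = (\<Sum>z\<in>A. if z = w then ?Q z (y (Suc k)) else 0)"
        using Suc.prems(2)[of "Suc k"] by (simp add: restr_def)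
      also have "\<dots> = (\<Sum>z\<in>A. ?Q z (y (Suc k)) * ind {z} w)"
        by (intro sum.cong) (auto simp: ind_def)
      finally show "app (restr A ?Q) (ind {y (Suc k)}) w = (\<Sum>z\<in>A. ?Q z (y (Suc k)) * ind {z} w)" .
    qed
    then show ?thesis
      unfolding funpow_Suc_right comp_apply by (simp only: app_pow_sum app_pow_cmult) (simp add: mult.commute)
  qed
  ultimately show ?case by (simp add: sum_distrib_right mult.assoc)
qed

text \<open>
  The dyadic survival events decrease to survival in continuous time, and their probabilities are
  entries of powers of the restricted kernel, whose limit is the killed semigroup.
\<close>

lemma killed_prob:
  assumes t: "0 \<le> t" and y: "y \<in> A"
  shows "measure (Pr x) {\<omega> \<in> space (Pr x). X t \<omega> = y \<and> hitting_time X (- A) \<omega> > ereal t}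
      = flow (restr A (mfun P)) t (ind {y}) x"
proof -
  interpret prob_space "Pr x" by (rule prob_space_Pr)
  define E where "E = (\<lambda>m::nat. {\<omega> \<in> space (Pr x). (\<forall>j\<le>2 ^ m. X (real j * (t / 2 ^ m)) \<omega> \<in> A) \<and> X t \<omega> = y})"
  have [measurable]: "X (real j * (t / 2 ^ m)) \<in> measurable (Pr x) (count_space UNIV)"
      "X t \<in> measurable (Pr x) (count_space UNIV)" for j m :: nat
    by (rule X_measurable; use t in simp)+
  have Es: "E m \<in> sets (Pr x)" for m
    unfolding E_def by measurable
  have dec: "decseq E"
  proof (rule decseq_SucI, rule subsetI)
    fix m \<omega> assume w: "\<omega> \<in> E (Suc m)"
    have "X (real j * (t / 2 ^ m)) \<omega> \<in> A" if "j \<le> 2 ^ m" for j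
    proof -
      have "2 * j \<le> 2 ^ Suc m" using that by simp
      then have "X (real (2 * j) * (t / 2 ^ Suc m)) \<omega> \<in> A" using w unfolding E_def by blast
      then show ?thesis by simp
    qed
    then show "\<omega> \<in> E m" using w by (simp add: E_def)
  qed
  have "(\<Inter>m. E m) = {\<omega> \<in> space (Pr x). X t \<omega> = y \<and> hitting_time X (- A) \<omega> > ereal t}"
    using hitting_gt_dyadic[OF _ t, where B = "- A" and x = x] by (auto simp: E_def)
  then have lim: "(\<lambda>m. measure (Pr x) (E m)) \<longlonglongrightarrow> measure (Pr x) {\<omega> \<in> space (Pr x). X t \<omega> = y \<and> hitting_time X (- A) \<omega> > ereal t}"
    using finite_Lim_measure_decseq[OF _ dec] Es by auto
  define a where "a = (\<lambda>n. (app (restr A (flow_kernel (mfun P) (t / real (Suc n)))) ^^ Suc n) (ind {y}) x)"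
  have mE: "measure (Pr x) (E m) = a (2 ^ m - 1)" for m
  proof -
    define n where "n = (2::nat) ^ m"
    have n: "Suc (2 ^ m - 1) = n" "real n = 2 ^ m" "n > 0" by (simp_all add: n_def)
    have nt: "real n * (t / real n) = t" using n by simp
    have "E m = {\<omega> \<in> space (Pr x). (\<forall>i<n. X (real i * (t / real n)) \<omega> \<in> A) \<and> (\<forall>i\<in>{n..n}. X (real i * (t / real n)) \<omega> = y)}"
      using nt y unfolding E_def n_def[symmetric] n(2)[symmetric] by (auto simp: le_less)
    then have "measure (Pr x) (E m) = (app (restr A (flow_kernel (mfun P) (t / real n))) ^^ n) (ind {y}) x"
      using grid_path_prob[of "t / real n" n n "\<lambda>_. y" A x] t y by simp
    then show ?thesis unfolding a_def n .
  qed
  have "a \<longlonglongrightarrow> flow (restr A (mfun P)) t (ind {y}) x"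
    unfolding a_def by (rule killed_limit) (use t y transition_matrix_substoch[OF transition] in \<open>auto simp: ind_def\<close>)
  moreover have "strict_mono (\<lambda>m. 2 ^ m - 1 :: nat)"
    by (rule strict_monoI_Suc) (simp add: diff_less_mono)
  ultimately have "(\<lambda>m. a (2 ^ m - 1)) \<longlonglongrightarrow> flow (restr A (mfun P)) t (ind {y}) x"
    using LIMSEQ_subseq_LIMSEQ[of a _ "\<lambda>m. 2 ^ m - 1"] by (simp add: comp_def)
  then show ?thesis using lim unfolding mE by (rule LIMSEQ_unique[rotated])
qed

lemma tail_prob:
  assumes t: "0 \<le> t"
  shows "measure (Pr x) {\<omega> \<in> space (Pr x). hitting_time X (- A) \<omega> > ereal t}
      = flow (restr A (mfun P)) t (ind A) x"
proof -
  interpret prob_space "Pr x" by (rule prob_space_Pr)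
  let ?E = "\<lambda>y. {\<omega> \<in> space (Pr x). X t \<omega> = y \<and> hitting_time X (- A) \<omega> > ereal t}"
  have "{\<omega> \<in> space (Pr x). hitting_time X (- A) \<omega> > ereal t} = (\<Union>y\<in>A. ?E y)"
    using hitting_gt_iff[OF _ t, where B = "- A" and x = x] t by auto
  moreover have "measure (Pr x) (\<Union>y\<in>A. ?E y) = (\<Sum>y\<in>A. measure (Pr x) (?E y))"
  proof (rule finite_measure_finite_Union)
    have "?E y \<in> sets (Pr x)" for y
      using X_sets[OF t, of x "{y}"] hitting_gt_sets[OF t] by (intro sets.sets_Collect_conj) auto
    then show "?E ` A \<subseteq> sets (Pr x)" by auto
  qed (auto simp: disjoint_family_on_def)
  moreover have "(\<Sum>y\<in>A. measure (Pr x) (?E y)) = flow (restr A (mfun P)) t (ind A) x"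
  proof -
    have "(\<Sum>y\<in>A. measure (Pr x) (?E y)) = (\<Sum>y\<in>A. flow (restr A (mfun P)) t (ind {y}) x)"
      by (intro sum.cong refl killed_prob t)
    also have "\<dots> = app (flow_kernel (restr A (mfun P)) t) (ind A) x"
      by (simp add: app_def ind_def if_distrib if_distribR sum.If_cases cong: if_cong)
    finally show ?thesis by (simp only: app_flow_kernel)
  qed
  ultimately show ?thesis by simp
qed

text \<open>
  Needed because the measure of a non-measurable set is \<open>0\<close> by convention. If \<open>b\<close> is hit first,
  the chain still sits at \<open>b\<close> at some rational time before \<open>B\<close> is hit.
\<close>

lemma hitting_before_sets:
  "{\<omega> \<in> space (Pr x). hitting_time X {b} \<omega> < hitting_time X B \<omega>} \<in> sets (Pr x)"
proof -
  have "hitting_time X {b} \<omega> < hitting_time X B \<omega> \<longleftrightarrow>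
      (\<exists>q::rat. 0 \<le> q \<and> X (of_rat q) \<omega> = b \<and> hitting_time X B \<omega> > ereal (of_rat q))"
    if w: "\<omega> \<in> space (Pr x)" for \<omega>
  proof
    assume "hitting_time X {b} \<omega> < hitting_time X B \<omega>"
    then obtain s where s: "0 \<le> s" "X s \<omega> = b" "ereal s < hitting_time X B \<omega>"
      unfolding hitting_time_def[of X "{b}"] Inf_less_iff by auto
    obtain c where c: "c > s" "\<And>r. s < r \<Longrightarrow> r < c \<Longrightarrow> X r \<omega> = X s \<omega>"
      using right_cont[OF w s(1)] unfolding eventually_at_right_field by blast
    obtain u where u: "u > s" "ereal u < hitting_time X B \<omega>"
      using ereal_dense2[OF s(3)] by auto
    obtain q where q: "s < of_rat q" "of_rat q < min c u"
      using of_rat_dense[of s "min c u"] c(1) u(1) by auto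
    have "0 \<le> q" using q(1) s(1) by (metis less_eq_real_def order_trans zero_le_of_rat_iff)
    moreover have "ereal (of_rat q) < hitting_time X B \<omega>"
      using q(2) u(2) by (intro order.strict_trans[OF _ u(2)]) simp
    ultimately show "\<exists>q::rat. 0 \<le> q \<and> X (of_rat q) \<omega> = b \<and> hitting_time X B \<omega> > ereal (of_rat q)"
      using c(2)[of "of_rat q"] q s(2) by auto
  next
    assume "\<exists>q::rat. 0 \<le> q \<and> X (of_rat q) \<omega> = b \<and> hitting_time X B \<omega> > ereal (of_rat q)"
    then obtain q where q: "0 \<le> q" "X (of_rat q) \<omega> = b" "hitting_time X B \<omega> > ereal (of_rat q)" by auto
    have "hitting_time X {b} \<omega> \<le> ereal (of_rat q)"
      unfolding hitting_time_def[of X "{b}"] using q by (intro Inf_lower) auto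
    then show "hitting_time X {b} \<omega> < hitting_time X B \<omega>" using q(3) by (rule le_less_trans)
  qed
  then have "{\<omega> \<in> space (Pr x). hitting_time X {b} \<omega> < hitting_time X B \<omega>}
      = (\<Union>q\<in>{q::rat. 0 \<le> q}. {\<omega> \<in> space (Pr x). X (of_rat q) \<omega> \<in> {b}}
          \<inter> {\<omega> \<in> space (Pr x). hitting_time X B \<omega> > ereal (of_rat q)})"
    by auto
  also have "\<dots> \<in> sets (Pr x)"
    by (intro sets.countable_UN'' sets.Int X_sets hitting_gt_sets countableI_type) auto
  finally show ?thesis .
qed

text \<open>
  Being at \<open>b\<close> at time \<open>1\<close> without having left \<open>A\<close> implies that \<open>b\<close> is hit before the exit.
\<close>

lemma connected_setI:
  assumes "A \<noteq> {}"
    and pos: "\<And>a b. a \<in> A \<Longrightarrow> b \<in> A \<Longrightarrow> 0 < flow (restr A (mfun P)) 1 (ind {b}) a"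
  shows "connected_set Pr X A"
  unfolding connected_set_def
proof (intro conjI ballI)
  fix a b assume ab: "a \<in> A" "b \<in> A"
  interpret prob_space "Pr a" by (rule prob_space_Pr)
  have "0 < measure (Pr a) {\<omega> \<in> space (Pr a). X 1 \<omega> = b \<and> hitting_time X (- A) \<omega> > ereal 1}"
    using killed_prob[of 1 b A a] pos[OF ab] ab by simp
  also have "\<dots> \<le> measure (Pr a) {\<omega> \<in> space (Pr a). hitting_time X {b} \<omega> < hitting_time X (- A) \<omega>}"
  proof (rule finite_measure_mono[OF _ hitting_before_sets], rule subsetI)
    fix \<omega> assume w: "\<omega> \<in> {\<omega> \<in> space (Pr a). X 1 \<omega> = b \<and> hitting_time X (- A) \<omega> > ereal 1}"
    then have "hitting_time X {b} \<omega> \<le> ereal 1"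
      unfolding hitting_time_def[of X "{b}"] by (intro Inf_lower) (auto intro!: exI[of _ 1])
    then show "\<omega> \<in> {\<omega> \<in> space (Pr a). hitting_time X {b} \<omega> < hitting_time X (- A) \<omega>}"
      using w by (auto intro: le_less_trans)
  qed
  finally show "0 < measure (Pr a) {\<omega> \<in> space (Pr a). hitting_time X {b} \<omega> < hitting_time X (- A) \<omega>}" .
qed fact

end

section \<open>Spectral gaps and decay\<close>

text \<open>
  The Rayleigh quotient attains its minimum on the unit sphere of \<open>S\<close>. Perturbing a minimiser in the
  direction of its residual \<open>L f - l f\<close> would decrease the quotient unless the residual is \<open>0\<close>,
  so the minimum is an eigenvalue. The weights and the subspace allow both restrictions of \<open>I - P\<close> to
  a set and its action on mean-zero functions.
\<close>

lemma rayleigh_minimum: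
  fixes w :: "'a::finite \<Rightarrow> real" and L :: "real^'a \<Rightarrow> real^'a" and S :: "(real^'a) set"
  assumes S: "subspace S" "S \<noteq> {0}" and L: "linear L" "\<And>f. f \<in> S \<Longrightarrow> L f \<in> S"
    and w: "\<And>x. 0 < w x"
    and sym: "\<And>f g. f \<in> S \<Longrightarrow> g \<in> S \<Longrightarrow> (\<Sum>x\<in>UNIV. w x * (L f $ x * g $ x)) = (\<Sum>x\<in>UNIV. w x * (f $ x * L g $ x))"
  obtains f l where "f \<in> S" "f \<noteq> 0" "L f = l *\<^sub>R f"
    "\<And>g. g \<in> S \<Longrightarrow> l * (\<Sum>x\<in>UNIV. w x * (g $ x * g $ x)) \<le> (\<Sum>x\<in>UNIV. w x * (g $ x * L g $ x))"
proof -
  define ip where "ip = (\<lambda>(f::real^'a) (g::real^'a). \<Sum>x\<in>UNIV. w x * (f $ x * g $ x))"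
  have ip_add: "ip (f + g) h = ip f h + ip g h" "ip h (f + g) = ip h f + ip h g" for f g h
    by (simp_all add: ip_def algebra_simps sum.distrib)
  have ip_scale: "ip (c *\<^sub>R f) h = c * ip f h" "ip h (c *\<^sub>R f) = c * ip h f" for f h c
    by (simp_all add: ip_def algebra_simps sum_distrib_left)
  have ip_comm: "ip f g = ip g f" for f g by (simp add: ip_def mult.commute)
  have ip_pos: "0 < ip f f" if f: "f \<noteq> 0" for f
  proof -
    obtain x where x: "f $ x \<noteq> 0" using f by (auto simp: vec_eq_iff)
    have "w x * (f $ x * f $ x) \<le> ip f f"
      unfolding ip_def
      by (rule member_le_sum) (use mult_nonneg_nonneg[OF less_imp_le[OF w] zero_le_square] in auto)
    moreover have "0 < w x * (f $ x * f $ x)"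
      using w[of x] x zero_less_power2[of "f $ x"] by (simp add: power2_eq_square)
    ultimately show ?thesis by linarith
  qed
  define q where "q = (\<lambda>f. ip f (L f) / ip f f)"
  have contL: "continuous_on T L" for T using L(1) by (rule linear_continuous_on[OF linear_conv_bounded_linear[THEN iffD1]])
  have cont: "continuous_on (S \<inter> sphere 0 1) q"
    unfolding q_def
  proof (rule continuous_on_divide)
    show "continuous_on (S \<inter> sphere 0 1) (\<lambda>f. ip f (L f))"
      unfolding ip_def by (intro continuous_intros contL)
    show "continuous_on (S \<inter> sphere 0 1) (\<lambda>f. ip f f)"
      unfolding ip_def by (intro continuous_intros)
    show "\<forall>f\<in>S \<inter> sphere 0 1. ip f f \<noteq> 0"
    proof
      fix f assume "f \<in> S \<inter> sphere 0 1"
      then have "f \<noteq> 0" by auto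
      then show "ip f f \<noteq> 0" using ip_pos[of f] by simp
    qed
  qed
  have comp: "compact (S \<inter> sphere 0 1)"
    using closed_subspace[OF S(1)] compact_sphere[of "0::real^'a" 1] by (simp add: closed_Int_compact)
  obtain h where h: "h \<in> S" "h \<noteq> 0" using S subspace_0 by blast
  have "(1 / norm h) *\<^sub>R h \<in> S \<inter> sphere 0 1"
    using h S(1) by (auto simp: subspace_scale)
  then have ne: "S \<inter> sphere 0 1 \<noteq> {}" by blast
  obtain f where f: "f \<in> S" "norm f = 1" and min: "\<And>g. g \<in> S \<inter> sphere 0 1 \<Longrightarrow> q f \<le> q g"
    using continuous_attains_inf[OF comp ne cont] by auto
  define l where "l = q f"
  have f0: "f \<noteq> 0" using f(2) by auto
  have ray: "l * ip g g \<le> ip g (L g)" if g: "g \<in> S" for g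
  proof (cases "g = 0")
    case True
    then show ?thesis by (simp add: ip_def)
  next
    case False
    define c where "c = 1 / norm g"
    have c: "c \<noteq> 0" using False by (simp add: c_def)
    have "c *\<^sub>R g \<in> S \<inter> sphere 0 1" using g S(1) False by (auto simp: subspace_scale c_def)
    then have "l \<le> q (c *\<^sub>R g)" using min unfolding l_def by blast
    also have "q (c *\<^sub>R g) = q g"
      using c by (simp add: q_def ip_scale linear_scale[OF L(1)])
    finally show ?thesis using ip_pos[OF False] by (simp add: q_def field_simps)
  qed
  define r where "r = L f - l *\<^sub>R f"
  have rS: "r \<in> S" using f(1) S(1) L(2) by (simp add: r_def subspace_diff subspace_scale)
  have eq: "ip f (L f) = l * ip f f" using ip_pos[OF f0] by (simp add: l_def q_def)
  have Lr: "ip f (L r) = ip r (L f)" using sym[OF f(1) rS] by (simp add: ip_def mult.commute)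
  have rr: "ip r (L f) - l * ip r f = ip r r"
  proof -
    have "ip h (L f - l *\<^sub>R f) = ip h (L f) - l * ip h f" for h
      by (simp add: ip_def algebra_simps sum_subtractf sum_distrib_left)
    from this[of r] show ?thesis by (simp add: r_def[symmetric])
  qed
  have "r = 0"
  proof (rule ccontr)
    assume r0: "r \<noteq> 0"
    define C where "C = ip r (L r) - l * ip r r"
    define A where "A = ip r r"
    have A0: "0 < A" using ip_pos[OF r0] by (simp add: A_def)
    have "0 \<le> 2 * e * A + e\<^sup>2 * C" for e
    proof -
      have "f + e *\<^sub>R r \<in> S" using f(1) rS S(1) by (simp add: subspace_add subspace_scale)
      then have "l * ip (f + e *\<^sub>R r) (f + e *\<^sub>R r) \<le> ip (f + e *\<^sub>R r) (L (f + e *\<^sub>R r))" by (rule ray)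
      then have "0 \<le> e * (ip r (L f) - l * ip r f) * 2 + e\<^sup>2 * C"
        using eq Lr ip_comm[of f r]
        by (simp add: linear_add[OF L(1)] linear_scale[OF L(1)] ip_add ip_scale C_def power2_eq_square algebra_simps)
      then show ?thesis using rr by (simp add: A_def algebra_simps)
    qed
    \<comment> \<open>a step so small and negative that the linear term wins\<close>
    from this[of "- A / (\<bar>C\<bar> + 1)"] have "0 \<le> - 2 * A\<^sup>2 / (\<bar>C\<bar> + 1) + A\<^sup>2 * C / (\<bar>C\<bar> + 1)\<^sup>2"
      by (simp add: power2_eq_square)
    moreover have "A\<^sup>2 * C / (\<bar>C\<bar> + 1)\<^sup>2 \<le> A\<^sup>2 / (\<bar>C\<bar> + 1)"
    proof -
      have "A\<^sup>2 * C / (\<bar>C\<bar> + 1)\<^sup>2 \<le> A\<^sup>2 * (\<bar>C\<bar> + 1) / (\<bar>C\<bar> + 1)\<^sup>2"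
        by (intro divide_right_mono mult_left_mono) auto
      also have "\<dots> = A\<^sup>2 / (\<bar>C\<bar> + 1)" by (simp add: power2_eq_square)
      finally show ?thesis .
    qed
    moreover have "0 < A\<^sup>2 / (\<bar>C\<bar> + 1)" using A0 by simp
    moreover have "- 2 * A\<^sup>2 / (\<bar>C\<bar> + 1) = - (2 * (A\<^sup>2 / (\<bar>C\<bar> + 1)))" by simp
    ultimately show False by linarith
  qed
  then have "L f = l *\<^sub>R f" by (simp add: r_def)
  with f(1) f0 ray show ?thesis using that[of f l] by (simp add: ip_def)
qed

text \<open>
  The energy has derivative minus twice the Dirichlet form, which the Rayleigh bound controls.
\<close>

lemma flow_decay:
  fixes w :: "'a::finite \<Rightarrow> real"
  assumes ray: "\<And>s. 0 \<le> s \<Longrightarrow> l * (\<Sum>x\<in>UNIV. w x * (flow R s f x)\<^sup>2)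
      \<le> (\<Sum>x\<in>UNIV. w x * (flow R s f x * (flow R s f x - app R (flow R s f) x)))"
    and t: "0 \<le> t"
  shows "(\<Sum>x\<in>UNIV. w x * (flow R t f x)\<^sup>2) \<le> exp (- 2 * l * t) * (\<Sum>x\<in>UNIV. w x * (f x)\<^sup>2)"
proof -
  define \<phi> where "\<phi> = (\<lambda>t. \<Sum>x\<in>UNIV. w x * (flow R t f x)\<^sup>2)"
  have "\<phi> t \<le> exp ((- 2 * l) * t) * \<phi> 0"
  proof (rule gronwall[OF _ _ t])
    fix s :: real assume s: "0 \<le> s"
    show "(\<phi> has_real_derivative (\<Sum>x\<in>UNIV. w x * (2 * (flow R s f x * app (gen R) (flow R s f) x)))) (at s)"
      unfolding \<phi>_def by (auto intro!: derivative_eq_intros flow_deriv sum.cong)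
    show "(\<Sum>x\<in>UNIV. w x * (2 * (flow R s f x * app (gen R) (flow R s f) x))) \<le> (- 2 * l) * \<phi> s"
    proof -
      have "(\<Sum>x\<in>UNIV. w x * (2 * (flow R s f x * app (gen R) (flow R s f) x)))
          = - 2 * (\<Sum>x\<in>UNIV. w x * (flow R s f x * (flow R s f x - app R (flow R s f) x)))"
        unfolding sum_distrib_left app_gen by (intro sum.cong) (auto simp: algebra_simps)
      then show ?thesis using ray[OF s] by (simp add: \<phi>_def)
    qed
  qed
  then show ?thesis by (simp add: \<phi>_def)
qed

locale rev_chain =
  fixes P :: "real^'a::finite^'a" and w :: "real^'a"
  assumes trans: "transition_matrix P" and irred: "irreducible_matrix P"
    and stat: "stationary_distribution P w" and rev: "reversible_wrt P w"
begin

abbreviation p :: "'a \<Rightarrow> 'a \<Rightarrow> real" where "p \<equiv> mfun P"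

lemma p_nonneg: "0 \<le> p x y" and p_sum: "(\<Sum>y\<in>UNIV. p x y) = 1" and p_substoch: "substoch p"
  using transition_matrix_substoch[OF trans] by auto

lemma rp_nonneg: "0 \<le> restr A p x y" by (simp add: restr_def p_nonneg)

lemma p_sym: "w $ x * p x y = w $ y * p y x"
  using rev by (simp add: reversible_wrt_def)

lemma rp_sym: "w $ x * restr A p x y = w $ y * restr A p y x"
  using p_sym by (simp add: restr_def)

lemma w_sum: "(\<Sum>x\<in>UNIV. w $ x) = 1" and w_nonneg: "0 \<le> w $ x"
  using stat by (auto simp: stationary_distribution_def)

lemma irreducible_pow_pos: "\<exists>k. 0 < (app p ^^ k) (ind {y}) x"
  using irred by (simp add: irreducible_matrix_def mat_power_entry)

text \<open>
  If \<open>y\<close> had mass \<open>0\<close>, then reversibility of the powers of \<open>P\<close> would transfer this to every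
  state from which \<open>y\<close> can be reached, that is, to all states.
\<close>

lemma w_pos: "0 < w $ y"
proof (rule ccontr)
  assume "\<not> 0 < w $ y"
  then have y0: "w $ y = 0" using w_nonneg[of y] by simp
  have "w $ x = 0" for x
  proof -
    obtain k where k: "0 < (app p ^^ k) (ind {y}) x" using irreducible_pow_pos by blast
    have "(\<Sum>z\<in>UNIV. w $ z * ((app p ^^ k) (\<lambda>_. 1) z * ind {y} z))
        = (\<Sum>z\<in>UNIV. w $ z * (1 * (app p ^^ k) (ind {y}) z))"
      by (rule app_pow_selfadj[OF p_sym, symmetric])
    moreover have "(\<Sum>z\<in>UNIV. w $ z * ((app p ^^ k) (\<lambda>_. 1) z * ind {y} z)) = 0"
      using y0 by (intro sum.neutral) (auto simp: ind_def)
    ultimately have "(\<Sum>z\<in>UNIV. w $ z * (app p ^^ k) (ind {y}) z) = 0" by simp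
    moreover have "w $ x * (app p ^^ k) (ind {y}) x \<le> (\<Sum>z\<in>UNIV. w $ z * (app p ^^ k) (ind {y}) z)"
      by (rule member_le_sum[of x UNIV "\<lambda>z. w $ z * (app p ^^ k) (ind {y}) z"])
         (auto intro!: mult_nonneg_nonneg w_nonneg app_pow_nonneg p_nonneg simp: ind_def)
    ultimately have "w $ x * (app p ^^ k) (ind {y}) x \<le> 0" by simp
    then show ?thesis using k w_nonneg[of x] by (simp add: mult_le_0_iff)
  qed
  then show False using w_sum by simp
qed

lemma dirichlet_form:
  "(\<Sum>x\<in>UNIV. w $ x * (f x * (f x - app p f x))) = (\<Sum>x\<in>UNIV. \<Sum>y\<in>UNIV. w $ x * p x y * (f x - f y)\<^sup>2) / 2"
proof -
  have 1: "(\<Sum>x\<in>UNIV. \<Sum>y\<in>UNIV. w $ x * p x y * (f x)\<^sup>2) = (\<Sum>x\<in>UNIV. w $ x * (f x)\<^sup>2)"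
    by (simp add: sum_distrib_right[symmetric] sum_distrib_left[symmetric] p_sum)
  have "(\<Sum>x\<in>UNIV. \<Sum>y\<in>UNIV. w $ x * p x y * (f y)\<^sup>2) = (\<Sum>y\<in>UNIV. \<Sum>x\<in>UNIV. w $ y * p y x * (f y)\<^sup>2)"
    by (subst sum.swap) (simp add: p_sym)
  then have 2: "(\<Sum>x\<in>UNIV. \<Sum>y\<in>UNIV. w $ x * p x y * (f y)\<^sup>2) = (\<Sum>x\<in>UNIV. w $ x * (f x)\<^sup>2)"
    using 1 by simp
  have 3: "(\<Sum>x\<in>UNIV. \<Sum>y\<in>UNIV. w $ x * p x y * (f x * f y)) = (\<Sum>x\<in>UNIV. w $ x * (f x * app p f x))"
    by (simp add: app_def sum_distrib_left algebra_simps)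
  have "(\<Sum>x\<in>UNIV. \<Sum>y\<in>UNIV. w $ x * p x y * (f x - f y)\<^sup>2)
      = (\<Sum>x\<in>UNIV. \<Sum>y\<in>UNIV. w $ x * p x y * (f x)\<^sup>2 + w $ x * p x y * (f y)\<^sup>2 - 2 * (w $ x * p x y * (f x * f y)))"
    by (intro sum.cong) (auto simp: power2_eq_square algebra_simps)
  also have "\<dots> = 2 * (\<Sum>x\<in>UNIV. w $ x * (f x)\<^sup>2) - 2 * (\<Sum>x\<in>UNIV. w $ x * (f x * app p f x))"
    by (simp add: sum.distrib sum_subtractf sum_distrib_left[symmetric] 1 2 3)
  finally show ?thesis by (simp add: right_diff_distrib sum_subtractf power2_eq_square)
qed

lemma dirichlet_nonneg: "0 \<le> (\<Sum>x\<in>UNIV. w $ x * (f x * (f x - app p f x)))"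
  unfolding dirichlet_form by (auto intro!: sum_nonneg mult_nonneg_nonneg w_nonneg p_nonneg divide_nonneg_nonneg)

text \<open>
  If the form vanishes, \<open>f\<close> does not change along possible transitions, and any two states are joined
  by such transitions.
\<close>

lemma dirichlet_zero_const:
  assumes z: "(\<Sum>x\<in>UNIV. w $ x * (f x * (f x - app p f x))) = 0"
  shows "f x = f y"
proof -
  have *: "(\<Sum>x\<in>UNIV. \<Sum>y\<in>UNIV. w $ x * p x y * (f x - f y)\<^sup>2) = 0"
    using z unfolding dirichlet_form by simp
  have e: "p x y * (f x - f y)\<^sup>2 = 0" for x y
  proof -
    have "w $ x \<noteq> 0" using w_pos[of x] by simp
    moreover have "w $ x * p x y * (f x - f y)\<^sup>2 = 0"
      using * by (simp add: sum_nonneg_eq_0_iff sum_nonneg p_nonneg w_nonneg) blast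
    ultimately show ?thesis by simp
  qed
  have inv: "(app p ^^ k) (\<lambda>z. (f z - f x)\<^sup>2) x = 0" for k x
  proof (induction k arbitrary: x)
    case (Suc k)
    have "(app p ^^ Suc k) (\<lambda>z. (f z - f x)\<^sup>2) x = (\<Sum>y\<in>UNIV. p x y * (app p ^^ k) (\<lambda>z. (f z - f x)\<^sup>2) y)"
      by (simp add: app_def)
    also have "\<dots> = (\<Sum>y\<in>UNIV. p x y * (app p ^^ k) (\<lambda>z. (f z - f y)\<^sup>2) y)"
    proof (intro sum.cong refl)
      fix y show "p x y * (app p ^^ k) (\<lambda>z. (f z - f x)\<^sup>2) y = p x y * (app p ^^ k) (\<lambda>z. (f z - f y)\<^sup>2) y"
        using e[of x y] by (cases "p x y = 0") auto
    qed
    finally show ?case using Suc by simp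
  qed simp
  obtain k where k: "0 < (app p ^^ k) (ind {y}) x" using irreducible_pow_pos by blast
  have "(f y - f x)\<^sup>2 * (app p ^^ k) (ind {y}) x = (app p ^^ k) (\<lambda>z. (f y - f x)\<^sup>2 * ind {y} z) x"
    by (simp add: app_pow_cmult)
  also have "\<dots> \<le> (app p ^^ k) (\<lambda>z. (f z - f x)\<^sup>2) x"
    by (rule app_pow_mono) (auto simp: ind_def p_nonneg)
  finally show ?thesis using inv[where k = k and x = x] k by (simp add: mult_le_0_iff)
qed

text \<open>
  The least eigenvalue is the minimum of the Rayleigh quotient over functions supported in \<open>A\<close>.
  It is positive because an eigenfunction with eigenvalue \<open>\<le> 0\<close>, extended by \<open>0\<close>, would have
  vanishing Dirichlet form, hence be constant, hence \<open>0\<close>.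
\<close>

lemma lambda_on_props:
  assumes A: "A \<noteq> {}"
  shows "\<And>f. (\<And>x. x \<notin> A \<Longrightarrow> f x = 0) \<Longrightarrow> lambda_on P A * (\<Sum>x\<in>UNIV. w $ x * (f x)\<^sup>2)
      \<le> (\<Sum>x\<in>UNIV. w $ x * (f x * (f x - app (restr A p) f x)))"
    and "A \<noteq> UNIV \<Longrightarrow> 0 < lambda_on P A"
proof -
  define S where "S = {f::real^'a. \<forall>x. x \<notin> A \<longrightarrow> f $ x = 0}"
  define L where "L = (\<lambda>f::real^'a. \<chi> x. f $ x - app (restr A p) (\<lambda>y. f $ y) x)"
  have Lx: "L f $ x = f $ x - app (restr A p) (\<lambda>y. f $ y) x" for f x by (simp add: L_def)
  have sub: "subspace S" by (simp add: S_def subspace_def)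
  obtain a where a: "a \<in> A" using A by blast
  have "(\<chi> x. ind {a} x) \<in> S" "(\<chi> x. ind {a} x) \<noteq> (0::real^'a)"
    using a by (auto simp: S_def ind_def vec_eq_iff)
  then have ne: "S \<noteq> {0}" by blast
  have lin: "linear L"
    by (rule linearI) (simp_all add: L_def vec_eq_iff app_def sum.distrib sum_distrib_left algebra_simps)
  have LS: "L f \<in> S" if "f \<in> S" for f
    using that by (auto simp: S_def Lx app_def restr_def)
  have sym: "(\<Sum>x\<in>UNIV. w $ x * (L f $ x * g $ x)) = (\<Sum>x\<in>UNIV. w $ x * (f $ x * L g $ x))" for f g
    using app_pow_selfadj[where w = "\<lambda>x. w $ x" and R = "restr A p" and k = 1 and f = "\<lambda>x. f $ x" and g = "\<lambda>x. g $ x", OF rp_sym]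
    by (simp add: Lx algebra_simps sum_subtractf)
  obtain f l where f: "f \<in> S" "f \<noteq> 0" "L f = l *\<^sub>R f"
    and ray: "\<And>g. g \<in> S \<Longrightarrow> l * (\<Sum>x\<in>UNIV. w $ x * (g $ x * g $ x)) \<le> (\<Sum>x\<in>UNIV. w $ x * (g $ x * L g $ x))"
    using rayleigh_minimum[where w = "\<lambda>x. w $ x" and L = L, OF sub ne lin LS w_pos sym] by blast
  have eig: "(\<Sum>y\<in>A. (mat 1 - P) $ x $ y * h $ y) = h $ x - app (restr A p) (\<lambda>y. h $ y) x" if x: "x \<in> A" for h x
  proof -
    have "(\<Sum>y\<in>A. (mat 1 - P) $ x $ y * h $ y) = (\<Sum>y\<in>A. (if y = x then h $ y else 0) - p x y * h $ y)"
      by (intro sum.cong) (auto simp: mat_def algebra_simps)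
    also have "\<dots> = h $ x - (\<Sum>y\<in>A. p x y * h $ y)"
      using x by (simp add: sum_subtractf)
    also have "(\<Sum>y\<in>A. p x y * h $ y) = app (restr A p) (\<lambda>y. h $ y) x"
      unfolding app_def using x by (intro sum.mono_neutral_cong_left) (auto simp: restr_def)
    finally show ?thesis .
  qed
  have "lambda_on P A = l"
    unfolding lambda_on_def
  proof (rule Least_equality)
    obtain x where "f $ x \<noteq> 0" using f(2) by (auto simp: vec_eq_iff)
    then have "\<exists>x\<in>A. f $ x \<noteq> 0" using f(1) by (auto simp: S_def)
    moreover have "\<forall>x\<in>A. (\<Sum>y\<in>A. (mat 1 - P) $ x $ y * f $ y) = l * f $ x"
      using eig f(3) Lx[of f] by simp
    ultimately show "eigenvalue_on A (mat 1 - P) l" unfolding eigenvalue_on_def by blast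
  next
    fix m assume "eigenvalue_on A (mat 1 - P) m"
    then obtain h where h: "\<exists>x\<in>A. h $ x \<noteq> 0" "\<And>x. x \<in> A \<Longrightarrow> (\<Sum>y\<in>A. (mat 1 - P) $ x $ y * h $ y) = m * h $ x"
      unfolding eigenvalue_on_def by blast
    define g where "g = (\<chi> x. if x \<in> A then h $ x else 0)"
    have gS: "g \<in> S" by (simp add: g_def S_def)
    have "app (restr A p) (\<lambda>y. g $ y) x = app (restr A p) (\<lambda>y. h $ y) x" for x
      unfolding app_def by (intro sum.cong) (auto simp: restr_def g_def)
    then have gL: "g $ x * L g $ x = m * (g $ x * g $ x)" for x
      using h(2)[of x] eig[of x h] by (cases "x \<in> A") (auto simp: Lx g_def)
    have "l * (\<Sum>x\<in>UNIV. w $ x * (g $ x * g $ x)) \<le> m * (\<Sum>x\<in>UNIV. w $ x * (g $ x * g $ x))"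
      using ray[OF gS] unfolding gL by (simp add: sum_distrib_left mult.left_commute)
    moreover have "0 < (\<Sum>x\<in>UNIV. w $ x * (g $ x * g $ x))"
    proof -
      obtain x where x: "x \<in> A" "h $ x \<noteq> 0" using h(1) by blast
      show ?thesis
        by (rule sum_pos2[of _ x]) (use x w_pos[of x] w_nonneg in \<open>auto simp: g_def intro!: mult_pos_pos mult_nonneg_nonneg simp: zero_less_mult_iff\<close>)
    qed
    ultimately show "l \<le> m" by simp
  qed
  note l = this
  have ray': "l * (\<Sum>x\<in>UNIV. w $ x * (g x)\<^sup>2) \<le> (\<Sum>x\<in>UNIV. w $ x * (g x * (g x - app (restr A p) g x)))"
    if "\<And>x. x \<notin> A \<Longrightarrow> g x = 0" for g
    using ray[of "\<chi> x. g x"] that by (simp add: S_def Lx power2_eq_square)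
  then show "\<And>f. (\<And>x. x \<notin> A \<Longrightarrow> f x = 0) \<Longrightarrow> lambda_on P A * (\<Sum>x\<in>UNIV. w $ x * (f x)\<^sup>2)
      \<le> (\<Sum>x\<in>UNIV. w $ x * (f x * (f x - app (restr A p) f x)))" unfolding l by blast
  show "0 < lambda_on P A" if "A \<noteq> UNIV"
  proof (rule ccontr)
    assume "\<not> 0 < lambda_on P A"
    then have l0: "l \<le> 0" by (simp add: l)
    have fA: "f $ x = 0" if "x \<notin> A" for x using f(1) that by (simp add: S_def)
    have "f $ x * (f $ x - app p (\<lambda>y. f $ y) x) = l * (f $ x)\<^sup>2" for x
    proof (cases "x \<in> A")
      case True
      have "app p (\<lambda>y. f $ y) x = app (restr A p) (\<lambda>y. f $ y) x"
        unfolding app_def using True fA by (intro sum.cong) (auto simp: restr_def)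
      then show ?thesis using Lx[of f x] f(3) by (simp add: power2_eq_square)
    qed (simp add: fA)
    then have "(\<Sum>x\<in>UNIV. w $ x * (f $ x * (f $ x - app p (\<lambda>y. f $ y) x))) = l * (\<Sum>x\<in>UNIV. w $ x * (f $ x)\<^sup>2)"
      by (simp add: sum_distrib_left algebra_simps)
    moreover have "0 \<le> (\<Sum>x\<in>UNIV. w $ x * (f $ x)\<^sup>2)" by (intro sum_nonneg mult_nonneg_nonneg w_nonneg) auto
    ultimately have "(\<Sum>x\<in>UNIV. w $ x * (f $ x * (f $ x - app p (\<lambda>y. f $ y) x))) = 0"
      using l0 dirichlet_nonneg[of "\<lambda>x. f $ x"] by (smt (verit) mult_nonpos_nonneg)
    from dirichlet_zero_const[OF this] have c: "f $ x = f $ y" for x y .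
    obtain z where "z \<notin> A" using \<open>A \<noteq> UNIV\<close> by blast
    then have "f $ x = 0" for x using c[of x z] fA by simp
    then show False using f(2) by (simp add: vec_eq_iff)
  qed
qed

text \<open>
  The division in \<^const>\<open>t_rel\<close> makes sense only for a positive gap, so positivity is part of
  the predicate.
\<close>

definition is_gap :: "real \<Rightarrow> bool" where
  "is_gap l \<longleftrightarrow> 0 < l \<and> t_rel P = 1 / l \<and>
     (\<forall>f. (\<Sum>x\<in>UNIV. w $ x * f x) = 0 \<longrightarrow> l * (\<Sum>x\<in>UNIV. w $ x * (f x)\<^sup>2)
        \<le> (\<Sum>x\<in>UNIV. w $ x * (f x * (f x - app p f x))))"

text \<open>
  An eigenfunction with non-zero eigenvalue has mean \<open>0\<close>, so the least non-zero eigenvalue is the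
  minimum of the Rayleigh quotient over mean-zero functions.
\<close>

lemma gap_eigenfunction:
  assumes card: "2 \<le> CARD('a)"
  obtains l f where "is_gap l" "(\<Sum>x\<in>UNIV. w $ x * f x) = 0" "\<exists>x. f x \<noteq> 0"
    "\<forall>x. app p f x = (1 - l) * f x"
proof -
  define S where "S = {f::real^'a. (\<Sum>x\<in>UNIV. w $ x * f $ x) = 0}"
  define L where "L = (\<lambda>f::real^'a. \<chi> x. f $ x - app p (\<lambda>y. f $ y) x)"
  have Lx: "L f $ x = f $ x - app p (\<lambda>y. f $ y) x" for f x by (simp add: L_def)
  have sub: "subspace S"
    by (auto simp: S_def subspace_def distrib_left sum.distrib mult.left_commute[of "w $ _"] sum_distrib_left[symmetric])
  obtain a b :: 'a where ab: "a \<noteq> b"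
  proof (rule ccontr)
    assume n: "\<not> thesis"
    have "UNIV \<subseteq> {undefined :: 'a}" using n that by auto
    then have "CARD('a) \<le> card {undefined :: 'a}" by (intro card_mono) auto
    then show False using card by simp
  qed
  define h where "h = (\<chi> x. ind {a} x / w $ a - ind {b} x / w $ b)"
  have "(\<Sum>x\<in>UNIV. w $ x * h $ x) = (\<Sum>x\<in>UNIV. (if x = a then 1 else 0) - (if x = b then 1 else 0))"
    using w_pos[of a] w_pos[of b] by (intro sum.cong) (auto simp: h_def ind_def)
  then have "h \<in> S" by (simp add: S_def sum_subtractf)
  moreover have "h \<noteq> 0"
    using ab w_pos[of a] by (auto simp: vec_eq_iff h_def ind_def intro!: exI[of _ a])
  ultimately have ne: "S \<noteq> {0}" by blast
  have lin: "linear L"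
    by (rule linearI) (simp_all add: L_def vec_eq_iff app_def sum.distrib sum_distrib_left algebra_simps)
  have inv: "(\<Sum>x\<in>UNIV. w $ x * app p f x) = (\<Sum>x\<in>UNIV. w $ x * f x)" for f
    using app_pow_selfadj[where w = "\<lambda>x. w $ x" and R = p and k = 1 and f = "\<lambda>_. 1" and g = f, OF p_sym] p_sum
    by (simp add: app_def[of p "\<lambda>_. 1"])
  have LS: "L f \<in> S" if "f \<in> S" for f
    using that inv by (simp add: S_def Lx right_diff_distrib sum_subtractf)
  have sym: "(\<Sum>x\<in>UNIV. w $ x * (L f $ x * g $ x)) = (\<Sum>x\<in>UNIV. w $ x * (f $ x * L g $ x))" for f g
    using app_pow_selfadj[where w = "\<lambda>x. w $ x" and R = p and k = 1 and f = "\<lambda>x. f $ x" and g = "\<lambda>x. g $ x", OF p_sym]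
    by (simp add: Lx algebra_simps sum_subtractf)
  obtain f l where f: "f \<in> S" "f \<noteq> 0" "L f = l *\<^sub>R f"
    and ray: "\<And>g. g \<in> S \<Longrightarrow> l * (\<Sum>x\<in>UNIV. w $ x * (g $ x * g $ x)) \<le> (\<Sum>x\<in>UNIV. w $ x * (g $ x * L g $ x))"
    using rayleigh_minimum[where w = "\<lambda>x. w $ x" and L = L, OF sub ne lin LS w_pos sym] by blast
  have pos: "0 < (\<Sum>x\<in>UNIV. w $ x * (g $ x * g $ x))" if g0: "g \<noteq> 0" for g :: "real^'a"
  proof -
    obtain x where x: "g $ x \<noteq> 0" using g0 by (auto simp: vec_eq_iff)
    show ?thesis
      by (rule sum_pos2[of _ x]) (use x w_pos[of x] w_nonneg in \<open>auto intro!: mult_pos_pos mult_nonneg_nonneg simp: zero_less_mult_iff\<close>)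
  qed
  have Lf: "L f $ x = l * f $ x" for x using f(3) by simp
  have l0: "0 < l"
  proof (rule ccontr)
    assume n: "\<not> 0 < l"
    have "(\<Sum>x\<in>UNIV. w $ x * (f $ x * (f $ x - app p (\<lambda>y. f $ y) x))) = l * (\<Sum>x\<in>UNIV. w $ x * (f $ x * f $ x))"
      unfolding Lx[symmetric] Lf by (simp add: sum_distrib_left algebra_simps)
    then have "(\<Sum>x\<in>UNIV. w $ x * (f $ x * (f $ x - app p (\<lambda>y. f $ y) x))) = 0"
      using n dirichlet_nonneg[of "\<lambda>x. f $ x"] pos[OF f(2)] by (smt (verit) mult_nonpos_nonneg)
    from dirichlet_zero_const[OF this] have c: "f $ x = f $ a" for x .
    have "(\<Sum>x\<in>UNIV. w $ x * f $ x) = (\<Sum>x\<in>UNIV. w $ x) * f $ a"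
      unfolding sum_distrib_right by (intro sum.cong refl arg_cong2[where f = "(*)"] c)
    then have a0: "f $ a = 0" using f(1) by (simp add: S_def w_sum)
    have "f $ x = 0" for x using c[of x] a0 by simp
    then show False using f(2) by (simp add: vec_eq_iff)
  qed
  have eig: "(\<Sum>y\<in>UNIV. (mat 1 - P) $ x $ y * h $ y) = L h $ x" for h x
  proof -
    have "(\<Sum>y\<in>UNIV. (mat 1 - P) $ x $ y * h $ y) = (\<Sum>y\<in>UNIV. (if y = x then h $ y else 0) - p x y * h $ y)"
      by (intro sum.cong) (auto simp: mat_def algebra_simps)
    then show ?thesis by (simp add: sum_subtractf Lx app_def)
  qed
  have "(LEAST l. l \<noteq> 0 \<and> eigenvalue_on UNIV (mat 1 - P) l) = l"
  proof (rule Least_equality)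
    show "l \<noteq> 0 \<and> eigenvalue_on UNIV (mat 1 - P) l"
      using l0 f(2) Lf unfolding eigenvalue_on_def eig by (auto simp: vec_eq_iff)
  next
    fix m assume m: "m \<noteq> 0 \<and> eigenvalue_on UNIV (mat 1 - P) m"
    then obtain g where g: "\<exists>x. g $ x \<noteq> 0" "\<And>x. L g $ x = m * g $ x"
      unfolding eigenvalue_on_def eig by blast
    have "(\<Sum>x\<in>UNIV. w $ x * L g $ x) = 0" using inv by (simp add: Lx right_diff_distrib sum_subtractf)
    then have "m * (\<Sum>x\<in>UNIV. w $ x * g $ x) = 0" unfolding g(2) by (simp add: sum_distrib_left algebra_simps)
    then have gS: "g \<in> S" using m by (simp add: S_def)
    have "l * (\<Sum>x\<in>UNIV. w $ x * (g $ x * g $ x)) \<le> m * (\<Sum>x\<in>UNIV. w $ x * (g $ x * g $ x))"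
      using ray[OF gS] unfolding g(2) by (simp add: sum_distrib_left algebra_simps)
    moreover have "g \<noteq> 0" using g(1) by auto
    ultimately show "l \<le> m" using pos by simp
  qed
  then have t: "t_rel P = 1 / l" by (simp add: t_rel_def)
  show ?thesis
  proof (rule that[of l "\<lambda>x. f $ x"])
    show "(\<Sum>x\<in>UNIV. w $ x * f $ x) = 0" using f(1) by (simp add: S_def)
    show "\<exists>x. f $ x \<noteq> 0" using f(2) by (auto simp: vec_eq_iff)
    have "app p (\<lambda>y. f $ y) x = (1 - l) * f $ x" for x using Lf[of x] by (simp add: Lx algebra_simps)
    then show "\<forall>x. app p (\<lambda>y. f $ y) x = (1 - l) * f $ x" by blast
    have "l * (\<Sum>x\<in>UNIV. w $ x * (g x)\<^sup>2) \<le> (\<Sum>x\<in>UNIV. w $ x * (g x * (g x - app p g x)))"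
      if "(\<Sum>x\<in>UNIV. w $ x * g x) = 0" for g
      using ray[of "\<chi> x. g x"] that by (simp add: S_def Lx power2_eq_square)
    then show "is_gap l" using l0 t by (simp add: is_gap_def)
  qed
qed

end

section \<open>A maximal inequality for reversible chains\<close>

lemma young_4: "4 * \<mu> * \<sigma> ^ 3 \<le> 3 * \<sigma> ^ 4 + \<mu> ^ 4" for \<mu> \<sigma> :: real
proof -
  have "0 \<le> (\<sigma> - \<mu>)\<^sup>2 * (2 * \<sigma>\<^sup>2 + (\<sigma> + \<mu>)\<^sup>2)" by simp
  also have "\<dots> = 3 * \<sigma> ^ 4 + \<mu> ^ 4 - 4 * \<mu> * \<sigma> ^ 3"
    by (simp add: power2_eq_square power3_eq_cube power4_eq_xxxx algebra_simps)
  finally show ?thesis by simp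
qed

text \<open>
  The weighted inequality above with \<open>1.27 \<sigma>\<close> in place of \<open>\<sigma>\<close>; the factor only has to satisfy
  \<open>4 * 1.27 ^ 3 \<ge> 8\<close> and \<open>3 * 1.27 ^ 4 \<le> 8\<close>.
\<close>

lemma young_base:
  fixes \<mu> \<sigma> :: real assumes "0 \<le> \<mu>" "0 \<le> \<sigma>" shows "8 * \<mu> * \<sigma> ^ 3 \<le> 8 * \<sigma> ^ 4 + \<mu> ^ 4"
proof -
  have "4 * \<mu> * (127/100 * \<sigma>) ^ 3 \<le> 3 * (127/100 * \<sigma>) ^ 4 + \<mu> ^ 4" by (rule young_4)
  then have a: "4 * (127/100) ^ 3 * (\<mu> * \<sigma> ^ 3) \<le> 3 * (127/100) ^ 4 * \<sigma> ^ 4 + \<mu> ^ 4"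
    unfolding power_mult_distrib by (simp only: ac_simps)
  have "8 * (\<mu> * \<sigma> ^ 3) \<le> 4 * (127/100) ^ 3 * (\<mu> * \<sigma> ^ 3)"
    using assms by (intro mult_right_mono) (auto simp: power3_eq_cube)
  moreover have "3 * (127/100) ^ 4 * \<sigma> ^ 4 \<le> 8 * \<sigma> ^ 4"
    by (rule mult_right_mono) (simp add: power4_eq_xxxx, simp)
  ultimately show ?thesis using a by (simp only: mult.assoc)
qed

text \<open>
  Starr's maximal inequality in exponent \<open>4/3\<close> for \<open>g = \<sigma> ^ 3\<close>, with a non-optimal constant. By Rota's
  observation \<open>(Q ^^ (2 * k)) g y\<close> is the conditional mean, given \<open>X\<^sub>0 = y\<close>, of \<open>(Q ^^ k) g\<close> at
  \<open>X\<^sub>k\<close>, and by reversibility these variables form a martingale when \<open>k\<close> decreases. Doob's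
  inequality for that martingale is proved by a Bellman function, so no path space is needed: with
  \<open>\<mu>\<close> the running maximum of \<open>((Q ^^ k) g) powr (1/3)\<close>, the expression \<open>2 \<mu> ^ 4 - 8 \<mu> (Q ^^ k) g\<close> dominates
  what the rest of the path can contribute, up to \<open>8 (Q ^^ k) (\<sigma> ^ 4)\<close>. The indicators \<open>u k\<close>
  split \<open>A\<close> according to the first \<open>k\<close> at which the level is exceeded.
\<close>

lemma maximal_inequality:
  fixes w :: "'a::finite \<Rightarrow> real" and Q :: "'a \<Rightarrow> 'a \<Rightarrow> real"
  assumes Q: "\<And>x y. 0 \<le> Q x y" "\<And>x. (\<Sum>y\<in>UNIV. Q x y) = 1"
    and w: "\<And>x. 0 \<le> w x" and sym: "\<And>x y. w x * Q x y = w y * Q y x"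
    and \<sigma>: "\<And>y. 0 \<le> \<sigma> y" and \<theta>: "0 \<le> \<theta>"
    and A: "\<And>y. y \<in> A \<Longrightarrow> \<exists>k\<le>N. (app Q ^^ (2 * k)) (\<lambda>z. \<sigma> z ^ 3) y > \<theta> ^ 3"
  shows "\<theta> ^ 4 * (\<Sum>y\<in>A. w y) \<le> 8 * (\<Sum>y\<in>UNIV. w y * \<sigma> y ^ 4)"
proof -
  define T where "T = (\<lambda>k. app Q ^^ k)"
  have T0: "T 0 f = f" and TS: "T (Suc k) f = app Q (T k f)" for k f by (simp_all add: T_def)
  have Q_const: "app Q (\<lambda>_. c) = (\<lambda>_. c)" for c
    by (simp add: app_def Q(2) sum_distrib_right[symmetric] fun_eq_iff)
  have T_const: "T k (\<lambda>_. c) = (\<lambda>_. c)" for k c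
    by (induction k) (simp_all add: T0 TS Q_const)
  have T_nonneg: "0 \<le> T k f y" if "\<And>y. 0 \<le> f y" for k f y
    unfolding T_def by (rule app_pow_nonneg[OF Q(1) that])
  have T_mono: "T k f y \<le> T k g y" if "\<And>y. 0 \<le> f y" "\<And>y. f y \<le> g y" for k f g y
    unfolding T_def by (rule app_pow_mono) (use Q that in auto)
  have Q_mono: "app Q f y \<le> app Q g y" if "\<And>y. f y \<le> g y" for f g y
    unfolding app_def by (intro sum_mono mult_left_mono Q that)
  define c where "c = (\<lambda>k y. root 3 (T k (\<lambda>z. \<sigma> z ^ 3) y))"
  have c3: "c k y ^ 3 = T k (\<lambda>z. \<sigma> z ^ 3) y" and c0: "0 \<le> c k y" for k y
    using T_nonneg[of "\<lambda>z. \<sigma> z ^ 3" k y] \<sigma> by (simp_all add: c_def)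
  have c_0: "c 0 y = \<sigma> y" for y
    using \<sigma>[of y] by (simp add: c_def T0 real_root_power_cancel)
  define K where "K = (\<lambda>y. LEAST k. k \<le> N \<and> T (2 * k) (\<lambda>z. \<sigma> z ^ 3) y > \<theta> ^ 3)"
  have K: "K y \<le> N" "T (2 * K y) (\<lambda>z. \<sigma> z ^ 3) y > \<theta> ^ 3" if "y \<in> A" for y
    using LeastI_ex[of "\<lambda>k. k \<le> N \<and> T (2 * k) (\<lambda>z. \<sigma> z ^ 3) y > \<theta> ^ 3"] A[OF that]
    unfolding K_def T_def by auto
  define u where "u = (\<lambda>k y. if y \<in> A \<and> K y = k then 1 else 0 :: real)"
  define V where "V = (\<lambda>k y. 1 - (\<Sum>j\<le>k. u j y))"
  have V0: "0 \<le> V k y" for k y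
  proof -
    have "(\<Sum>j\<le>k. u j y) \<le> (\<Sum>j\<le>k. if j = K y then 1 else 0)"
      by (intro sum_mono) (auto simp: u_def)
    also have "\<dots> \<le> 1" by simp
    finally show ?thesis by (simp add: V_def)
  qed
  define R where "R = (\<lambda>k y. \<Sum>j\<le>k. T (k - j) (\<lambda>z. c j z ^ 4 * T j (u j) z) y)"
  have R_Suc: "R (Suc k) y = app Q (R k) y + c (Suc k) y ^ 4 * T (Suc k) (u (Suc k)) y" for k y
  proof -
    have "R (Suc k) y = (\<Sum>j\<le>k. T (Suc k - j) (\<lambda>z. c j z ^ 4 * T j (u j) z) y) + c (Suc k) y ^ 4 * T (Suc k) (u (Suc k)) y"
      by (simp add: R_def T0)
    also have "(\<Sum>j\<le>k. T (Suc k - j) (\<lambda>z. c j z ^ 4 * T j (u j) z) y) = app Q (R k) y"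
      unfolding R_def app_sum by (intro sum.cong) (auto simp: Suc_diff_le TS)
    finally show ?thesis .
  qed
  \<comment> \<open>the Bellman inequality; a larger current value than \<open>\<mu>\<close> becomes the new maximum\<close>
  have main: "R k y + \<mu> ^ 4 * T k (V k) y \<le> 8 * T k (\<lambda>z. \<sigma> z ^ 4) y + 2 * \<mu> ^ 4 - 8 * \<mu> * c k y ^ 3"
    if "c k y \<le> \<mu>" for k y \<mu>
    using that
  proof (induction k arbitrary: y \<mu>)
    case 0
    have s: "0 \<le> \<sigma> y" "\<sigma> y \<le> \<mu>" using 0 \<sigma> by (simp_all add: c_0)
    then have "\<sigma> y ^ 4 * u 0 y \<le> \<mu> ^ 4 * u 0 y"
      by (intro mult_right_mono power_mono) (auto simp: u_def)
    then have "R 0 y + \<mu> ^ 4 * T 0 (V 0) y \<le> \<mu> ^ 4"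
      by (simp add: R_def T0 c_0 V_def algebra_simps)
    moreover have "8 * \<mu> * \<sigma> y ^ 3 \<le> 8 * \<sigma> y ^ 4 + \<mu> ^ 4" by (rule young_base) (use s in auto)
    ultimately show ?case by (simp add: T0 c_0)
  next
    case (Suc k)
    have \<mu>0: "0 \<le> \<mu>" using c0[of "Suc k" y] Suc.prems by linarith
    let ?G = "\<lambda>z. 8 * T k (\<lambda>z. \<sigma> z ^ 4) z + 2 * \<mu> ^ 4 + (- (8 * \<mu>)) * T k (\<lambda>z. \<sigma> z ^ 3) z"
    have pt: "R k z + \<mu> ^ 4 * T k (V k) z \<le> ?G z" for z
    proof (cases "c k z \<le> \<mu>")
      case True
      from Suc.IH[OF True] show ?thesis by (simp add: c3)
    next
      case False
      define \<nu> where "\<nu> = c k z"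
      have \<nu>: "\<mu> \<le> \<nu>" "\<nu> ^ 3 = T k (\<lambda>z. \<sigma> z ^ 3) z" using False by (simp_all add: \<nu>_def c3)
      have "\<mu> ^ 4 * T k (V k) z \<le> \<nu> ^ 4 * T k (V k) z"
        using \<nu>(1) \<mu>0 by (intro mult_right_mono power_mono T_nonneg V0) auto
      moreover have "R k z + \<nu> ^ 4 * T k (V k) z \<le> 8 * T k (\<lambda>z. \<sigma> z ^ 4) z + 2 * \<nu> ^ 4 - 8 * \<nu> * \<nu> ^ 3"
        using Suc.IH[of z \<nu>] by (simp add: \<nu>_def)
      moreover have "\<nu> * \<nu> ^ 3 = \<nu> ^ 4" by (simp add: power_eq_if)
      moreover have "4 * \<mu> * \<nu> ^ 3 \<le> 3 * \<nu> ^ 4 + \<mu> ^ 4" by (rule young_4)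
      ultimately show ?thesis using \<nu>(2) by simp
    qed
    have VV: "(\<lambda>y. u (Suc k) y + V (Suc k) y) = V k" by (simp add: V_def fun_eq_iff)
    have "c (Suc k) y ^ 4 * T (Suc k) (u (Suc k)) y \<le> \<mu> ^ 4 * T (Suc k) (u (Suc k)) y"
      using Suc.prems c0 by (intro mult_right_mono power_mono T_nonneg) (auto simp: u_def)
    then have "R (Suc k) y + \<mu> ^ 4 * T (Suc k) (V (Suc k)) y
        \<le> app Q (R k) y + \<mu> ^ 4 * (T (Suc k) (u (Suc k)) y + T (Suc k) (V (Suc k)) y)"
      unfolding R_Suc by (simp add: distrib_left)
    also have "T (Suc k) (u (Suc k)) y + T (Suc k) (V (Suc k)) y = T (Suc k) (V k) y"
      unfolding VV[symmetric] T_def app_pow_add ..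
    also have "app Q (R k) y + \<mu> ^ 4 * T (Suc k) (V k) y = app Q (\<lambda>z. R k z + \<mu> ^ 4 * T k (V k) z) y"
      by (simp add: app_add app_cmult TS)
    also have "\<dots> \<le> app Q ?G y" by (rule Q_mono[OF pt])
    also have "\<dots> = 8 * T (Suc k) (\<lambda>z. \<sigma> z ^ 4) y + 2 * \<mu> ^ 4 - 8 * \<mu> * c (Suc k) y ^ 3"
      unfolding app_add app_cmult Q_const c3 TS by simp
    finally show ?case .
  qed
  have inv: "(\<Sum>x\<in>UNIV. w x * T k f x) = (\<Sum>x\<in>UNIV. w x * f x)" for k f
    using app_pow_selfadj[where w = w and R = Q and k = k and f = "\<lambda>_. 1" and g = f, OF sym]
      T_const[of k 1] by (simp add: T_def)
  have RN: "R N y \<le> 8 * T N (\<lambda>z. \<sigma> z ^ 4) y" for y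
  proof -
    have "0 \<le> c N y ^ 4 * T N (V N) y" by (intro mult_nonneg_nonneg T_nonneg V0) auto
    moreover have "c N y * c N y ^ 3 = c N y ^ 4" by (simp add: power_eq_if)
    moreover have "0 \<le> c N y ^ 4" by simp
    ultimately show ?thesis
      using main[of N y "c N y", OF order_refl] unfolding mult.assoc by linarith
  qed
  have "(\<Sum>y\<in>UNIV. w y * R N y) \<le> (\<Sum>y\<in>UNIV. w y * (8 * T N (\<lambda>z. \<sigma> z ^ 4) y))"
    by (intro sum_mono mult_left_mono RN w)
  also have "\<dots> = 8 * (\<Sum>y\<in>UNIV. w y * T N (\<lambda>z. \<sigma> z ^ 4) y)"
    by (simp add: sum_distrib_left mult.left_commute)
  finally have upper: "(\<Sum>y\<in>UNIV. w y * R N y) \<le> 8 * (\<Sum>y\<in>UNIV. w y * \<sigma> y ^ 4)"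
    by (simp only: inv)
  have "(\<Sum>y\<in>UNIV. w y * R N y) = (\<Sum>j\<le>N. \<Sum>y\<in>UNIV. w y * T (N - j) (\<lambda>z. c j z ^ 4 * T j (u j) z) y)"
    unfolding R_def sum_distrib_left by (rule sum.swap)
  also have "\<dots> = (\<Sum>j\<le>N. \<Sum>y\<in>UNIV. w y * (T j (\<lambda>z. c j z ^ 4) y * u j y))"
    unfolding inv unfolding T_def by (intro sum.cong refl app_pow_selfadj sym)
  also have "\<dots> \<ge> (\<Sum>j\<le>N. \<Sum>y\<in>UNIV. w y * (\<theta> ^ 4 * u j y))"
  proof (intro sum_mono mult_left_mono w)
    fix j y
    show "\<theta> ^ 4 * u j y \<le> T j (\<lambda>z. c j z ^ 4) y * u j y"
    proof (cases "y \<in> A \<and> K y = j")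
      case False
      then show ?thesis by (auto simp: u_def)
    next
      case True
      have "T j (\<lambda>z. c j z ^ 3) y = T (2 * j) (\<lambda>z. \<sigma> z ^ 3) y"
        unfolding c3 T_def by (simp add: mult_2 funpow_add)
      then have big: "\<theta> ^ 3 < T j (\<lambda>z. c j z ^ 3) y" using K(2)[of y] True by simp
      have "T j (\<lambda>z. 4 * \<theta> * c j z ^ 3) y \<le> T j (\<lambda>z. 3 * c j z ^ 4 + \<theta> ^ 4) y"
        by (rule T_mono) (use c0 \<theta> young_4 in auto)
      then have "4 * \<theta> * T j (\<lambda>z. c j z ^ 3) y \<le> 3 * T j (\<lambda>z. c j z ^ 4) y + \<theta> ^ 4"
        using T_const[of j "\<theta> ^ 4"] unfolding T_def app_pow_add app_pow_cmult by simp
      moreover have "4 * \<theta> * \<theta> ^ 3 \<le> 4 * \<theta> * T j (\<lambda>z. c j z ^ 3) y"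
        using big \<theta> by (intro mult_left_mono) auto
      moreover have "\<theta> * \<theta> ^ 3 = \<theta> ^ 4" by (simp add: power_eq_if)
      ultimately have "\<theta> ^ 4 \<le> T j (\<lambda>z. c j z ^ 4) y" by (simp add: mult.assoc)
      then show ?thesis using True by (simp add: u_def)
    qed
  qed
  also have "(\<Sum>j\<le>N. \<Sum>y\<in>UNIV. w y * (\<theta> ^ 4 * u j y)) = (\<Sum>y\<in>UNIV. \<theta> ^ 4 * w y * (\<Sum>j\<le>N. u j y))"
    by (subst sum.swap) (simp add: sum_distrib_left algebra_simps)
  also have "\<dots> = (\<Sum>y\<in>UNIV. if y \<in> A then \<theta> ^ 4 * w y else 0)"
  proof (intro sum.cong refl)
    fix y
    have "(\<Sum>j\<le>N. u j y) = (if y \<in> A then 1 else 0)"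
      using K(1)[of y] by (auto simp: u_def)
    then show "\<theta> ^ 4 * w y * (\<Sum>j\<le>N. u j y) = (if y \<in> A then \<theta> ^ 4 * w y else 0)" by simp
  qed
  also have "\<dots> = \<theta> ^ 4 * (\<Sum>y\<in>A. w y)" by (simp add: sum.If_cases sum_distrib_left)
  finally show ?thesis using upper by linarith
qed

context rev_chain
begin

lemma mass_nonneg: "0 \<le> mass w A"
  by (simp add: mass_def sum_nonneg w_nonneg)

lemma mass_pos: "A \<noteq> {} \<Longrightarrow> 0 < mass w A"
  unfolding mass_def by (intro sum_pos) (auto simp: w_pos)

lemma mass_mono: "A \<subseteq> B \<Longrightarrow> mass w A \<le> mass w B"
  unfolding mass_def by (intro sum_mono2) (auto simp: w_nonneg)

text \<open>
  With \<open>\<sigma> = sqrt \<bar>F\<bar>\<close> and levels \<open>\<theta> i ^ 3\<close> for \<open>\<sigma> ^ 3\<close>, let \<open>A i\<close> be the set where the maximal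
  function of \<open>\<sigma> ^ 3\<close> exceeds level \<open>i\<close>. The paths that stay in \<open>A (i - 1)\<close> but leave \<open>A i\<close> carry
  mass at most of order \<open>(mass (A (i - 1))) ^ 3\<close>, and \<open>\<sigma> ^ 3\<close> integrates to at most \<open>\<theta> i ^ 3\<close> over them. Young's
  inequality bounds their contribution to \<open>\<bar>F\<bar> = \<sigma>\<^sup>2\<close> by a term of a geometric series.
  The argument runs on a grid so fine that discrete survival is at most \<open>8\<close> times the assumed cube;
  there are only finitely many sets to control.
\<close>

lemma layered_bound:
  assumes t: "0 \<le> t"
    and tail: "\<And>A. mass w A \<le> 1/2 \<Longrightarrow> flow (restr A p) t (ind A) x \<le> mass w A ^ 3"
    and \<eta>: "0 \<le> \<eta>" and F: "(\<Sum>y\<in>UNIV. w $ y * (F y)\<^sup>2) \<le> \<eta>\<^sup>2"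
  shows "\<bar>flow p t F x\<bar> \<le> 26 * \<eta>"
proof (cases "\<eta> = 0")
  case True
  then have "(\<Sum>y\<in>UNIV. w $ y * (F y)\<^sup>2) = 0"
    using F by (simp add: antisym sum_nonneg w_nonneg)
  then have "F y = 0" for y
    using w_pos[of y] by (subst (asm) sum_nonneg_eq_0_iff) (auto simp: w_nonneg dest!: spec[of _ y])
  then have "F = (\<lambda>_. 0)" by auto
  then show ?thesis using flow_const[of t p 0 x] t p_sum True by simp
next
  case False
  define \<zeta> where "\<zeta> = sqrt \<eta>"
  have \<zeta>: "0 < \<zeta>" "\<zeta>\<^sup>2 = \<eta>" using \<eta> False by (simp_all add: \<zeta>_def)
  define \<sigma> where "\<sigma> = (\<lambda>y. sqrt \<bar>F y\<bar>)"
  have \<sigma>0: "0 \<le> \<sigma> y" and \<sigma>2: "(\<sigma> y)\<^sup>2 = \<bar>F y\<bar>" for y by (simp_all add: \<sigma>_def)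
  have \<sigma>4: "\<sigma> y ^ 4 = (F y)\<^sup>2" for y
  proof -
    have "\<sigma> y ^ 4 = ((\<sigma> y)\<^sup>2)\<^sup>2" by (simp flip: power_mult)
    then show ?thesis by (simp add: \<sigma>2)
  qed
  have s4: "(\<Sum>y\<in>UNIV. w $ y * \<sigma> y ^ 4) \<le> \<zeta> ^ 4"
  proof -
    have "\<zeta> ^ 4 = (\<zeta>\<^sup>2)\<^sup>2" by (simp flip: power_mult)
    then show ?thesis using F by (simp add: \<sigma>4 \<zeta>(2))
  qed
  define M where "M = (\<lambda>n A. (app (restr A (flow_kernel p (t / real (Suc n)))) ^^ Suc n) (ind A) x)"
  have "\<forall>\<^sub>F n in sequentially. \<forall>A. A \<noteq> {} \<longrightarrow> mass w A \<le> 1/2 \<longrightarrow> M n A < 8 * mass w A ^ 3"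
  proof (intro eventually_all_finite)
    fix A :: "'a set"
    have lim: "(\<lambda>n. M n A) \<longlonglongrightarrow> flow (restr A p) t (ind A) x"
      unfolding M_def by (rule killed_limit[OF p_substoch t]) (auto simp: ind_def)
    show "\<forall>\<^sub>F n in sequentially. A \<noteq> {} \<longrightarrow> mass w A \<le> 1/2 \<longrightarrow> M n A < 8 * mass w A ^ 3"
    proof (cases "A \<noteq> {} \<and> mass w A \<le> 1/2")
      case True
      then have "0 < mass w A ^ 3" by (simp add: mass_pos)
      then have "flow (restr A p) t (ind A) x < 8 * mass w A ^ 3" using tail[of A] True by linarith
      then show ?thesis using order_tendstoD(2)[OF lim] by (auto elim: eventually_mono)
    qed auto
  qed
  then obtain n where n: "\<And>A. A \<noteq> {} \<Longrightarrow> mass w A \<le> 1/2 \<Longrightarrow> M n A < 8 * mass w A ^ 3"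
    by (auto simp: eventually_sequentially)
  define N where "N = Suc n"
  define d where "d = t / real N"
  have d: "0 \<le> d" "real N * d = t" using t by (simp_all add: d_def N_def)
  define Q where "Q = flow_kernel p d"
  have Q: "substoch Q" "\<And>x y. 0 \<le> Q x y" unfolding Q_def
    using substoch_flow_kernel[OF d(1) p_substoch] by (auto simp: substoch_def)
  have QN: "(app Q ^^ k) f = flow p (real k * d) f" for k f
    unfolding Q_def by (rule app_pow_flow_kernel[OF d(1)])
  define \<theta> where "\<theta> = (\<lambda>i::nat. 2 * 2 ^ i * \<zeta>)"
  have \<theta>0: "0 < \<theta> i" for i using \<zeta> by (simp add: \<theta>_def)
  define A where "A = (\<lambda>i. {y. \<exists>k\<le>N. (app Q ^^ k) (\<lambda>z. \<sigma> z ^ 3) y > \<theta> i ^ 3})"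
  have massA: "mass w (A i) \<le> 1/2 * (1/16) ^ i" for i
  proof -
    \<comment> \<open>half steps, since the maximal inequality controls even powers only\<close>
    define H where "H = flow_kernel p (d / 2)"
    have HN: "(app H ^^ (2 * k)) f = (app Q ^^ k) f" for k f
      using d(1) by (simp add: H_def QN app_pow_flow_kernel)
    have "\<theta> i ^ 4 * (\<Sum>y\<in>A i. w $ y) \<le> 8 * (\<Sum>y\<in>UNIV. w $ y * \<sigma> y ^ 4)"
    proof (rule maximal_inequality[where Q = H and N = N])
      have d2: "0 \<le> d / 2" using d by simp
      show "0 \<le> H y z" for y z using substoch_flow_kernel[OF d2 p_substoch] by (simp add: H_def substoch_def)
      have "app H (\<lambda>_. 1) y = 1" for y
        unfolding H_def app_flow_kernel by (rule flow_const[OF d2 p_sum])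
      then show "(\<Sum>z\<in>UNIV. H y z) = 1" for y by (simp add: app_def)
      show "w $ y * H y z = w $ z * H z y" for y z
        using flow_selfadj[where w = "\<lambda>x. w $ x" and R = p and t = "d / 2" and f = "ind {y}" and g = "ind {z}", OF p_sym]
        by (simp add: H_def ind_def if_distrib if_distribR sum.If_cases cong: if_cong)
      show "\<exists>k\<le>N. \<theta> i ^ 3 < (app H ^^ (2 * k)) (\<lambda>z. \<sigma> z ^ 3) y" if "y \<in> A i" for y
        using that by (simp add: A_def HN)
    qed (use w_nonneg \<sigma>0 \<theta>0[of i] in auto)
    also have "\<dots> \<le> 8 * \<zeta> ^ 4" using s4 by simp
    also have "\<theta> i ^ 4 = 16 * 16 ^ i * \<zeta> ^ 4"
      by (simp add: \<theta>_def power_mult_distrib flip: power_mult) (simp add: mult.commute[of i] power_mult)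
    finally have "\<zeta> ^ 4 * (16 * 16 ^ i * mass w (A i)) \<le> \<zeta> ^ 4 * 8"
      by (simp add: mass_def algebra_simps)
    then have "16 * 16 ^ i * mass w (A i) \<le> 8" using \<zeta> by simp
    then show ?thesis by (simp add: power_divide field_simps)
  qed
  have massA2: "mass w (A i) \<le> 1/2" for i
  proof -
    have "(1/16::real) ^ i \<le> 1" by (simp add: power_le_one)
    then show ?thesis using massA[of i] by linarith
  qed
  define B where "B = (\<lambda>i. case i of 0 \<Rightarrow> UNIV | Suc j \<Rightarrow> A j)"
  have B0: "B 0 = UNIV" and BS: "B (Suc i) = A i" for i by (simp_all add: B_def)
  have "A (Suc i) \<subseteq> A i" for i
  proof -
    have "\<theta> i ^ 3 \<le> \<theta> (Suc i) ^ 3" using \<zeta> by (intro power_mono) (auto simp: \<theta>_def)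
    then show ?thesis by (auto simp: A_def intro: le_less_trans)
  qed
  then have Bsub: "B (Suc i) \<subseteq> B i" for i by (cases i) (simp_all add: B_def)
  define k where "k = (\<lambda>i f. (app (restr (B i) Q) ^^ N) f x)"
  have k_mono: "k (Suc i) f \<le> k i f" if "\<And>y. 0 \<le> f y" for i f
    unfolding k_def by (rule app_pow_mono) (use Bsub[of i] that Q in \<open>auto simp: restr_def\<close>)
  have k_le: "k i f \<le> k 0 f" if "\<And>y. 0 \<le> f y" for i f
    using lift_Suc_antimono_le[of "\<lambda>i. k i f" 0 i] k_mono[OF that] by auto
  have k_one: "k 0 (\<lambda>_. 1) \<le> 1"
    using app_pow_abs_le[OF Q(1), of "\<lambda>_. 1" 1 N x] by (simp add: k_def B0 abs_le_iff)
  have k_oneS: "k (Suc i) (\<lambda>_. 1) \<le> ((1/16) ^ i) ^ 3" for i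
  proof (cases "x \<in> A i")
    case False
    then have "k (Suc i) (\<lambda>_. 1) = 0" by (simp add: k_def BS N_def app_def restr_def)
    then show ?thesis by simp
  next
    case True
    have "k (Suc i) (\<lambda>_. 1) = (app (restr (A i) Q) ^^ N) (ind (A i)) x"
      unfolding k_def BS by (subst app_pow_restr_cut[OF True]) simp
    also have "\<dots> = M n (A i)" by (simp only: M_def Q_def d_def N_def)
    also have "\<dots> \<le> 8 * mass w (A i) ^ 3" using n[of "A i"] True massA2[of i] by fastforce
    also have "\<dots> \<le> 8 * (1/2 * (1/16) ^ i) ^ 3"
      using massA[of i] mass_nonneg by (intro mult_left_mono power_mono) auto
    finally show ?thesis by (simp add: power_mult_distrib power3_eq_cube)
  qed
  have stop: "k 0 (\<lambda>z. \<sigma> z ^ 3) \<le> k (Suc i) (\<lambda>z. \<sigma> z ^ 3) + \<theta> i ^ 3" for i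
    unfolding k_def B0 BS restr_UNIV
  proof (rule stopping_bound[OF Q(1)])
    show "(app Q ^^ m) (\<lambda>z. \<sigma> z ^ 3) y \<le> \<theta> i ^ 3" if "m \<le> N" "y \<notin> A i" for m y
      using that by (force simp: A_def not_less)
  qed (use \<sigma>0 \<theta>0[of i] in auto)
  \<comment> \<open>\<open>k i - k (Suc i)\<close> is a positive functional; apply it to \<open>3 \<beta> \<sigma>\<^sup>2 \<le> 2 \<sigma> ^ 3 + \<beta> ^ 3\<close>\<close>
  have D: "3 * \<beta> * (k i (\<lambda>z. (\<sigma> z)\<^sup>2) - k (Suc i) (\<lambda>z. (\<sigma> z)\<^sup>2)) \<le> 2 * \<theta> i ^ 3 + \<beta> ^ 3 * k i (\<lambda>_. 1)"
    if \<beta>: "0 \<le> \<beta>" for i \<beta>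
  proof -
    have y3: "0 \<le> 2 * s ^ 3 + \<beta> ^ 3 + (- (3 * \<beta>)) * s\<^sup>2" if "0 \<le> s" for s
    proof -
      have "0 \<le> (s - \<beta>)\<^sup>2 * (2 * s + \<beta>)" using that \<beta> by (intro mult_nonneg_nonneg) auto
      also have "\<dots> = 2 * s ^ 3 + \<beta> ^ 3 + (- (3 * \<beta>)) * s\<^sup>2"
        by (simp add: power2_eq_square power3_eq_cube algebra_simps)
      finally show ?thesis .
    qed
    have lin: "k j (\<lambda>z. 2 * \<sigma> z ^ 3 + \<beta> ^ 3 * 1 + (- (3 * \<beta>)) * (\<sigma> z)\<^sup>2)
        = 2 * k j (\<lambda>z. \<sigma> z ^ 3) + \<beta> ^ 3 * k j (\<lambda>_. 1) + (- (3 * \<beta>)) * k j (\<lambda>z. (\<sigma> z)\<^sup>2)" for j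
      unfolding k_def app_pow_add app_pow_cmult ..
    have "k (Suc i) (\<lambda>z. 2 * \<sigma> z ^ 3 + \<beta> ^ 3 * 1 + (- (3 * \<beta>)) * (\<sigma> z)\<^sup>2)
        \<le> k i (\<lambda>z. 2 * \<sigma> z ^ 3 + \<beta> ^ 3 * 1 + (- (3 * \<beta>)) * (\<sigma> z)\<^sup>2)"
      by (rule k_mono) (use y3[OF \<sigma>0] in simp)
    moreover have "0 \<le> \<beta> ^ 3 * k (Suc i) (\<lambda>_. 1)"
      using \<beta> unfolding k_def by (intro mult_nonneg_nonneg app_pow_nonneg) (auto simp: restr_def Q)
    moreover have "k i (\<lambda>z. \<sigma> z ^ 3) \<le> k (Suc i) (\<lambda>z. \<sigma> z ^ 3) + \<theta> i ^ 3"
      using stop[of i] k_le[of "\<lambda>z. \<sigma> z ^ 3" i] \<sigma>0 by simp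
    ultimately show ?thesis unfolding lin by (simp add: algebra_simps)
  qed
  have D': "k i (\<lambda>z. (\<sigma> z)\<^sup>2) - k (Suc i) (\<lambda>z. (\<sigma> z)\<^sup>2) \<le> (\<theta> i)\<^sup>2 * \<omega>"
    if \<omega>: "0 < \<omega>" and m: "k i (\<lambda>_. 1) \<le> \<omega> ^ 3" for i \<omega>
  proof -
    define \<beta> where "\<beta> = \<theta> i / \<omega>"
    have \<beta>: "0 < \<beta>" "\<beta> * \<omega> = \<theta> i" using \<omega> \<theta>0[of i] by (simp_all add: \<beta>_def)
    have "\<beta> ^ 3 * k i (\<lambda>_. 1) \<le> \<beta> ^ 3 * \<omega> ^ 3" using m \<beta> by (intro mult_left_mono) auto
    also have "\<dots> = \<theta> i ^ 3" by (simp add: power_mult_distrib[symmetric] \<beta>)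
    finally have "3 * \<beta> * (k i (\<lambda>z. (\<sigma> z)\<^sup>2) - k (Suc i) (\<lambda>z. (\<sigma> z)\<^sup>2)) \<le> 3 * \<theta> i ^ 3"
      using D[of \<beta> i] \<beta> by simp
    also have "\<dots> = 3 * \<beta> * ((\<theta> i)\<^sup>2 * \<omega>)"
      using \<beta>(2) by (simp add: power3_eq_cube power2_eq_square algebra_simps)
    finally show ?thesis using \<beta>(1) by (simp add: mult_le_cancel_left)
  qed
  have telescope: "k 0 (\<lambda>z. (\<sigma> z)\<^sup>2) \<le> k (Suc i) (\<lambda>z. (\<sigma> z)\<^sup>2) + \<zeta>\<^sup>2 * (26 - 64/3 * (1/4) ^ i)" for i
  proof (induction i)
    case 0
    have "k 0 (\<lambda>z. (\<sigma> z)\<^sup>2) - k (Suc 0) (\<lambda>z. (\<sigma> z)\<^sup>2) \<le> (\<theta> 0)\<^sup>2 * 1"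
      by (rule D') (use k_one in auto)
    moreover have "(\<theta> 0)\<^sup>2 * 1 \<le> \<zeta>\<^sup>2 * (26 - 64/3 * (1/4) ^ 0)"
      by (simp add: \<theta>_def power_mult_distrib)
    ultimately show ?case by linarith
  next
    case (Suc i)
    have "k (Suc i) (\<lambda>z. (\<sigma> z)\<^sup>2) - k (Suc (Suc i)) (\<lambda>z. (\<sigma> z)\<^sup>2) \<le> (\<theta> (Suc i))\<^sup>2 * (1/16) ^ i"
      by (rule D') (use k_oneS in auto)
    also have "(\<theta> (Suc i))\<^sup>2 * (1/16) ^ i = \<zeta>\<^sup>2 * (16 * (1/4) ^ i)"
    proof -
      have "((2::real) ^ i)\<^sup>2 * (1/16) ^ i = (1/4) ^ i"
        by (simp add: power2_eq_square power_mult_distrib[symmetric])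
      then show ?thesis by (simp add: \<theta>_def power_mult_distrib algebra_simps)
    qed
    finally show ?case using Suc by (simp add: algebra_simps)
  qed
  obtain i where i: "(1/16::real) ^ i < Min (range (\<lambda>y. w $ y))"
    using real_arch_pow_inv[of "Min (range (\<lambda>y. w $ y))" "1/16"] w_pos by auto
  \<comment> \<open>the masses decrease geometrically, so a deep level set is smaller than any single state\<close>
  have "A i = {}"
  proof (rule ccontr)
    assume "A i \<noteq> {}"
    then obtain y where y: "y \<in> A i" by blast
    have "w $ y \<le> mass w (A i)" using mass_mono[of "{y}" "A i"] y by (simp add: mass_def)
    also have "\<dots> \<le> (1/16) ^ i" using massA[of i] mass_nonneg[of "A i"] by simp
    also have "\<dots> < Min (range (\<lambda>y. w $ y))" by (rule i)
    also have "\<dots> \<le> w $ y" by simp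
    finally show False by simp
  qed
  then have "k (Suc i) (\<lambda>z. (\<sigma> z)\<^sup>2) = 0" by (simp add: k_def BS N_def app_def restr_def)
  moreover have "\<zeta>\<^sup>2 * (26 - 64/3 * (1/4) ^ i) \<le> \<zeta>\<^sup>2 * 26" by (intro mult_left_mono) auto
  ultimately have "k 0 (\<lambda>z. (\<sigma> z)\<^sup>2) \<le> 26 * \<eta>" using telescope[of i] \<zeta>(2) by linarith
  then have "flow p t (\<lambda>z. \<bar>F z\<bar>) x \<le> 26 * \<eta>" by (simp add: k_def B0 \<sigma>2 QN d(2))
  moreover have "flow p t (\<lambda>z. \<bar>F z\<bar> - F z) x \<ge> 0" "flow p t (\<lambda>z. \<bar>F z\<bar> + F z) x \<ge> 0"
    by (rule flow_nonneg[OF t p_nonneg]; simp)+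
  ultimately show ?thesis unfolding flow_diff flow_add by linarith
qed

end

section \<open>Survival in a set and mixing in \<open>L\<^sup>2\<close>\<close>

lemma real_Least:
  fixes S :: "real \<Rightarrow> bool"
  assumes "closed {t. S t}" "S t0" "\<And>t. S t \<Longrightarrow> 0 \<le> t"
  shows "S (LEAST t. S t)" "\<And>t. S t \<Longrightarrow> (LEAST t. S t) \<le> t"
proof -
  have bdd: "bdd_below {t. S t}" using assms(3) by (auto intro!: bdd_belowI)
  have "Inf {t. S t} \<in> {t. S t}"
    using assms(2) by (intro closed_contains_Inf assms(1) bdd) auto
  moreover have "Inf {t. S t} \<le> t" if "S t" for t using that bdd by (intro cInf_lower) auto
  ultimately have "(LEAST t. S t) = Inf {t. S t}" "S (Inf {t. S t})" "\<And>t. S t \<Longrightarrow> Inf {t. S t} \<le> t"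
    by (auto intro!: Least_equality)
  then show "S (LEAST t. S t)" "\<And>t. S t \<Longrightarrow> (LEAST t. S t) \<le> t" by auto
qed

lemma weighted_cauchy_schwarz:
  fixes w a b :: "'a \<Rightarrow> real"
  assumes "\<And>x. 0 \<le> w x"
  shows "(\<Sum>x\<in>I. w x * (a x * b x)) \<le> sqrt (\<Sum>x\<in>I. w x * (a x)\<^sup>2) * sqrt (\<Sum>x\<in>I. w x * (b x)\<^sup>2)"
proof -
  have "(\<Sum>x\<in>I. (sqrt (w x) * a x) * (sqrt (w x) * b x))\<^sup>2
      \<le> (\<Sum>x\<in>I. (sqrt (w x) * a x)\<^sup>2) * (\<Sum>x\<in>I. (sqrt (w x) * b x)\<^sup>2)"
    by (rule Cauchy_Schwarz_ineq_sum)
  moreover have "(sqrt (w x) * a x) * (sqrt (w x) * b x) = w x * (a x * b x)" for x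
    using assms[of x] real_sqrt_mult_self[of "w x"] by (simp add: algebra_simps)
  ultimately have "(\<Sum>x\<in>I. w x * (a x * b x))\<^sup>2 \<le> (\<Sum>x\<in>I. w x * (a x)\<^sup>2) * (\<Sum>x\<in>I. w x * (b x)\<^sup>2)"
    using assms by (simp add: power_mult_distrib)
  then show ?thesis
    unfolding real_sqrt_mult[symmetric] by (rule real_le_rsqrt)
qed

text \<open>
  The growth inequality for \<open>R\<close> iterates to its powers, hence to the Poisson mixture.
\<close>

lemma flow_supersolution:
  assumes t: "0 \<le> t" and R: "\<And>x y. 0 \<le> R x y" and c: "0 \<le> c" and g: "\<And>y. 0 \<le> g y"
    and sup: "\<And>y. c * g y \<le> app R g y"
  shows "exp (- ((1 - c) * t)) * g x \<le> flow R t g x"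
proof -
  have pow: "c ^ k * g y \<le> (app R ^^ k) g y" for k y
  proof (induction k arbitrary: y)
    case (Suc k)
    have "c ^ Suc k * g y \<le> c ^ k * app R g y"
      using mult_left_mono[OF sup[of y], of "c ^ k"] c by (simp add: ac_simps)
    also have "\<dots> = app R (\<lambda>y. c ^ k * g y) y" by (simp add: app_cmult)
    also have "\<dots> \<le> app R ((app R ^^ k) g) y"
      by (rule app_mono) (use R c g Suc in auto)
    finally show ?case by simp
  qed simp
  have "(\<lambda>k. (t * c) ^ k / fact k * g x) sums (exp (t * c) * g x)" by (rule exp_sums_mult)
  then have "exp (t * c) * g x \<le> expop R t g x"
  proof (rule sums_le[OF _ _ expop_sums, rotated])
    show "(t * c) ^ k / fact k * g x \<le> t ^ k / fact k * (app R ^^ k) g x" for k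
      using mult_left_mono[OF pow[of k x], of "t ^ k / fact k"] t
      by (simp add: power_mult_distrib algebra_simps)
  qed
  then have "exp (- t) * (exp (t * c) * g x) \<le> exp (- t) * expop R t g x" by (intro mult_left_mono) auto
  moreover have "exp (- t) * (exp (t * c) * g x) = exp (- ((1 - c) * t)) * g x"
  proof -
    have "- t + t * c = - ((1 - c) * t)" by (simp add: algebra_simps)
    then show ?thesis unfolding mult.assoc[symmetric] exp_add[symmetric] by simp
  qed
  ultimately show ?thesis by (simp add: flow_def)
qed

context rev_chain
begin

definition component :: "'a set \<Rightarrow> 'a \<Rightarrow> 'a set" where
  "component A x = {y. (x, y) \<in> {(u, v). u \<in> A \<and> v \<in> A \<and> 0 < p u v}\<^sup>*}"

lemma component_self: "x \<in> component A x"
  by (simp add: component_def)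

lemma component_subset: "x \<in> A \<Longrightarrow> component A x \<subseteq> A"
  by (auto simp: component_def elim: rtranclE)

lemma component_step: "y \<in> component A x \<Longrightarrow> x \<in> A \<Longrightarrow> z \<in> A \<Longrightarrow> z \<notin> component A x \<Longrightarrow> p y z = 0"
proof (rule ccontr)
  assume a: "y \<in> component A x" "x \<in> A" "z \<in> A" "z \<notin> component A x" "p y z \<noteq> 0"
  then have "0 < p y z" using p_nonneg[of y z] by simp
  moreover have "y \<in> A" using a component_subset by blast
  ultimately have "z \<in> component A x" using a(1,3) unfolding component_def
    by (auto intro: rtrancl_into_rtrancl)
  then show False using a by simp
qed

text \<open>
  The powers of the two restricted kernels agree on the component, as no transition leads from it to the
  rest of \<open>A\<close>.
\<close>

lemma component_tail:
  assumes x: "x \<in> A"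
  shows "flow (restr A p) t (ind A) x = flow (restr (component A x) p) t (ind (component A x)) x"
proof -
  let ?C = "component A x"
  have "(app (restr A p) ^^ k) (ind A) z = (app (restr ?C p) ^^ k) (ind ?C) z" if "z \<in> ?C" for k z
    using that
  proof (induction k arbitrary: z)
    case 0
    then show ?case using component_subset[OF x] by (auto simp: ind_def)
  next
    case (Suc k)
    have "(\<Sum>y\<in>UNIV. restr A p z y * (app (restr A p) ^^ k) (ind A) y)
        = (\<Sum>y\<in>UNIV. restr ?C p z y * (app (restr ?C p) ^^ k) (ind ?C) y)"
    proof (intro sum.cong refl)
      fix y
      show "restr A p z y * (app (restr A p) ^^ k) (ind A) y = restr ?C p z y * (app (restr ?C p) ^^ k) (ind ?C) y"
      proof (cases "y \<in> ?C")
        case True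
        then have "restr A p z y = restr ?C p z y"
          using Suc.prems component_subset[OF x] by (auto simp: restr_def)
        then show ?thesis by (simp only: Suc.IH[OF True])
      next
        case False
        then have "restr A p z y = 0" "restr ?C p z y = 0"
          using component_step[OF Suc.prems x] by (auto simp: restr_def)
        then show ?thesis by simp
      qed
    qed
    then show ?case by (simp only: app_pow_Suc)
  qed
  from this[OF component_self] show ?thesis by (simp add: flow_def expop_def)
qed

text \<open>
  Reversibility makes possible transitions symmetric, so any two points of a component are joined by a
  path inside it.
\<close>

lemma component_positive:
  assumes x: "x \<in> A" and a: "a \<in> component A x" and b: "b \<in> component A x" and t: "0 < t"
  shows "0 < flow (restr (component A x) p) t (ind {b}) a"
proof -
  let ?C = "component A x" and ?E = "\<lambda>A. {(u, v). u \<in> A \<and> v \<in> A \<and> 0 < p u v}"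
  have psym: "0 < p u v \<Longrightarrow> 0 < p v u" for u v
    using p_sym[of u v] w_pos[of u] w_pos[of v] p_nonneg[of v u] by (auto simp: less_le)
  have toC: "(x, y) \<in> (?E ?C)\<^sup>*" if "(x, y) \<in> (?E A)\<^sup>*" for y
    using that
  proof (induction rule: rtrancl_induct)
    case (step y z)
    then have "y \<in> ?C" "z \<in> ?C" unfolding component_def by (auto intro: rtrancl_into_rtrancl)
    then show ?case using step by (auto intro: rtrancl_into_rtrancl)
  qed simp
  have "sym (?E ?C)" using psym by (auto simp: sym_def)
  moreover have "(x, a) \<in> (?E ?C)\<^sup>*" using a by (intro toC) (simp add: component_def)
  ultimately have "(a, x) \<in> (?E ?C)\<^sup>*" by (rule symD[OF sym_rtrancl])
  moreover have "(x, b) \<in> (?E ?C)\<^sup>*" using b by (intro toC) (simp add: component_def)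
  ultimately have "(a, b) \<in> (?E ?C)\<^sup>*" by (rule rtrancl_trans)
  then have "\<exists>k. 0 < (app (restr ?C p) ^^ k) (ind {b}) a"
  proof (induction rule: converse_rtrancl_induct)
    case base
    show ?case by (rule exI[of _ 0]) (simp add: ind_def)
  next
    case (step u v)
    then obtain k where k: "0 < (app (restr ?C p) ^^ k) (ind {b}) v" by blast
    have "0 < restr ?C p u v * (app (restr ?C p) ^^ k) (ind {b}) v"
      using step(1) k by (auto simp: restr_def)
    also have "\<dots> \<le> (\<Sum>y\<in>UNIV. restr ?C p u y * (app (restr ?C p) ^^ k) (ind {b}) y)"
      by (rule member_le_sum[of v UNIV "\<lambda>y. restr ?C p u y * (app (restr ?C p) ^^ k) (ind {b}) y"])
         (auto intro!: mult_nonneg_nonneg rp_nonneg app_pow_nonneg simp: ind_def)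
    also have "\<dots> = (app (restr ?C p) ^^ Suc k) (ind {b}) u" by (simp only: app_pow_Suc)
    finally show ?case by blast
  qed
  then obtain k where k: "0 < (app (restr ?C p) ^^ k) (ind {b}) a" by blast
  have "0 < expop (restr ?C p) t (ind {b}) a"
    unfolding expop_def
  proof (rule suminf_pos2[OF summable_expop])
    show "0 \<le> t ^ n / fact n * (app (restr ?C p) ^^ n) (ind {b}) a" for n
      using t by (intro mult_nonneg_nonneg app_pow_nonneg rp_nonneg) (auto simp: ind_def)
    show "0 < t ^ k / fact k * (app (restr ?C p) ^^ k) (ind {b}) a" using t k by simp
  qed
  then show ?thesis by (simp add: flow_def)
qed

lemma mass_UNIV: "mass w UNIV = 1" by (simp add: mass_def w_sum)

lemma mass_Compl: "mass w (- A) = 1 - mass w A"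
proof -
  have "mass w UNIV = mass w A + mass w (- A)"
    unfolding mass_def by (subst sum.union_disjoint[symmetric]) auto
  then show ?thesis by (simp add: mass_UNIV)
qed

definition survival :: "'a set \<Rightarrow> real \<Rightarrow> 'a \<Rightarrow> real" where
  "survival A t = flow (restr A p) t (ind A)"

lemma survival_nonneg: "0 \<le> t \<Longrightarrow> 0 \<le> survival A t x"
  unfolding survival_def by (rule flow_nonneg) (auto simp: rp_nonneg ind_def)

lemma survival_le_ind: "0 \<le> t \<Longrightarrow> survival A t x \<le> ind A x"
proof (cases "x \<in> A")
  case True
  assume "0 \<le> t"
  then have "\<bar>survival A t x\<bar> \<le> 1"
    unfolding survival_def by (rule flow_abs_le) (auto simp: substoch_restr p_substoch ind_def)
  then show ?thesis using True by (simp add: ind_def)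
next
  case False
  then show ?thesis unfolding survival_def by (subst flow_supported) (auto simp: ind_def)
qed

lemma survival_add: "0 \<le> s \<Longrightarrow> 0 \<le> t \<Longrightarrow> survival A (s + t) = flow (restr A p) s (survival A t)"
  unfolding survival_def by (rule flow_semigroup)

lemma survival_antimono: "0 \<le> s \<Longrightarrow> s \<le> t \<Longrightarrow> survival A t x \<le> survival A s x"
proof -
  assume s: "0 \<le> s" "s \<le> t"
  have "survival A t x = flow (restr A p) s (survival A (t - s)) x" using survival_add[of s "t - s" A] s by simp
  also have "\<dots> \<le> flow (restr A p) s (ind A) x"
    by (rule flow_mono) (use s in \<open>auto simp: rp_nonneg survival_nonneg survival_le_ind\<close>)
  finally show ?thesis by (simp add: survival_def)
qed

text \<open>
  At each multiple of \<open>\<rho>\<close> the chain faces a fresh trial, which it survives with probability at most \<open>c\<close>.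
\<close>

lemma survival_power:
  assumes \<rho>: "0 \<le> \<rho>" and c: "0 \<le> c" and le: "\<And>x. survival A \<rho> x \<le> c"
  shows "survival A (real k * \<rho>) x \<le> c ^ k * ind A x"
proof (induction k arbitrary: x)
  case 0 show ?case using survival_le_ind[of 0 A x] by simp
next
  case (Suc k)
  have "survival A (real (Suc k) * \<rho>) x = flow (restr A p) \<rho> (survival A (real k * \<rho>)) x"
    using survival_add[of \<rho> "real k * \<rho>" A] \<rho> by (simp add: algebra_simps)
  also have "\<dots> \<le> flow (restr A p) \<rho> (\<lambda>x. c ^ k * ind A x) x"
    by (rule flow_mono) (use \<rho> Suc in \<open>auto simp: rp_nonneg survival_nonneg\<close>)
  also have "\<dots> = c ^ k * survival A \<rho> x" by (simp add: flow_cmult survival_def)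
  also have "\<dots> \<le> c ^ k * (c * ind A x)"
  proof (intro mult_left_mono)
    show "survival A \<rho> x \<le> c * ind A x"
      using le[of x] survival_le_ind[OF \<rho>, of A x] by (simp add: ind_def split: if_splits)
  qed (use c in simp)
  finally show ?case by (simp add: ac_simps)
qed

lemma sum_ind: "(\<Sum>x\<in>UNIV. f x * ind A x) = sum f A" for f :: "'a \<Rightarrow> real"
  by (simp add: ind_def if_distrib sum.If_cases cong: if_cong)

lemma ind_square: "(ind A x)\<^sup>2 = ind A x"
  by (simp add: ind_def)

lemma survival_decay:
  assumes A: "A \<noteq> {}" and t: "0 \<le> t"
  shows "(\<Sum>x\<in>UNIV. w $ x * (survival A t x)\<^sup>2) \<le> exp (- 2 * lambda_on P A * t) * mass w A"
proof -
  have "(\<Sum>x\<in>UNIV. w $ x * (survival A t x)\<^sup>2) \<le> exp (- 2 * lambda_on P A * t) * (\<Sum>x\<in>UNIV. w $ x * (ind A x)\<^sup>2)"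
    unfolding survival_def
    by (rule flow_decay[OF _ t], rule lambda_on_props(1)[OF A], rule flow_supported) (auto simp: ind_def)
  also have "(\<Sum>x\<in>UNIV. w $ x * (ind A x)\<^sup>2) = mass w A"
    by (simp only: ind_square sum_ind mass_def)
  finally show ?thesis .
qed

lemma flow_mean: "(\<Sum>x\<in>UNIV. w $ x * flow p t f x) = (\<Sum>x\<in>UNIV. w $ x * f x)" if "0 \<le> t"
  using flow_selfadj[where w = "\<lambda>x. w $ x" and R = p and t = t and f = "\<lambda>_. 1" and g = f, OF p_sym]
    flow_const[of t p 1] that p_sum by simp

text \<open>
  The centred density \<open>H\<^sub>t(x, \<cdot>) / \<pi> - 1\<close>. By reversibility it is a solution of the heat equation, which
  makes its mean, decay and continuity in \<open>t\<close> immediate.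
\<close>

definition rel_density :: "'a \<Rightarrow> real \<Rightarrow> 'a \<Rightarrow> real" where
  "rel_density x t = flow p t (\<lambda>y. ind {x} y / w $ x - 1)"

lemma rel_density_mean: "0 \<le> t \<Longrightarrow> (\<Sum>y\<in>UNIV. w $ y * rel_density x t y) = 0"
proof -
  assume t: "0 \<le> t"
  have "w $ y * (ind {x} y / w $ x - 1) = (if y = x then 1 else 0) - w $ y" for y
    using w_pos[of x] by (auto simp: ind_def right_diff_distrib)
  then show ?thesis unfolding rel_density_def flow_mean[OF t] by (simp add: sum_subtractf w_sum)
qed

lemma flow_kernel_eq_rel_density:
  assumes t: "0 \<le> t" shows "flow_kernel p t x y = w $ y * (rel_density x t y + 1)"
proof -
  have "w $ x * flow_kernel p t x y = w $ y * flow_kernel p t y x"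
    using flow_selfadj[where w = "\<lambda>x. w $ x" and R = p and t = t and f = "ind {x}" and g = "ind {y}", OF p_sym]
    by (simp add: ind_def if_distrib if_distribR sum.If_cases cong: if_cong)
  moreover have "rel_density x t y = flow_kernel p t y x / w $ x - 1"
  proof -
    have "rel_density x t y = flow p t (\<lambda>y. (1 / w $ x) * ind {x} y - 1) y" by (simp add: rel_density_def)
    then show ?thesis unfolding flow_diff flow_cmult flow_const[OF t p_sum] by simp
  qed
  moreover have "w $ x \<noteq> 0" using w_pos[of x] by simp
  ultimately have "w $ x * flow_kernel p t x y = w $ x * (w $ y * (rel_density x t y + 1))" by simp
  then show ?thesis using \<open>w $ x \<noteq> 0\<close> by simp
qed

lemma flow_eq_rel_density:
  assumes t: "0 \<le> t" shows "flow p t g x = (\<Sum>y\<in>UNIV. w $ y * g y) + (\<Sum>y\<in>UNIV. w $ y * (rel_density x t y * g y))"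
proof -
  have "flow p t g x = (\<Sum>y\<in>UNIV. flow_kernel p t x y * g y)" by (simp add: app_flow_kernel[of p t g, symmetric] app_def)
  then show ?thesis by (simp add: flow_kernel_eq_rel_density[OF t] algebra_simps sum.distrib)
qed

definition l2_dist :: "'a \<Rightarrow> real \<Rightarrow> real" where
  "l2_dist x t = sqrt (\<Sum>y\<in>UNIV. w $ y * (rel_density x t y)\<^sup>2)"

lemma norm_2_heat_kernel:
  assumes t: "0 \<le> t" shows "norm_2 w (heat_kernel P t $ x - w) = l2_dist x t"
proof -
  have "(heat_kernel P t $ x - w) $ y / w $ y = rel_density x t y" for y
    using w_pos[of y] by (simp add: heat_kernel_eq_flow[OF t] flow_kernel_eq_rel_density[OF t] field_simps)
  then show ?thesis by (simp add: norm_2_def l2_dist_def)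
qed

lemma gap_decay:
  assumes gap: "is_gap l"
    and f: "(\<Sum>x\<in>UNIV. w $ x * f x) = 0" and t: "0 \<le> t"
  shows "(\<Sum>x\<in>UNIV. w $ x * (flow p t f x)\<^sup>2) \<le> exp (- 2 * l * t) * (\<Sum>x\<in>UNIV. w $ x * (f x)\<^sup>2)"
proof (rule flow_decay[OF _ t])
  fix s :: real assume "0 \<le> s"
  then have "(\<Sum>x\<in>UNIV. w $ x * flow p s f x) = 0" by (simp add: flow_mean f)
  then show "l * (\<Sum>x\<in>UNIV. w $ x * (flow p s f x)\<^sup>2)
      \<le> (\<Sum>x\<in>UNIV. w $ x * (flow p s f x * (flow p s f x - app p (flow p s f) x)))"
    using gap by (simp add: is_gap_def)
qed

text \<open>
  Being alive at \<open>t\<close> implies being in \<open>A\<close> at \<open>t\<close>. The indicator of \<open>A\<close> may be centred because the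
  centred density has mean \<open>0\<close>, and its variance is \<open>u (1 - u)\<close>.
\<close>

lemma survival_le_of_l2_dist:
  assumes t: "0 \<le> t" and n: "l2_dist x t \<le> 1/2"
  shows "survival A t x \<le> mass w A + 1/2 * sqrt (mass w A * (1 - mass w A))"
proof -
  let ?u = "mass w A"
  have m: "(\<Sum>y\<in>UNIV. w $ y * ind A y) = ?u"
    by (simp only: sum_ind mass_def)
  have "survival A t x \<le> flow p t (ind A) x"
    unfolding survival_def by (rule flow_mono[OF t]) (auto simp: restr_def p_nonneg ind_def)
  also have "\<dots> = ?u + (\<Sum>y\<in>UNIV. w $ y * (rel_density x t y * ind A y))"
    by (simp add: flow_eq_rel_density[OF t] m)
  also have "(\<Sum>y\<in>UNIV. w $ y * (rel_density x t y * ind A y)) = (\<Sum>y\<in>UNIV. w $ y * (rel_density x t y * (ind A y - ?u)))"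
  proof -
    have "(\<Sum>y\<in>UNIV. w $ y * (rel_density x t y * (ind A y - ?u)))
        = (\<Sum>y\<in>UNIV. w $ y * (rel_density x t y * ind A y)) - ?u * (\<Sum>y\<in>UNIV. w $ y * rel_density x t y)"
      by (simp add: sum_distrib_left sum_subtractf algebra_simps)
    then show ?thesis by (simp add: rel_density_mean[OF t])
  qed
  also have "\<dots> \<le> l2_dist x t * sqrt (\<Sum>y\<in>UNIV. w $ y * (ind A y - ?u)\<^sup>2)"
    unfolding l2_dist_def by (rule weighted_cauchy_schwarz) (rule w_nonneg)
  also have "(\<Sum>y\<in>UNIV. w $ y * (ind A y - ?u)\<^sup>2) = ?u * (1 - ?u)"
  proof -
    have "w $ y * (ind A y - ?u)\<^sup>2 = w $ y * ind A y + (?u\<^sup>2 * w $ y - 2 * ?u * (w $ y * ind A y))" for y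
      by (simp add: ind_def power2_eq_square algebra_simps)
    then have "(\<Sum>y\<in>UNIV. w $ y * (ind A y - ?u)\<^sup>2) = ?u + (?u\<^sup>2 * 1 - 2 * ?u * ?u)"
      by (simp add: sum.distrib sum_subtractf sum_distrib_left[symmetric] m w_sum)
    then show ?thesis by (simp add: power2_eq_square algebra_simps)
  qed
  also have "l2_dist x t * sqrt (?u * (1 - ?u)) \<le> 1/2 * sqrt (?u * (1 - ?u))"
    using n mass_nonneg[of A] mass_mono[of A UNIV] by (intro mult_right_mono) (auto simp: mass_UNIV)
  finally show ?thesis by simp
qed

text \<open>
  With \<open>f\<close> the centred density at time \<open>t + 5 / l\<close> and \<open>Z\<close> its norm, \<open>H\<^sub>t (H\<^sub>s f) x = Z\<^sup>2\<close> for
  \<open>s = 5 / l\<close>, while the layered bound makes the left side at most \<open>26 exp (- 5) Z\<close>.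
\<close>

lemma l2_dist_le_half:
  assumes gap: "is_gap l" and t: "0 \<le> t"
    and tail: "\<And>A. mass w A \<le> 1/2 \<Longrightarrow> survival A t x \<le> mass w A ^ 3"
  shows "l2_dist x (t + 5 / l) \<le> 1/2"
proof -
  let ?f = "rel_density x (t + 5 / l)"
  have l: "0 < l" using gap by (simp add: is_gap_def)
  define Z where "Z = l2_dist x (t + 5 / l)"
  have s: "0 \<le> 5 / l" "0 \<le> t + 5 / l" using l t by auto
  have Z0: "0 \<le> Z" by (simp add: Z_def l2_dist_def sum_nonneg w_nonneg)
  have Z2: "(\<Sum>y\<in>UNIV. w $ y * (?f y)\<^sup>2) = Z\<^sup>2"
    by (simp add: Z_def l2_dist_def sum_nonneg w_nonneg)
  have "flow p (t + 5 / l) ?f x = Z\<^sup>2"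
    unfolding flow_eq_rel_density[OF s(2)] rel_density_mean[OF s(2)] using Z2 by (simp add: power2_eq_square)
  then have e: "flow p t (flow p (5 / l) ?f) x = Z\<^sup>2" by (simp only: flow_semigroup[OF t s(1)])
  have "\<bar>flow p t (flow p (5 / l) ?f) x\<bar> \<le> 26 * (exp (- 5) * Z)"
  proof (rule layered_bound[OF t])
    show "flow (restr A p) t (ind A) x \<le> mass w A ^ 3" if "mass w A \<le> 1/2" for A
      using tail[OF that] by (simp add: survival_def)
    have "(\<Sum>y\<in>UNIV. w $ y * (flow p (5 / l) ?f y)\<^sup>2) \<le> exp (- 2 * l * (5 / l)) * Z\<^sup>2"
      unfolding Z2[symmetric] by (rule gap_decay[OF gap rel_density_mean[OF s(2)] s(1)])
    also have "exp (- 2 * l * (5 / l)) = (exp (- 5))\<^sup>2"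
      using l by (simp add: power2_eq_square exp_add[symmetric])
    finally show "(\<Sum>y\<in>UNIV. w $ y * (flow p (5 / l) ?f y)\<^sup>2) \<le> (exp (- 5) * Z)\<^sup>2"
      by (simp only: power_mult_distrib)
  qed (use Z0 in auto)
  then have "Z * Z \<le> (26 * exp (- 5)) * Z" unfolding e by (simp add: power2_eq_square)
  then have "Z = 0 \<or> Z \<le> 26 * exp (- 5)" using Z0 by (auto simp: mult_le_cancel_right)
  moreover have "26 * exp (- 5) \<le> (1/2 :: real)"
  proof -
    have "(3/2::real) ^ 10 \<le> exp (1/2) ^ 10"
      using exp_ge_add_one_self[of "1/2::real"] by (intro power_mono) auto
    also have "exp (1/2) ^ 10 = exp (5::real)" 
      using exp_of_nat_mult[of 10 "1/2::real"] by simp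
    finally have "52 \<le> exp (5::real)" by (simp add: power_divide)
    then show ?thesis by (simp add: exp_minus field_simps)
  qed
  ultimately show ?thesis by (auto simp: Z_def)
qed

lemma sqrt_half: "0 \<le> u \<Longrightarrow> u \<le> 1 \<Longrightarrow> sqrt (u * (1 - u)) \<le> 1/2" for u :: real
proof (rule real_le_lsqrt)
  have "0 \<le> (u - 1/2)\<^sup>2" by simp
  then show "u * (1 - u) \<le> (1/2)\<^sup>2" by (simp add: power2_eq_square algebra_simps)
qed auto

text \<open>
  The square of the base is at most \<open>(9/8) u\<close>, because \<open>u\<close> and the square root are at most
  \<open>1/2\<close>, and \<open>(9/8) ^ 4 \<le> 2\<close>.
\<close>

lemma rho_level_power:
  fixes u :: real assumes u: "0 \<le> u" "u \<le> 1/2"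
  shows "(u + 1/2 * sqrt (u * (1 - u))) ^ 8 \<le> u ^ 3"
proof -
  define q where "q = sqrt (u * (1 - u))"
  have q: "q\<^sup>2 = u * (1 - u)" "q \<le> 1/2" using u sqrt_half[of u] by (simp_all add: q_def)
  define v where "v = (u + 1/2 * q)\<^sup>2"
  have "v = u * u + u * q + 1/4 * q\<^sup>2" by (simp add: v_def power2_eq_square algebra_simps)
  also have "\<dots> = u * (u + q + 1/4 * (1 - u))" unfolding q(1) by (simp add: algebra_simps)
  also have "\<dots> \<le> u * (9/8)" 
  proof (rule mult_left_mono)
    have "1/4 * (1 - u) = 1/4 - u/4" by simp
    then show "u + q + 1/4 * (1 - u) \<le> 9/8" using q(2) u by linarith
  qed (rule u(1))
  finally have "v \<le> u * (9/8)" .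
  moreover have "0 \<le> v" by (simp add: v_def)
  ultimately have "v ^ 4 \<le> (u * (9/8)) ^ 4" by (rule power_mono)
  also have "(u * (9/8)) ^ 4 = u ^ 3 * (u * (6561/4096))"
    by (simp add: power_mult_distrib power_divide power4_eq_xxxx power3_eq_cube)
  also have "\<dots> \<le> u ^ 3 * 1" using u by (intro mult_left_mono) auto
  finally have "v ^ 4 \<le> u ^ 3" by simp
  then show ?thesis unfolding v_def q_def by (simp flip: power_mult)
qed

end

section \<open>Comparison of the mixing and exit times\<close>

locale rev_ct_chain = rev_chain P w + ct_chain P Pr X
  for P :: "real^'a::finite^'a" and w :: "real^'a"
    and Pr :: "'a \<Rightarrow> 'w measure" and X :: "real \<Rightarrow> 'w \<Rightarrow> 'a" +
  assumes card: "2 \<le> CARD('a)"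
begin

abbreviation Con :: "'a set set" where "Con \<equiv> Con_half w Pr X"

lemma Con_iff: "A \<in> Con \<longleftrightarrow> connected_set Pr X A \<and> mass w A \<le> 1/2"
  by (simp add: Con_half_def)

lemma Con_nonempty: "A \<in> Con \<Longrightarrow> A \<noteq> {}"
  by (simp add: Con_half_def connected_set_def)

lemma component_Con:
  assumes "x \<in> A" "mass w A \<le> 1/2" shows "component A x \<in> Con"
proof -
  have "connected_set Pr X (component A x)"
    using component_self[of x A] component_positive[OF assms(1)] by (intro connected_setI) auto
  moreover have "mass w (component A x) \<le> 1/2"
    using mass_mono[OF component_subset[OF assms(1)]] assms(2) by linarith
  ultimately show ?thesis by (simp add: Con_iff)
qed

text \<open>
  The conditions that define \<^const>\<open>rho_at\<close> and \<^const>\<open>rho_bar_at\<close>, with the allowed survival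
  probability \<open>c\<close> as a parameter.
\<close>

definition exits :: "(real \<Rightarrow> real) \<Rightarrow> 'a \<Rightarrow> real \<Rightarrow> bool" where
  "exits c x t \<longleftrightarrow> 0 \<le> t \<and> (\<forall>A\<in>Con. survival A t x \<le> c (mass w A))"

definition rho_level :: "real \<Rightarrow> real" where "rho_level u = u + 1/2 * sqrt (u * (1 - u))"

definition rho_bar_level :: "real \<Rightarrow> real" where "rho_bar_level u = u ^ 3"

lemma rho_at_eq: "rho_at w Pr X x = (LEAST t. exits rho_level x t)"
  unfolding rho_at_def exits_def rho_level_def mass_Compl
  by (rule arg_cong[where f = Least]) (auto simp: fun_eq_iff tail_prob survival_def)

lemma rho_bar_at_eq: "rho_bar_at w Pr X x = (LEAST t. exits rho_bar_level x t)"
  unfolding rho_bar_at_def exits_def rho_bar_level_def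
  by (rule arg_cong[where f = Least]) (auto simp: fun_eq_iff tail_prob survival_def)

definition mixed :: "'a \<Rightarrow> real \<Rightarrow> bool" where
  "mixed x t \<longleftrightarrow> 0 \<le> t \<and> l2_dist x t \<le> 1/2"

lemma tau2_at_eq: "tau2_at P w x = (LEAST t. mixed x t)"
  unfolding tau2_at_def mixed_def
  by (rule arg_cong[where f = Least]) (auto simp: fun_eq_iff norm_2_heat_kernel)

lemma closed_exits: "closed {t. exits c x t}"
proof -
  have "{t. exits c x t} = {0..} \<inter> (\<Inter>A\<in>Con. {t. survival A t x \<le> c (mass w A)})"
    by (auto simp: exits_def)
  moreover have "closed {t. survival A t x \<le> c (mass w A)}" for A
    unfolding survival_def by (intro closed_Collect_le continuous_flow continuous_on_const)
  ultimately show ?thesis by (simp only:) (intro closed_Int closed_atLeast closed_INT ballI)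
qed

lemma closed_mixed: "closed {t. mixed x t}"
proof -
  have "{t. mixed x t} = {0..} \<inter> {t. l2_dist x t \<le> 1/2}" by (auto simp: mixed_def)
  moreover have "closed {t. l2_dist x t \<le> 1/2}"
    unfolding l2_dist_def rel_density_def
    by (intro closed_Collect_le continuous_intros continuous_flow)
  ultimately show ?thesis by auto
qed

lemma exits_ge0: "exits c x t \<Longrightarrow> 0 \<le> t" and mixed_ge0: "mixed x t \<Longrightarrow> 0 \<le> t"
  by (simp_all add: exits_def mixed_def)

text \<open>
  Replacing \<open>A\<close> by the component of the starting point leaves survival unchanged and does not increase
  the mass.
\<close>

lemma exits_all:
  assumes e: "exits c x t" and A: "mass w A \<le> 1/2"
    and c: "0 \<le> c (mass w A)" "\<And>u. 0 \<le> u \<Longrightarrow> u \<le> mass w A \<Longrightarrow> c u \<le> c (mass w A)"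
  shows "survival A t x \<le> c (mass w A)"
proof (cases "x \<in> A")
  case False
  then have "survival A t x \<le> 0" using survival_le_ind[OF exits_ge0[OF e], of A x] by (simp add: ind_def)
  then show ?thesis using c(1) by linarith
next
  case True
  have "survival A t x = survival (component A x) t x" unfolding survival_def by (rule component_tail[OF True])
  also have "\<dots> \<le> c (mass w (component A x))" using e component_Con[OF True A] by (simp add: exits_def)
  also have "\<dots> \<le> c (mass w A)" by (rule c(2)[OF mass_nonneg mass_mono[OF component_subset[OF True]]])
  finally show ?thesis .
qed

text \<open>
  Take an eigenfunction \<open>g\<close> for the gap, with sign such that \<open>{x. 0 < g x}\<close> has mass at most \<open>1/2\<close>,
  and the component \<open>C\<close> of its maximum point in that set. Cutting \<open>g\<close> off outside \<open>C\<close> only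
  discards non-positive values seen from \<open>C\<close>, so the cut-off function is a supersolution for the killed chain;
  comparing it with its maximum at \<open>x\<close> gives the rate.
\<close>

lemma gap_rate:
  obtains l C x where "is_gap l" "C \<in> Con" "\<forall>t\<ge>0. exp (- l * t) \<le> survival C t x"
proof -
  obtain l f where gap: "is_gap l"
    and f: "(\<Sum>x\<in>UNIV. w $ x * f x) = 0" "\<exists>x. f x \<noteq> 0" "\<forall>x. app p f x = (1 - l) * f x"
    using gap_eigenfunction[OF card] by blast
  have pos: "\<exists>x. 0 < g x" if "(\<Sum>x\<in>UNIV. w $ x * g x) = 0" "\<exists>x. g x \<noteq> 0" for g
  proof (rule ccontr)
    assume n: "\<not> (\<exists>x. 0 < g x)"
    have "(\<Sum>x\<in>UNIV. w $ x * (- g x)) = 0" using that(1) by (simp add: sum_negf)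
    then have "\<forall>x. w $ x * (- g x) = 0"
      using n by (subst (asm) sum_nonneg_eq_0_iff) (auto simp: not_less intro!: mult_nonneg_nonpos w_nonneg)
    then have z: "w $ x * (- g x) = 0" for x by blast
    have "g x = 0" for x
    proof -
      have "w $ x \<noteq> 0" using w_pos[of x] by simp
      then show ?thesis using z[of x] by simp
    qed
    then show False using that(2) by simp
  qed
  obtain g where g: "mass w {x. 0 < g x} \<le> 1/2" "\<exists>x. 0 < g x" "\<And>x. app p g x = (1 - l) * g x"
  proof (cases "mass w {x. 0 < f x} \<le> 1/2")
    case True
    then show ?thesis using that[of f] pos[OF f(1,2)] f(3) by blast
  next
    case False
    let ?g = "\<lambda>x. (- 1) * f x"
    have "mass w {x. 0 < ?g x} \<le> mass w (- {x. 0 < f x})" by (intro mass_mono) auto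
    then have "mass w {x. 0 < ?g x} \<le> 1/2" using False by (simp add: mass_Compl)
    moreover have "\<exists>x. 0 < ?g x" using f(1,2) by (intro pos) (auto simp: sum_negf)
    moreover have "app p ?g x = (1 - l) * ?g x" for x unfolding app_cmult using f(3) by simp
    ultimately show ?thesis using that[of ?g] by blast
  qed
  let ?A = "{x. 0 < g x}"
  obtain x where x: "g x = Max (range g)" using Max_in[of "range g"] by fastforce
  have max: "g y \<le> g x" for y unfolding x by simp
  have xA: "x \<in> ?A" using g(2) max by (auto intro: less_le_trans)
  let ?C = "component ?A x"
  let ?h = "\<lambda>y. ind ?C y * g y"
  have CA: "?C \<subseteq> ?A" by (rule component_subset[OF xA])
  have h0: "0 \<le> ?h y" for y using CA by (auto simp: ind_def)
  have h1: "?h y \<le> g x * ind ?C y" for y using max by (simp add: ind_def)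
  have "exp (- l * t) \<le> survival ?C t x" if t: "0 \<le> t" for t
  proof -
    \<comment> \<open>the eigenvalue \<open>1 - l\<close> of \<open>P\<close> may be negative; then \<open>0\<close> serves, and the rate \<open>1\<close> is below \<open>l\<close>\<close>
    let ?c = "max 0 (1 - l)"
    have "?c * ?h y \<le> app (restr ?C p) ?h y" for y
    proof (cases "y \<in> ?C \<and> 0 \<le> 1 - l")
      case False
      then have e: "?c * ?h y = 0" by (auto simp: ind_def)
      show ?thesis unfolding e by (rule app_nonneg[OF rp_nonneg h0])
    next
      case True
      then have "?c * ?h y = app p g y" by (simp add: ind_def g(3))
      also have "\<dots> \<le> app (restr ?C p) ?h y"
        unfolding app_def
      proof (rule sum_mono)
        fix z
        show "p y z * g z \<le> restr ?C p y z * ?h z"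
        proof (cases "z \<in> ?C")
          case False
          have "p y z * g z \<le> 0"
          proof (cases "z \<in> ?A")
            case True
            then show ?thesis using component_step[OF _ xA True False] \<open>y \<in> ?C \<and> 0 \<le> 1 - l\<close> by simp
          qed (simp add: mult_nonneg_nonpos p_nonneg)
          then show ?thesis using False by (simp add: restr_def)
        qed (use True in \<open>simp add: restr_def ind_def\<close>)
      qed
      finally show ?thesis .
    qed
    then have "exp (- ((1 - ?c) * t)) * ?h x \<le> flow (restr ?C p) t ?h x"
      by (intro flow_supersolution t rp_nonneg h0) auto
    also have "\<dots> \<le> flow (restr ?C p) t (\<lambda>y. g x * ind ?C y) x"
      by (rule flow_mono[OF t]) (use h0 h1 rp_nonneg in auto)
    also have "\<dots> = g x * survival ?C t x" by (simp add: flow_cmult survival_def)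
    finally have "exp (- ((1 - ?c) * t)) * g x \<le> survival ?C t x * g x"
      using component_self[of x ?A] by (simp add: ind_def mult.commute)
    then have "exp (- ((1 - ?c) * t)) \<le> survival ?C t x" using xA by simp
    moreover have "(1 - ?c) * t \<le> l * t" using t by (intro mult_right_mono) auto
    ultimately show ?thesis using order_trans[of "exp (- l * t)" "exp (- ((1 - ?c) * t))"] by simp
  qed
  then show ?thesis using that[of l ?C x] gap component_Con[OF xA g(1)] by blast
qed

lemma t_rel_pos: "0 < t_rel P"
proof -
  obtain l where "is_gap l" using gap_rate by blast
  then show ?thesis by (simp add: is_gap_def)
qed

text \<open>
  The time \<open>2 K / l\<close> is convenient since \<open>K exp (- 4 K) \<le> 1/4\<close> for every \<open>K\<close>.
\<close>

lemma mixed_exists: "\<exists>t. mixed x t"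
proof -
  obtain l where gap: "is_gap l" using gap_rate by blast
  then have l: "0 < l" by (simp add: is_gap_def)
  define K where "K = (\<Sum>y\<in>UNIV. w $ y * (rel_density x 0 y)\<^sup>2)"
  have K0: "0 \<le> K" by (simp add: K_def sum_nonneg w_nonneg)
  define t where "t = 2 * K / l"
  have t: "0 \<le> t" using K0 l by (simp add: t_def)
  have "(\<Sum>y\<in>UNIV. w $ y * (rel_density x t y)\<^sup>2) \<le> exp (- 2 * l * t) * K"
    using gap_decay[OF gap rel_density_mean[OF order_refl] t] flow_semigroup[OF t order_refl]
    by (simp add: K_def rel_density_def)
  also have "\<dots> = K / exp (4 * K)" using l by (simp add: t_def exp_minus field_simps)
  also have "\<dots> \<le> 1/4"
  proof -
    have "4 * K \<le> exp (4 * K)" using exp_ge_add_one_self[of "4 * K"] by linarith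
    then show ?thesis by (simp add: field_simps)
  qed
  finally have "l2_dist x t \<le> sqrt (1/4)" unfolding l2_dist_def by (rule real_sqrt_le_mono)
  also have "sqrt (1/4) = (1/2::real)" by (simp add: real_sqrt_divide)
  finally show ?thesis using t by (auto simp: mixed_def)
qed

lemma mixed_tau2: "mixed x (tau2_at P w x)" "mixed x t \<Longrightarrow> tau2_at P w x \<le> t"
proof -
  obtain t0 where t0: "mixed x t0" using mixed_exists by blast
  note least = real_Least[OF closed_mixed t0]
  show "mixed x (tau2_at P w x)" unfolding tau2_at_eq by (rule least(1)) (rule mixed_ge0)
  show "mixed x t \<Longrightarrow> tau2_at P w x \<le> t" unfolding tau2_at_eq by (rule least(2)) (rule mixed_ge0)
qed

lemma mixed_exits: "mixed x t \<Longrightarrow> exits rho_level x t"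
  unfolding mixed_def exits_def rho_level_def using survival_le_of_l2_dist by blast

lemma exits_rho: "exits rho_level x (rho_at w Pr X x)" "exits rho_level x t \<Longrightarrow> rho_at w Pr X x \<le> t"
proof -
  note least = real_Least[OF closed_exits mixed_exits[OF mixed_tau2(1)[of x]]]
  show "exits rho_level x (rho_at w Pr X x)" unfolding rho_at_eq by (rule least(1)) (rule exits_ge0)
  show "exits rho_level x t \<Longrightarrow> rho_at w Pr X x \<le> t" unfolding rho_at_eq by (rule least(2)) (rule exits_ge0)
qed

lemma rho_le_tau2: "rho_at w Pr X x \<le> tau2_at P w x"
  by (rule exits_rho(2)[OF mixed_exits[OF mixed_tau2(1)]])

lemma kappa_bound:
  assumes A: "A \<in> Con"
  shows "\<bar>ln (mass w A)\<bar> / lambda_on P A \<le> kappa P w Pr X"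
  unfolding kappa_def by (rule Max_ge) (use A in auto)

lemma lambda_pos:
  assumes A: "A \<in> Con" shows "0 < lambda_on P A"
proof (rule lambda_on_props(2)[OF Con_nonempty[OF A]])
  show "A \<noteq> UNIV" using A mass_UNIV by (auto simp: Con_iff)
qed

lemma kappa_nonneg: "0 \<le> kappa P w Pr X"
proof -
  obtain C where C: "C \<in> Con" using gap_rate by blast
  have "0 \<le> \<bar>ln (mass w C)\<bar> / lambda_on P C" using lambda_pos[OF C] by simp
  then show ?thesis using kappa_bound[OF C] by linarith
qed

text \<open>
  With \<open>u\<close> the mass of \<open>A\<close> and \<open>s = 8 \<kappa>\<close>, the squared norm of \<open>survival A s\<close> is at most \<open>u ^ 17\<close>, so
  the set \<open>B\<close> where it exceeds \<open>u ^ 3 / 2\<close> has mass at most \<open>4 u ^ 11 \<le> u ^ 6 / 8\<close>. Not leaving \<open>B\<close> by time \<open>r\<close>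
  thus has probability at most \<open>u ^ 3 / 2\<close>, and the strong Markov property at the exit from \<open>B\<close>
  contributes the other half.
\<close>

lemma exits_rho_bar_level:
  assumes e: "exits rho_level x r" shows "exits rho_bar_level x (r + 8 * kappa P w Pr X)"
proof -
  define s where "s = 8 * kappa P w Pr X"
  have s: "0 \<le> s" using kappa_nonneg by (simp add: s_def)
  have r: "0 \<le> r" using e by (rule exits_ge0)
  have "survival A (r + s) x \<le> mass w A ^ 3" if A: "A \<in> Con" for A
  proof -
    define u where "u = mass w A"
    have u: "0 < u" "u \<le> 1/2" using mass_pos[OF Con_nonempty[OF A]] A by (auto simp: u_def Con_iff)
    define B where "B = {y. survival A s y > u ^ 3 / 2}"
    have BA: "B \<subseteq> A"
    proof
      fix y assume "y \<in> B"
      then have "u ^ 3 / 2 < survival A s y" by (simp add: B_def)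
      moreover have "0 < u ^ 3 / 2" using u by simp
      ultimately have "0 < survival A s y" by linarith
      then show "y \<in> A" using survival_le_ind[OF s, of A y] by (auto simp: ind_def split: if_splits)
    qed
    have lam: "exp (- 2 * lambda_on P A * s) \<le> u ^ 16"
    proof -
      have "- ln u / lambda_on P A \<le> kappa P w Pr X"
        using kappa_bound[OF A] u by (simp add: u_def[symmetric])
      then have "- ln u \<le> lambda_on P A * kappa P w Pr X"
        using lambda_pos[OF A] by (simp add: field_simps)
      then have "- 2 * lambda_on P A * s \<le> 16 * ln u" by (simp add: s_def algebra_simps)
      then have "exp (- 2 * lambda_on P A * s) \<le> exp (16 * ln u)" by simp
      also have "exp (16 * ln u) = u ^ 16"
        using exp_of_nat_mult[of 16 "ln u"] u by simp
      finally show ?thesis .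
    qed
    have "mass w B * (u ^ 3 / 2)\<^sup>2 \<le> (\<Sum>y\<in>UNIV. w $ y * (survival A s y)\<^sup>2)"
    proof -
      have "mass w B * (u ^ 3 / 2)\<^sup>2 \<le> (\<Sum>y\<in>B. w $ y * (survival A s y)\<^sup>2)"
        unfolding mass_def sum_distrib_right
        by (intro sum_mono mult_left_mono power_mono w_nonneg) (use u in \<open>auto simp: B_def\<close>)
      also have "\<dots> \<le> (\<Sum>y\<in>UNIV. w $ y * (survival A s y)\<^sup>2)"
        by (intro sum_mono2) (auto intro!: mult_nonneg_nonneg w_nonneg)
      finally show ?thesis .
    qed
    also have "\<dots> \<le> exp (- 2 * lambda_on P A * s) * u"
      unfolding u_def by (rule survival_decay[OF Con_nonempty[OF A] s])
    also have "\<dots> \<le> u ^ 16 * u" using lam u by (intro mult_right_mono) auto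
    also have "\<dots> = u ^ 6 * u ^ 11" by (simp flip: power_add power_Suc2)
    finally have "u ^ 6 * mass w B \<le> u ^ 6 * (4 * u ^ 11)"
      by (simp add: power_divide algebra_simps flip: power_mult)
    then have "mass w B \<le> 4 * u ^ 11" using u by simp
    also have "\<dots> = 4 * u ^ 5 * u ^ 6" by (simp flip: power_add)
    also have "\<dots> \<le> 4 * (1/2) ^ 5 * u ^ 6"
      using u by (intro mult_right_mono mult_left_mono power_mono) auto
    finally have B6: "mass w B \<le> u ^ 6 / 8" by (simp add: power_divide)
    have u3: "0 < u ^ 3" "u ^ 3 \<le> 1/8"
      using u power_mono[of u "1/2" 3] by (auto simp: power_divide)
    have sq: "u ^ 6 = (u ^ 3)\<^sup>2" by (simp flip: power_mult)
    define b where "b = (u ^ 3 / 2)\<^sup>2"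
    have "mass w B \<le> (u ^ 3)\<^sup>2 / 8" using B6 by (simp only: sq)
    also have "\<dots> \<le> (u ^ 3)\<^sup>2 / 4" by (intro divide_left_mono) auto
    also have "\<dots> = b" by (simp add: b_def power_divide)
    finally have Bb: "mass w B \<le> b" .
    have b: "0 \<le> b" "sqrt b = u ^ 3 / 2" "b \<le> u ^ 3 / 32"
    proof -
      have "(v / 2)\<^sup>2 \<le> v / 32" if "0 < v" "v \<le> 1/8" for v :: real
        using mult_left_mono[OF that(2), of v] that(1) by (simp add: power2_eq_square)
      from this[OF u3] show "b \<le> u ^ 3 / 32" by (simp only: b_def)
      show "0 \<le> b" by (simp add: b_def)
      have "0 \<le> u ^ 3 / 2" using u3 by simp
      then show "sqrt b = u ^ 3 / 2" unfolding b_def by (simp only: real_sqrt_abs abs_of_nonneg)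
    qed
    have B12: "mass w B \<le> 1/2" using Bb b u3 by linarith
    \<comment> \<open>dropping the factor \<open>1 - u\<close> makes the level monotone on the whole half-line\<close>
    have "exits (\<lambda>v. v + 1/2 * sqrt v) x r"
      unfolding exits_def
    proof (intro conjI r ballI)
      fix D assume D: "D \<in> Con"
      have "survival D r x \<le> mass w D + 1/2 * sqrt (mass w D * (1 - mass w D))"
        using e D by (simp add: exits_def rho_level_def)
      also have "mass w D * (1 - mass w D) \<le> mass w D * 1"
        using mass_nonneg[of D] by (intro mult_left_mono) auto
      finally show "survival D r x \<le> mass w D + 1/2 * sqrt (mass w D)" by simp
    qed
    then have "survival B r x \<le> mass w B + 1/2 * sqrt (mass w B)"
      by (rule exits_all[OF _ B12]) (auto simp: mass_nonneg add_mono)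
    also have "\<dots> \<le> b + 1/2 * sqrt b" using Bb by (simp add: add_mono)
    also have "\<dots> \<le> u ^ 3 / 2" using b u3 by linarith
    finally have kB: "survival B r x \<le> u ^ 3 / 2" .
    have "flow (restr A p) r (survival A s) x \<le> flow (restr B (restr A p)) r (ind B) x + u ^ 3 / 2"
    proof (rule strong_markov_bound[OF substoch_restr[OF p_substoch] r])
      show "0 \<le> u ^ 3 / 2" using u3 by simp
      show "0 \<le> survival A s y" for y by (rule survival_nonneg[OF s])
      show "survival A s y \<le> 1" for y using survival_le_ind[OF s, of A y] by (auto simp: ind_def split: if_splits)
      show "flow (restr A p) q (survival A s) y \<le> u ^ 3 / 2" if "0 \<le> q" "y \<notin> B" for q y
      proof -
        have "flow (restr A p) q (survival A s) y = survival A (q + s) y" using survival_add[OF that(1) s] by simp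
        also have "\<dots> \<le> survival A s y" using that(1) s by (intro survival_antimono) auto
        also have "\<dots> \<le> u ^ 3 / 2" using that(2) by (simp add: B_def not_less)
        finally show ?thesis .
      qed
    qed
    then have "survival A (r + s) x \<le> survival B r x + u ^ 3 / 2"
      unfolding survival_add[OF r s] restr_restr[OF BA] by (simp add: survival_def)
    then show ?thesis using kB by (simp add: u_def[symmetric])
  qed
  then show ?thesis using r s by (simp add: exits_def rho_bar_level_def s_def)
qed

lemma exits_rho_bar: "exits rho_bar_level x (rho_bar_at w Pr X x)" "exits rho_bar_level x t \<Longrightarrow> rho_bar_at w Pr X x \<le> t"
proof -
  note least = real_Least[OF closed_exits exits_rho_bar_level[OF exits_rho(1)[of x]]]
  show "exits rho_bar_level x (rho_bar_at w Pr X x)" unfolding rho_bar_at_eq by (rule least(1)) (rule exits_ge0)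
  show "exits rho_bar_level x t \<Longrightarrow> rho_bar_at w Pr X x \<le> t" unfolding rho_bar_at_eq by (rule least(2)) (rule exits_ge0)
qed

lemma rho_bar_le: "rho_bar_at w Pr X x \<le> rho_at w Pr X x + 8 * kappa P w Pr X"
  by (rule exits_rho_bar(2)[OF exits_rho_bar_level[OF exits_rho(1)]])

lemma tau2_le_rho_bar: "tau2_at P w x \<le> rho_bar_at w Pr X x + 5 * t_rel P"
proof -
  obtain l where gap: "is_gap l" using gap_rate by blast
  then have l: "0 < l" "t_rel P = 1 / l" by (simp_all add: is_gap_def)
  define t where "t = rho_bar_at w Pr X x"
  have e: "exits rho_bar_level x t" and t: "0 \<le> t" using exits_rho_bar(1) exits_ge0 by (auto simp: t_def)
  have "l2_dist x (t + 5 / l) \<le> 1/2"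
  proof (rule l2_dist_le_half[OF gap t])
    show "survival A t x \<le> mass w A ^ 3" if "mass w A \<le> 1/2" for A
      using exits_all[OF e that] mass_nonneg by (simp add: rho_bar_level_def power_mono)
  qed
  then have "mixed x (t + 5 / l)" using t l by (simp add: mixed_def)
  then show ?thesis using mixed_tau2(2) l by (simp add: t_def)
qed

lemma rho_at_le: "rho_at w Pr X x \<le> (rho w Pr X)"
  unfolding rho_def by (rule Max_ge) auto

lemma rho_nonneg: "0 \<le> (rho w Pr X)"
  using rho_at_le exits_ge0[OF exits_rho(1)] by (rule order_trans[rotated])

lemma survival_rho: "A \<in> Con \<Longrightarrow> survival A (rho w Pr X) x \<le> rho_level (mass w A)"
proof -
  assume A: "A \<in> Con"
  have "survival A (rho w Pr X) x \<le> survival A (rho_at w Pr X x) x"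
    by (rule survival_antimono[OF exits_ge0[OF exits_rho(1)] rho_at_le])
  also have "\<dots> \<le> rho_level (mass w A)" using exits_rho(1) A by (simp add: exits_def)
  finally show ?thesis .
qed

lemma rho_bar_le_8: "rho_bar_at w Pr X x \<le> 8 * (rho w Pr X)"
proof (rule exits_rho_bar(2))
  show "exits rho_bar_level x (8 * (rho w Pr X))"
    unfolding exits_def
  proof (intro conjI ballI)
    show "0 \<le> 8 * (rho w Pr X)" using rho_nonneg by simp
    fix A assume A: "A \<in> Con"
    have m: "0 \<le> mass w A" "mass w A \<le> 1/2" using A mass_nonneg by (auto simp: Con_iff)
    have c: "0 \<le> rho_level (mass w A)" using m by (simp add: rho_level_def)
    have "survival A (real 8 * (rho w Pr X)) x \<le> rho_level (mass w A) ^ 8 * ind A x"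
      by (rule survival_power[OF rho_nonneg c survival_rho[OF A]])
    also have "\<dots> \<le> rho_level (mass w A) ^ 8 * 1" by (rule mult_left_mono) (auto simp: ind_def)
    also have "\<dots> \<le> rho_bar_level (mass w A)" using rho_level_power[OF m] by (simp add: rho_level_def rho_bar_level_def)
    finally show "survival A (8 * (rho w Pr X)) x \<le> rho_bar_level (mass w A)" by simp
  qed
qed

text \<open>
  In the slowly left set of lemma \<open>gap_rate\<close> survival at time \<open>\<rho>\<close> has probability at most \<open>3/4\<close>, so
  \<open>exp (- l \<rho>) \<le> 3/4\<close>, while \<open>exp (- l \<rho>) \<ge> 1 - l \<rho>\<close>.
\<close>

lemma t_rel_le: "t_rel P \<le> 4 * (rho w Pr X)"
proof -
  obtain l C x where gap: "is_gap l" and C: "C \<in> Con"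
    and slow: "\<forall>t\<ge>0. exp (- l * t) \<le> survival C t x"
    using gap_rate by blast
  have l: "0 < l" "t_rel P = 1 / l" using gap by (simp_all add: is_gap_def)
  have m: "0 \<le> mass w C" "mass w C \<le> 1/2" using C mass_nonneg by (auto simp: Con_iff)
  have "1 - l * (rho w Pr X) \<le> exp (- l * (rho w Pr X))" using exp_ge_add_one_self[of "- l * (rho w Pr X)"] by simp
  also have "\<dots> \<le> survival C (rho w Pr X) x" using slow rho_nonneg by blast
  also have "\<dots> \<le> rho_level (mass w C)" by (rule survival_rho[OF C])
  also have "\<dots> \<le> 3/4" using m sqrt_half[of "mass w C"] by (simp add: rho_level_def)
  finally have "1 \<le> 4 * (l * (rho w Pr X))" by simp
  then have "1 / l \<le> 4 * (l * (rho w Pr X)) / l" using l(1) by (intro divide_right_mono) auto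
  then show ?thesis using l by simp
qed

end

theorem theorem5p1:
  fixes P :: "real^'a::finite^'a" and \<pi> :: "real^'a"
    and Pr :: "'a \<Rightarrow> 'w measure" and X :: "real \<Rightarrow> 'w \<Rightarrow> 'a"
  assumes "2 \<le> CARD('a)"
    and "transition_matrix P" and "irreducible_matrix P"
    and "stationary_distribution P \<pi>" and "reversible_wrt P \<pi>"
    and "continuous_time_chain P Pr X"
  shows "(\<forall>x. rho_at \<pi> Pr X x \<le> tau2_at P \<pi> x \<and>
              tau2_at P \<pi> x \<le> rho_bar_at \<pi> Pr X x + 5 * t_rel P \<and>
              rho_bar_at \<pi> Pr X x + 5 * t_rel P
                \<le> rho_at \<pi> Pr X x + 8 * kappa P \<pi> Pr X + (5 + 6 * ln 2) * t_rel P) \<and>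
         (rho \<pi> Pr X \<le> tau2 P \<pi> \<and>
          tau2 P \<pi> \<le> rho_bar \<pi> Pr X + 5 * t_rel P \<and>
          rho_bar \<pi> Pr X + 5 * t_rel P
            \<le> rho \<pi> Pr X + 8 * kappa P \<pi> Pr X + (5 + 6 * ln 2) * t_rel P) \<and>
         (rho \<pi> Pr X \<le> tau2 P \<pi> \<and> tau2 P \<pi> \<le> (9 + 15 / ln 2) * rho \<pi> Pr X)"
proof -
  interpret rev_ct_chain P \<pi> Pr X
    using assms by unfold_locales
  have ln0: "0 \<le> 6 * ln 2 * t_rel P" using t_rel_pos by simp
  have 1: "rho_bar_at \<pi> Pr X x + 5 * t_rel P \<le> rho_at \<pi> Pr X x + 8 * kappa P \<pi> Pr X + (5 + 6 * ln 2) * t_rel P" for x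
    using rho_bar_le[of x] ln0 unfolding distrib_right by linarith
  have tau: "tau2_at P \<pi> x \<le> tau2 P \<pi>" and rb: "rho_bar_at \<pi> Pr X x \<le> rho_bar \<pi> Pr X" for x
    unfolding tau2_def rho_bar_def by (rule Max_ge; simp)+
  have 2: "rho \<pi> Pr X \<le> tau2 P \<pi>"
    unfolding rho_def by (rule Max.boundedI) (auto intro: order_trans[OF rho_le_tau2 tau])
  have 3: "tau2 P \<pi> \<le> rho_bar \<pi> Pr X + 5 * t_rel P"
    unfolding tau2_def
  proof (rule Max.boundedI)
    fix a assume "a \<in> range (tau2_at P \<pi>)"
    then obtain x where "a = tau2_at P \<pi> x" by auto
    then show "a \<le> rho_bar \<pi> Pr X + 5 * t_rel P" using tau2_le_rho_bar[of x] rb[of x] by linarith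
  qed auto
  have 4: "rho_bar \<pi> Pr X \<le> rho \<pi> Pr X + 8 * kappa P \<pi> Pr X"
    unfolding rho_bar_def
  proof (rule Max.boundedI)
    fix a assume "a \<in> range (rho_bar_at \<pi> Pr X)"
    then obtain x where "a = rho_bar_at \<pi> Pr X x" by auto
    then show "a \<le> rho \<pi> Pr X + 8 * kappa P \<pi> Pr X"
      using rho_bar_le[of x] rho_at_le[of x] by simp
  qed auto
  have "rho_bar \<pi> Pr X \<le> 8 * rho \<pi> Pr X"
    unfolding rho_bar_def by (rule Max.boundedI) (auto intro: rho_bar_le_8)
  then have "tau2 P \<pi> \<le> 28 * rho \<pi> Pr X" using 3 t_rel_le by linarith
  also have "\<dots> \<le> (9 + 15 / ln 2) * rho \<pi> Pr X"
  proof (rule mult_right_mono[OF _ rho_nonneg])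
    have "19 * ln 2 \<le> (15::real)" using ln2_le_25_over_36 by simp
    then show "28 \<le> 9 + 15 / ln (2::real)" by (simp add: field_simps)
  qed
  finally have 5: "tau2 P \<pi> \<le> (9 + 15 / ln 2) * rho \<pi> Pr X" .
  have 6: "rho_bar \<pi> Pr X + 5 * t_rel P \<le> rho \<pi> Pr X + 8 * kappa P \<pi> Pr X + (5 + 6 * ln 2) * t_rel P"
    using 4 ln0 unfolding distrib_right by linarith
  show ?thesis using rho_le_tau2 tau2_le_rho_bar 1 2 3 5 6 by blast
qed

end
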